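(* Let $k\ge2$ and $N\ge 1$ be integers. Suppose a finite set of oriented circles is given, with the $j$-th circle of color $i$ ($1\le i\le k$) having length $l_{ij}>0$, all circles being distinguishable. Let $$F(N,l_{ij})=\sum_C \mathrm{Vol}(C)\,N^{\chi(C)},$$ the sum over all topological types $C$ of (not necessarily connected) circle constellations glued from exactly these circles, without isolated circles, and in which no three circles share a common point; here $\mathrm{Vol}(C)$ is the volume of the space of circle constellations of type $C$ and $\chi(C)$ is the Euler characteristic of the (not necessarily connected) surface of the natural embedding. Let $E$, $H$ be as follows: $E$ is the real vector space of $k$-tuples $(A_1,\dots,A_k)$ of complex $N\times N$ matrices with $A_i=X+Y_i$, $X$ hermitian, $Y_i$ skew-hermitian, $\sum_i Y_i=0$; $H(A_1,\dots,A_k)=\sum_{i,j}s_{ij}\mathrm{Tr}(A_iA_j)$ with $(s_{ij})=\frac{J-(k-1)I}{k-1}$, $I$ the $k\times k$ identity and $J$ the all-ones $k\times k$ matrix; and $d\lambda$ is a Lebesgue measure on $E$. Then both the series $F(N,l_{ij})$ and the integral below converge and $$F(N,l_{ij})=\frac{\displaystyle\int_E \prod_{i,j}\left(N\,\mathrm{Tr}\,\frac{e^{l_{ij}A_i}-1}{l_{ij}}\right)e^{-\frac12 N H}\,d\lambda}{\displaystyle\int_E e^{-\frac12 N H}\,d\lambda}.$$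
   Context: A circle constellation (here not necessarily connected) is an oriented graph with nonnegative edge lengths obtained by gluing together, at finitely many points, oriented circles of given lengths colored in colors $1,\dots,k$, such that no two circles of the same color share a point; it is naturally embedded in a compact oriented (possibly disconnected) surface so that cutting along the circles gives open discs, each circle bounds one disc and is oriented counterclockwise with respect to it, and the cyclic order of circles at every gluing point coincides with the increasing order of colors. An isolated circle is one glued to no other circle. The topological type of a circle constellation records, for each circle, its gluing points in the cyclic order along the circle and, for each such point, which circles are glued there, but not the arc lengths between gluing points. The space of circle constellations of a given type (no three circles sharing a point) is parametrized by the lengths of all but one of the arcs on each circle, and its volume is taken with respect to $|d\lambda_1\wedge\dots\wedge d\lambda_d|$ in these coordinates (constellations considered up to isomorphism). *)

theory Defs
  imports "HOL-Analysis.Analysis" "HOL-Combinatorics.Orbits"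
begin

section \<open>Circle constellations\<close>

text \<open>The colors \<open>1, \<dots>, k\<close> are a finite linearly ordered type \<open>'k\<close> with \<open>k\<close> elements; the pair
  \<open>(i, j)\<close> is the \<open>j\<close>-th circle of color \<open>i\<close>.\<close>

type_synonym 'k circle = "'k \<times> nat"

definition circles :: "('k \<Rightarrow> nat) \<Rightarrow> 'k circle set" where
  "circles m = (SIGMA i:UNIV. {1..m i})"

text \<open>The combinatorial data of a constellation: the gluing points, the circles through each of
  them, and, for each circle, the successor of a gluing point along that oriented circle. The names
  of the points are irrelevant; types are isomorphism classes of such data (see below).\<close>

record 'k gluing =
  points :: "nat set"
  circles_at :: "nat \<Rightarrow> 'k circle set"
  succ_on :: "'k circle \<Rightarrow> nat \<Rightarrow> nat"

definition points_on :: "'k gluing \<Rightarrow> 'k circle \<Rightarrow> nat set" where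
  "points_on D c = {p \<in> points D. c \<in> circles_at D p}"

definition constellation :: "'k circle set \<Rightarrow> 'k gluing \<Rightarrow> bool" where
  "constellation S D \<longleftrightarrow>
     finite (points D) \<and>
     (\<forall>p\<in>points D. circles_at D p \<subseteq> S \<and> 2 \<le> card (circles_at D p) \<and> inj_on fst (circles_at D p)) \<and>
     (\<forall>c\<in>S. points_on D c \<noteq> {} \<longrightarrow> cyclic_on (succ_on D c) (points_on D c))"

definition isolated :: "'k gluing \<Rightarrow> 'k circle \<Rightarrow> bool" where
  "isolated D c \<longleftrightarrow> points_on D c = {}"

definition no_triple_points :: "'k gluing \<Rightarrow> bool" where
  "no_triple_points D \<longleftrightarrow> (\<forall>p\<in>points D. card (circles_at D p) < 3)"

text \<open>The circles are distinguishable, so an isomorphism fixes each of them.\<close>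

definition gluing_iso :: "(nat \<Rightarrow> nat) \<Rightarrow> 'k gluing \<Rightarrow> 'k gluing \<Rightarrow> bool" where
  "gluing_iso f D D' \<longleftrightarrow>
     bij_betw f (points D) (points D') \<and>
     (\<forall>p\<in>points D. circles_at D' (f p) = circles_at D p \<and>
        (\<forall>c\<in>circles_at D p. succ_on D' c (f p) = f (succ_on D c p)))"

definition admissible :: "'k circle set \<Rightarrow> 'k gluing set" where
  "admissible S = {D. constellation S D \<and> (\<forall>c\<in>S. \<not> isolated D c) \<and> no_triple_points D}"

definition topological_types :: "'k circle set \<Rightarrow> 'k gluing set set" where
  "topological_types S =
     admissible S // {(D, D'). D \<in> admissible S \<and> D' \<in> admissible S \<and> (\<exists>f. gluing_iso f D D')}"


section \<open>Euler characteristic of the natural embedding\<close>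

text \<open>The pair \<open>(p, c)\<close> stands for the arc of the circle \<open>c\<close> that starts at the gluing point \<open>p\<close>.\<close>

definition arcs :: "'k gluing \<Rightarrow> (nat \<times> 'k circle) set" where
  "arcs D = {(p, c). p \<in> points D \<and> c \<in> circles_at D p}"

text \<open>The circle following \<open>c\<close> at \<open>p\<close> in the cyclic order of increasing colors.\<close>

definition next_color :: "'k::linorder gluing \<Rightarrow> nat \<Rightarrow> 'k circle \<Rightarrow> 'k circle" where
  "next_color D p c =
     (let A = circles_at D p; B = {b \<in> A. fst c < fst b}
      in if B \<noteq> {} then arg_min_on fst B else arg_min_on fst A)"

text \<open>Each circle has its disc on the left. With the discs at a gluing point arranged
  counterclockwise in the increasing order of colors, a face on the right of an arc of \<open>c\<close> ending
  at \<open>q\<close> is also on the right of the arc that starts at \<open>q\<close> on the circle following \<open>c\<close>. So the faces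
  that are not discs of circles are the orbits of \<open>face_step\<close> on the arcs, together with one outer
  disc for each isolated circle (whose component is a sphere).\<close>

definition face_step :: "'k::linorder gluing \<Rightarrow> nat \<times> 'k circle \<Rightarrow> nat \<times> 'k circle" where
  "face_step D = (\<lambda>(p, c). let q = succ_on D c p in (q, next_color D q c))"

text \<open>Vertices minus edges plus faces. (The closed edge of an isolated circle, which carries no
  vertex, has Euler characteristic 0.)\<close>

definition euler_char :: "'k::linorder circle set \<Rightarrow> 'k gluing \<Rightarrow> int" where
  "euler_char S D =
     int (card (points D)) - int (card (arcs D)) +
     int (card S + card (orbit (face_step D) ` arcs D) + card {c \<in> S. isolated D c})"


section \<open>Volumes\<close>

definition arc_lengths :: "'k circle set \<Rightarrow> ('k \<Rightarrow> nat \<Rightarrow> real) \<Rightarrow> 'k gluing \<Rightarrow>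
    (nat \<times> 'k circle \<Rightarrow> real) set" where
  "arc_lengths S l D =
     {x \<in> arcs D \<rightarrow>\<^sub>E {0..}. \<forall>(i, j)\<in>S. (\<Sum>p\<in>points_on D (i, j). x (p, (i, j))) = l i j}"

text \<open>All but one of the arcs on each circle. Which arc is omitted does not matter, since the change
  of coordinates has determinant \<open>\<plusminus>1\<close>.\<close>

definition coordinate_arcs :: "'k gluing \<Rightarrow> (nat \<times> 'k circle) set" where
  "coordinate_arcs D = {(p, c) \<in> arcs D. p \<noteq> Min (points_on D c)}"

definition coordinates :: "'k gluing \<Rightarrow> (nat \<times> 'k circle \<Rightarrow> real) \<Rightarrow> (nat \<times> 'k circle \<Rightarrow> real)" where
  "coordinates D x = restrict x (coordinate_arcs D)"

definition same_constellation :: "'k gluing \<Rightarrow> (nat \<times> 'k circle \<Rightarrow> real) \<Rightarrow>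
    (nat \<times> 'k circle \<Rightarrow> real) \<Rightarrow> bool" where
  "same_constellation D x x' \<longleftrightarrow>
     (\<exists>f. gluing_iso f D D \<and> (\<forall>(p, c)\<in>arcs D. x' (f p, c) = x (p, c)))"

text \<open>The coordinates of all length assignments isomorphic to the one with coordinates \<open>y\<close>.\<close>

definition iso_class :: "'k circle set \<Rightarrow> ('k \<Rightarrow> nat \<Rightarrow> real) \<Rightarrow> 'k gluing \<Rightarrow>
    (nat \<times> 'k circle \<Rightarrow> real) \<Rightarrow> (nat \<times> 'k circle \<Rightarrow> real) set" where
  "iso_class S l D y =
     {coordinates D x' | x x'. x \<in> arc_lengths S l D \<and> x' \<in> arc_lengths S l D \<and>
        coordinates D x = y \<and> same_constellation D x x'}"

text \<open>The volume of the quotient of the coordinate domain by isomorphism: Lebesgue measure, where a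
  (finite) isomorphism class with \<open>r\<close> points in the domain is counted once, i.e. each of its points
  with weight \<open>1 / r\<close>.\<close>

definition gluing_volume :: "'k circle set \<Rightarrow> ('k \<Rightarrow> nat \<Rightarrow> real) \<Rightarrow> 'k gluing \<Rightarrow> real" where
  "gluing_volume S l D =
     enn2real (\<integral>\<^sup>+ y \<in> coordinates D ` arc_lengths S l D.
       ennreal (1 / real (card (iso_class S l D y))) \<partial>(\<Pi>\<^sub>M a\<in>coordinate_arcs D. lborel))"

definition type_volume :: "'k circle set \<Rightarrow> ('k \<Rightarrow> nat \<Rightarrow> real) \<Rightarrow> 'k gluing set \<Rightarrow> real" where
  "type_volume S l C = gluing_volume S l (SOME D. D \<in> C)"

definition type_euler :: "'k::linorder circle set \<Rightarrow> 'k gluing set \<Rightarrow> int" where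
  "type_euler S C = euler_char S (SOME D. D \<in> C)"

definition F_term :: "nat \<Rightarrow> ('k::linorder \<Rightarrow> nat) \<Rightarrow> ('k \<Rightarrow> nat \<Rightarrow> real) \<Rightarrow> 'k gluing set \<Rightarrow> real" where
  "F_term N m l C = type_volume (circles m) l C * real N powi type_euler (circles m) C"

definition F :: "nat \<Rightarrow> ('k::linorder \<Rightarrow> nat) \<Rightarrow> ('k \<Rightarrow> nat \<Rightarrow> real) \<Rightarrow> real" where
  "F N m l = (\<Sum>\<^sub>\<infinity>C\<in>topological_types (circles m). F_term N m l C)"


section \<open>The matrix integral\<close>

definition conj_transpose :: "complex^'n^'n \<Rightarrow> complex^'n^'n" where
  "conj_transpose A = map_matrix cnj (transpose A)"

definition hermitian :: "complex^'n^'n \<Rightarrow> bool" where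
  "hermitian A \<longleftrightarrow> conj_transpose A = A"

definition skew_hermitian :: "complex^'n^'n \<Rightarrow> bool" where
  "skew_hermitian A \<longleftrightarrow> conj_transpose A = - A"

text \<open>The product of \<open>complex^'n^'n\<close> as a type class operation is componentwise, hence neither
  \<open>A ^ n\<close> nor \<open>exp\<close> can be used for matrices.\<close>

definition matrix_power :: "complex^'n^'n \<Rightarrow> nat \<Rightarrow> complex^'n^'n" where
  "matrix_power A r = ((\<lambda>B. A ** B) ^^ r) (mat 1)"

definition matrix_exp :: "complex^'n^'n \<Rightarrow> complex^'n^'n" where
  "matrix_exp A = (\<Sum>r. (1 / fact r) *\<^sub>R matrix_power A r)"

definition E_space :: "((complex^'n^'n)^'k) set" where
  "E_space = {A. \<exists>X Y. hermitian X \<and> (\<forall>i. skew_hermitian (Y i)) \<and> (\<Sum>i\<in>UNIV. Y i) = 0 \<and>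
     (\<forall>i. A $ i = X + Y i)}"

definition s_matrix :: "real^'k^'k" where
  "s_matrix = (1 / (real CARD('k) - 1)) *\<^sub>R ((\<chi> i j. 1) - (real CARD('k) - 1) *\<^sub>R mat 1)"

definition H_form :: "(complex^'n^'n)^'k \<Rightarrow> complex" where
  "H_form A = (\<Sum>i\<in>UNIV. \<Sum>j\<in>UNIV. complex_of_real (s_matrix $ i $ j) * trace (A $ i ** A $ j))"

text \<open>The Lebesgue measures on a finite-dimensional subspace \<open>V\<close>: the images of the Lebesgue measure
  of coordinate space under the linear isomorphisms given by the bases of \<open>V\<close>.\<close>

definition lebesgue_measure_on :: "'v::euclidean_space set \<Rightarrow> 'v measure \<Rightarrow> bool" where
  "lebesgue_measure_on V M \<longleftrightarrow>
     (\<exists>B. independent B \<and> span B = V \<and>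
        M = distr (\<Pi>\<^sub>M b\<in>B. lborel) (restrict_space borel V) (\<lambda>t. \<Sum>b\<in>B. t b *\<^sub>R b))"

definition gauss_weight :: "(complex^'n^'n)^'k \<Rightarrow> complex" where
  "gauss_weight A = exp (- (1 / 2) * of_nat CARD('n) * H_form A)"

definition trace_product :: "('k \<Rightarrow> nat) \<Rightarrow> ('k \<Rightarrow> nat \<Rightarrow> real) \<Rightarrow> (complex^'n^'n)^'k \<Rightarrow> complex" where
  "trace_product m l A =
     (\<Prod>(i, j)\<in>circles m.
        of_nat CARD('n) * trace ((1 / l i j) *\<^sub>R (matrix_exp (l i j *\<^sub>R A $ i) - mat 1)))"

end

theory Submission
  imports Defs
begin

text \<open>
  On \<open>E_space\<close> the form \<open>H\<close> is real and positive definite, and since the inverse of \<open>(s\<^sub>i\<^sub>j)\<close> is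
  \<open>J - I\<close>, integration by parts yields a Wick formula in which only entries of matrices of
  different colors are paired, the pairing of \<open>(A\<^sub>i)\<^sub>x\<^sub>y\<close> with \<open>(A\<^sub>j)\<^sub>y\<^sub>x\<close> contributing \<open>1 / N\<close>. Expanding
  each factor \<open>N Tr (exp (l A) - 1) / l\<close> as the series of \<open>N l^(n-1) / n! Tr (A^n)\<close>, the integral
  becomes a sum over numbers \<open>n\<close> of marked points (darts) on every circle and over color-respecting
  pairings \<open>\<sigma>\<close> of the darts; the free matrix indices are functions constant on the orbits of
  \<open>\<sigma> \<circ> next\<close>, which are the outer faces of the constellation glued according to \<open>\<sigma>\<close>.

  A pairing is a gluing together with a base point on each circle. The automorphism group of
  a gluing acts freely on the choices of base points, so a type with automorphism group \<open>G\<close> comes from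
  \<open>(\<Prod> n) / |G|\<close> pairings. Its volume is \<open>(\<Prod> l^(n-1) / (n-1)!) / |G|\<close>, because the arc lengths on
  a circle are almost everywhere pairwise distinct, and so the two sums agree term by term.
\<close>

section \<open>Integration by parts for Gaussian weights\<close>

text \<open>The vector representing an entry of A_i with respect to H is not an element of
  \<open>E_space\<close>, which is only a real space. So the Gaussian theory is set up for a complex
  bilinear form that is coercive on the span of a real basis, and representing vectors are complex
  combinations of that basis. The powers of N match as follows. Each trace carries a factor N, which
  accounts for the disc bounded by its circle. A pairing of 2v darts carries N^(-v); the glued
  surface has v vertices and 2v edges, since two arcs start at every gluing point, so V - E = -v.
  Each free index gives a factor N, which accounts for an outer face. Sum and integral are
  interchanged by truncating the exponential series. The truncations are bounded by C exp(\<kappa>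
  |A|) uniformly in the order of truncation, and the Gaussian absorbs this. Convergence of the sum
  over types needs no estimate of its own: all weights are nonnegative, the truncated sums exhaust
  the index set, and they converge because the integrals do.\<close>

lemma integrable_exp_neg_abs:
  fixes d :: real
  assumes "d > 0"
  shows "integrable lborel (\<lambda>s. exp (- d * \<bar>s\<bar>))"
proof -
  have pos: "set_integrable lborel {0..} (\<lambda>s. exp (- d * s))"
  proof -
    have "(\<lambda>s. exp (- d * s)) absolutely_integrable_on {0..}"
      using has_integral_exp_minus_to_infinity[OF assms, of 0]
      by (intro nonnegative_absolutely_integrable_1) (auto simp: integrable_on_def)
    then show ?thesis
      unfolding set_integrable_def by (subst (asm) integrable_completion) auto
  qed
  have i1: "integrable lborel (\<lambda>s. indicator {0..} s *\<^sub>R exp (- d * s))"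
    using pos unfolding set_integrable_def .
  have i2: "integrable lborel (\<lambda>s. indicator {0..} (-s) *\<^sub>R exp (- d * (-s)))"
    using lborel_integrable_real_affine[OF i1, of "-1" 0] by simp
  show ?thesis
    by (rule Bochner_Integration.integrable_bound[OF Bochner_Integration.integrable_add[OF i1 i2]])
       (auto simp: indicator_def)
qed

text \<open>Completing the square; the maximum over u is attained at u = a / (2 e).\<close>

lemma linear_minus_square_bound:
  fixes a e u :: real
  assumes "e > 0"
  shows "a * u - e * u\<^sup>2 \<le> a\<^sup>2 / (4 * e)"
proof -
  have "0 \<le> (2 * e * u - a)\<^sup>2 / (4 * e)" using assms by simp
  also have "\<dots> = a\<^sup>2 / (4 * e) - (a * u - e * u\<^sup>2)"
    using assms by (simp add: field_simps power2_eq_square)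
  finally show ?thesis by simp
qed

text \<open>The form takes complex values on the whole space, because H is given by a trace formula
  that is guaranteed to be real only on \<open>E_space\<close>. Coercivity is therefore asked of the
  real part, and only on \<open>span B\<close>.\<close>

locale gaussian_form =
  fixes B :: "'v::euclidean_space set" and q :: "'v \<Rightarrow> 'v \<Rightarrow> complex" and e :: real
  assumes indep: "independent B"
    and bilin: "bilinear q"
    and sym: "q x y = q y x"
    and e_pos: "0 < e"
    and coercive: "x \<in> span B \<Longrightarrow> e * (norm x)\<^sup>2 \<le> Re (q x x)"
begin

abbreviation \<mu> where "\<mu> \<equiv> \<Pi>\<^sub>M b\<in>B. (lborel :: real measure)"

text \<open>All integrals are taken over the coefficients t, which is how
  \<open>lebesgue_measure_on\<close> presents a Lebesgue measure on a subspace.\<close>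

definition T :: "('v \<Rightarrow> real) \<Rightarrow> 'v" where "T t = (\<Sum>b\<in>B. t b *\<^sub>R b)"

definition w :: "'v \<Rightarrow> complex" where "w x = exp (- q x x / 2)"

lemma finite_B: "finite B"
  using indep by (simp add: independent_imp_finite)

lemma T_in_span: "T t \<in> span B"
  unfolding T_def by (intro span_sum span_scale span_base)

lemma measurable_T [measurable]: "T \<in> borel_measurable \<mu>"
  unfolding T_def by measurable

lemma q_cont: "continuous_on UNIV (\<lambda>x. q x x)"
proof -
  have "bounded_bilinear q"
    using bilin bilinear_conv_bounded_bilinear by blast
  then show ?thesis
    by (intro bounded_bilinear.continuous_on[of q] continuous_on_id)
qed

lemma w_cont: "continuous_on UNIV w"
  unfolding w_def by (intro continuous_intros q_cont) auto

lemma w_measurable [measurable]: "w \<in> borel_measurable borel"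
  using w_cont by (rule borel_measurable_continuous_onI)

lemma norm_w_le: "x \<in> span B \<Longrightarrow> norm (w x) \<le> exp (- (e / 2) * (norm x)\<^sup>2)"
  using coercive[of x] by (simp add: w_def)

text \<open>The quadratic exponent absorbs any linear one. The growth exp(c |x|) comes from the
  integrand, and the surplus exp(-d |x|) is what integrability will use.\<close>

lemma norm_w_exp_le:
  fixes c d :: real
  shows "\<exists>C>0. \<forall>x\<in>span B. exp (c * norm x) * norm (w x) \<le> C * exp (- d * norm x)"
proof (intro exI conjI ballI)
  let ?C = "exp ((c + d)\<^sup>2 / (4 * (e / 2)))"
  show "?C > 0" by simp
  fix x assume x: "x \<in> span B"
  have "exp (c * norm x) * norm (w x) \<le> exp (c * norm x) * exp (- (e / 2) * (norm x)\<^sup>2)"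
    using norm_w_le[OF x] by (intro mult_left_mono) auto
  also have "\<dots> = exp (((c + d) * norm x - (e / 2) * (norm x)\<^sup>2) + (- d * norm x))"
    by (simp add: exp_add [symmetric] algebra_simps)
  also have "\<dots> \<le> exp ((c + d)\<^sup>2 / (4 * (e / 2)) + (- d * norm x))"
    using linear_minus_square_bound[of "e/2" "c+d" "norm x"] e_pos by simp
  also have "\<dots> = ?C * exp (- d * norm x)" by (simp only: exp_add)
  finally show "exp (c * norm x) * norm (w x) \<le> ?C * exp (- d * norm x)" .
qed

text \<open>The functionals dual to the basis recover the coefficients from the vector and are
  bounded in finite dimension. Hence decay in the norm of \<open>T t\<close> is decay in every
  coefficient.\<close>

lemma sum_abs_coordinates_le: "\<exists>d>0. \<forall>t. (\<Sum>b\<in>B. \<bar>t b\<bar>) \<le> d * norm (T t)"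
proof -
  have "\<forall>b\<in>B. \<exists>g. linear g \<and> (\<forall>x\<in>B. g x = (if x = b then 1 else (0::real)))"
    by (intro ballI linear_independent_extend[OF indep])
  then obtain g where g: "\<And>b. b \<in> B \<Longrightarrow> linear (g b)"
    "\<And>b x. b \<in> B \<Longrightarrow> x \<in> B \<Longrightarrow> g b x = (if x = b then 1 else (0::real))" by metis
  have "\<forall>b\<in>B. \<exists>K>0. \<forall>x. norm (g b x) \<le> norm x * K"
    using g(1) linear_conv_bounded_linear bounded_linear.pos_bounded by blast
  then obtain K where K: "\<And>b. b \<in> B \<Longrightarrow> K b > 0" "\<And>b x. b \<in> B \<Longrightarrow> norm (g b x) \<le> norm x * K b"
    by metis
  have coord: "t b = g b (T t)" if "b \<in> B" for t b
  proof -
    have "g b (T t) = (\<Sum>a\<in>B. t a * g b a)"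
      using g(1)[OF that] by (simp add: T_def linear_sum linear_scale)
    also have "\<dots> = (\<Sum>a\<in>B. if a = b then t a else 0)"
      by (intro sum.cong refl) (simp add: g(2)[OF that])
    also have "\<dots> = t b" using that finite_B by simp
    finally show ?thesis by simp
  qed
  show ?thesis
  proof (intro exI conjI allI)
    \<comment> \<open>The summand 1 keeps the constant positive when \<open>B\<close> is
      empty.\<close>
    show "sum K B + 1 > 0" using K(1) by (simp add: add_nonneg_pos sum_nonneg less_imp_le)
    fix t
    have "(\<Sum>b\<in>B. \<bar>t b\<bar>) \<le> (\<Sum>b\<in>B. norm (T t) * K b)"
      using K(2)[of _ "T t"] coord by (intro sum_mono) (simp flip: coord)
    also have "\<dots> = norm (T t) * sum K B" by (simp add: sum_distrib_left)
    also have "\<dots> \<le> (sum K B + 1) * norm (T t)" by (simp add: algebra_simps)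
    finally show "(\<Sum>b\<in>B. \<bar>t b\<bar>) \<le> (sum K B + 1) * norm (T t)" .
  qed
qed

text \<open>By the preceding bound the function is dominated by the product of the one-variable
  functions exp(-|t_b|).\<close>

lemma integrable_exp_neg_norm: "\<exists>d>0. integrable \<mu> (\<lambda>t. exp (- d * norm (T t)))"
proof -
  interpret product_sigma_finite "\<lambda>_. lborel :: real measure" by standard
  obtain d where d: "d > 0" "\<And>t. (\<Sum>b\<in>B. \<bar>t b\<bar>) \<le> d * norm (T t)"
    using sum_abs_coordinates_le by blast
  have "integrable \<mu> (\<lambda>t. \<Prod>b\<in>B. exp (- 1 * \<bar>t b\<bar>))"
    by (intro product_integrable_prod finite_B integrable_exp_neg_abs) auto
  then have "integrable \<mu> (\<lambda>t. exp (- d * norm (T t)))"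
  proof (rule Bochner_Integration.integrable_bound)
    show "AE t in \<mu>. norm (exp (- d * norm (T t))) \<le> norm (\<Prod>b\<in>B. exp (- 1 * \<bar>t b\<bar>))"
      using d(2) finite_B by (intro AE_I2) (simp add: exp_sum [symmetric] sum_negf abs_prod)
  qed measurable
  with d(1) show ?thesis by blast
qed

text \<open>The integrability criterion behind both products of linear forms and the function that
  dominates the truncated trace products.\<close>

lemma integrable_exponential_growth:
  fixes f :: "'v \<Rightarrow> complex"
  assumes [measurable]: "f \<in> borel_measurable borel"
    and f: "\<And>x. x \<in> span B \<Longrightarrow> norm (f x) \<le> K * exp (c * norm x)"
  shows "integrable \<mu> (\<lambda>t. f (T t) * w (T t))"
proof -
  obtain d where d: "d > 0" "integrable \<mu> (\<lambda>t. exp (- d * norm (T t)))"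
    using integrable_exp_neg_norm by blast
  obtain C where C: "C > 0" "\<And>x. x\<in>span B \<Longrightarrow> exp (c * norm x) * norm (w x) \<le> C * exp (- d * norm x)"
    using norm_w_exp_le by blast
  have "integrable \<mu> (\<lambda>t. (\<bar>K\<bar> * C) * exp (- d * norm (T t)))"
    using d by simp
  then show ?thesis
  proof (rule Bochner_Integration.integrable_bound)
    show "AE t in \<mu>. norm (f (T t) * w (T t)) \<le> norm (\<bar>K\<bar> * C * exp (- d * norm (T t)))"
    proof (intro AE_I2)
      fix t
      have "norm (f (T t) * w (T t)) \<le> (\<bar>K\<bar> * exp (c * norm (T t))) * norm (w (T t))"
        unfolding norm_mult
      proof (intro mult_right_mono)
        have "norm (f (T t)) \<le> K * exp (c * norm (T t))" by (rule f[OF T_in_span])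
        also have "\<dots> \<le> \<bar>K\<bar> * exp (c * norm (T t))" by (intro mult_right_mono) auto
        finally show "norm (f (T t)) \<le> \<bar>K\<bar> * exp (c * norm (T t))" .
      qed auto
      also have "\<dots> \<le> \<bar>K\<bar> * (C * exp (- d * norm (T t)))"
        using C(2)[OF T_in_span] by (simp add: mult.assoc mult_left_mono)
      finally show "norm (f (T t) * w (T t)) \<le> norm (\<bar>K\<bar> * C * exp (- d * norm (T t)))"
        using C(1) by (simp add: abs_mult)
    qed
  qed measurable
qed

text \<open>Since |x| \<le> exp |x|, each linear factor costs one unit in the exponent. So
  polynomials fall under the criterion for exponential growth.\<close>

lemma norm_prod_linear_le:
  fixes L :: "'r \<Rightarrow> 'v \<Rightarrow> complex"
  assumes "finite R" "\<And>r. r \<in> R \<Longrightarrow> linear (L r)"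
  shows "\<exists>K c. K \<ge> 0 \<and> (\<forall>x. norm (\<Prod>r\<in>R. L r x) \<le> K * exp (c * norm x))"
proof -
  have "\<forall>r\<in>R. \<exists>K>0. \<forall>x. norm (L r x) \<le> norm x * K"
    using assms(2) linear_conv_bounded_linear bounded_linear.pos_bounded by blast
  then obtain K where K: "\<And>r. r \<in> R \<Longrightarrow> K r > 0" "\<And>r x. r \<in> R \<Longrightarrow> norm (L r x) \<le> norm x * K r"
    by metis
  show ?thesis
  proof (intro exI conjI allI)
    show "(\<Prod>r\<in>R. K r) \<ge> 0" by (intro prod_nonneg ballI) (simp add: K less_imp_le)
    fix x
    have "norm (\<Prod>r\<in>R. L r x) = (\<Prod>r\<in>R. norm (L r x))" by (simp add: prod_norm)
    also have "\<dots> \<le> (\<Prod>r\<in>R. K r * exp (norm x))"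
    proof (intro prod_mono conjI)
      fix r assume r: "r \<in> R"
      have "norm x \<le> exp (norm x)" using exp_ge_add_one_self[of "norm x"] by linarith
      then have "norm x * K r \<le> exp (norm x) * K r"
        using K(1)[OF r] by (intro mult_right_mono) auto
      then show "norm (L r x) \<le> K r * exp (norm x)" using K(2)[OF r, of x] by (simp add: mult.commute)
    qed auto
    also have "\<dots> = (\<Prod>r\<in>R. K r) * exp (real (card R) * norm x)"
      by (simp add: prod.distrib exp_of_nat_mult)
    finally show "norm (\<Prod>r\<in>R. L r x) \<le> (\<Prod>r\<in>R. K r) * exp (real (card R) * norm x)" .
  qed
qed

lemma measurable_linear: "linear (f :: 'v \<Rightarrow> complex) \<Longrightarrow> f \<in> borel_measurable borel"
  by (intro borel_measurable_continuous_onI linear_continuous_on) (simp add: linear_conv_bounded_linear)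

lemma integrable_prod_linear:
  fixes L :: "'r \<Rightarrow> 'v \<Rightarrow> complex"
  assumes "finite R" "\<And>r. r \<in> R \<Longrightarrow> linear (L r)"
  shows "integrable \<mu> (\<lambda>t. (\<Prod>r\<in>R. L r (T t)) * w (T t))"
proof -
  obtain K c where "\<And>x. norm (\<Prod>r\<in>R. L r x) \<le> K * exp (c * norm x)"
    using norm_prod_linear_le[of R L, OF assms] by blast
  then show ?thesis
    using integrable_exponential_growth[of "\<lambda>x. \<Prod>r\<in>R. L r x" K c] assms measurable_linear by auto
qed

lemma q_linear: "linear (q x)"
  using bilin by (simp add: bilinear_def)

lemma integrable_form_prod_linear:
  fixes L :: "'r \<Rightarrow> 'v \<Rightarrow> complex"
  assumes R: "finite R" "\<And>r. r \<in> R \<Longrightarrow> linear (L r)"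
  shows "integrable \<mu> (\<lambda>t. q b (T t) * (\<Prod>r\<in>R. L r (T t)) * w (T t))"
proof -
  \<comment> \<open>\<open>q b\<close> is itself linear, so it joins the family under the new index
    \<open>None\<close>.\<close>
  define L2 where "L2 r = (case r of None \<Rightarrow> q b | Some r \<Rightarrow> L r)" for r
  have "integrable \<mu> (\<lambda>t. (\<Prod>r\<in>insert None (Some ` R). L2 r (T t)) * w (T t))"
    by (intro integrable_prod_linear) (use R q_linear in \<open>auto simp: L2_def\<close>)
  moreover have "(\<Prod>r\<in>insert None (Some ` R). L2 r y) = q b y * (\<Prod>r\<in>R. L r y)" for y
    using R(1) by (subst prod.insert) (auto simp: L2_def prod.reindex)
  ultimately show ?thesis by simp
qed

text \<open>The integrand is a total derivative along the line z + s b: the product rule gives the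
  sum over R, and differentiating exp(-q/2) brings down - q b x. Since b is nonzero, the weight
  tends to 0 at both ends of the line.\<close>

lemma integral_line_derivative_zero:
  fixes L :: "'r \<Rightarrow> 'v \<Rightarrow> complex"
  assumes R: "finite R" "\<And>r. r \<in> R \<Longrightarrow> linear (L r)" and b: "b \<in> B" and z: "z \<in> span B"
  shows "(LBINT s. ((\<Sum>r\<in>R. L r b * (\<Prod>r'\<in>R-{r}. L r' (z + s *\<^sub>R b)))
            - q b (z + s *\<^sub>R b) * (\<Prod>r\<in>R. L r (z + s *\<^sub>R b))) * w (z + s *\<^sub>R b)) = 0"
    (is "(LBINT s. ?g s) = 0")
proof -
  define x where "x s = z + s *\<^sub>R b" for s
  define G where "G s = (\<Prod>r\<in>R. L r (x s)) * w (x s)" for s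
  have xs: "x s \<in> span B" for s
    unfolding x_def using z b by (auto intro: span_add span_scale span_base)
  have b0: "b \<noteq> 0" using b indep dependent_zero by blast
  have L': "linear (L r) \<Longrightarrow> ((\<lambda>s. L r (x s)) has_derivative (\<lambda>h. h *\<^sub>R L r b)) (at s)" for r s
    unfolding x_def by (simp add: linear_add linear_scale) (auto intro!: derivative_eq_intros)
  have qx: "q (x s) (x s) = q z z + of_real (2 * s) * q z b + of_real (s\<^sup>2) * q b b" for s
    unfolding x_def using bilin sym[of b z]
    by (simp add: bilinear_ladd bilinear_radd bilinear_lmul bilinear_rmul algebra_simps power2_eq_square
        scaleR_conv_of_real)
  have w': "((\<lambda>s. w (x s)) has_derivative (\<lambda>h. h *\<^sub>R (- q b (x s) * w (x s)))) (at s)" for s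
  proof -
    have "((\<lambda>s. exp (- (q z z + of_real (2 * s) * q z b + of_real (s\<^sup>2) * q b b) / 2)) has_derivative
        (\<lambda>h. h *\<^sub>R (- q b (x s) * w (x s)))) (at s)"
    proof -
      have "((\<lambda>s. exp (- (q z z + of_real (2 * s) * q z b + of_real (s\<^sup>2) * q b b) / 2)) has_vector_derivative
        (- (2 * q z b + 2 * s * q b b) / 2) * exp (- (q z z + of_real (2 * s) * q z b + of_real (s\<^sup>2) * q b b) / 2)) (at s)"
      proof -
        \<comment> \<open>On the line the exponent is a quadratic polynomial in s; it is
          differentiated as a function of a complex variable and then restricted to real
          arguments.\<close>
        have "((\<lambda>u::complex. exp (- (q z z + (2 * u) * q z b + (u\<^sup>2) * q b b) / 2)) has_field_derivative
          (- (2 * q z b + 2 * s * q b b) / 2) * exp (- (q z z + of_real (2 * s) * q z b + of_real (s\<^sup>2) * q b b) / 2)) (at (of_real s))"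
          by (rule derivative_eq_intros refl | simp)+
        from has_vector_derivative_real_field[OF this] show ?thesis by (simp add: o_def)
      qed
      moreover have "(- (2 * q z b + 2 * s * q b b) / 2) = - q b (x s)"
        unfolding x_def using bilin sym[of b z]
        by (simp add: bilinear_radd bilinear_rmul scaleR_conv_of_real field_simps)
      ultimately show ?thesis
        by (simp add: has_vector_derivative_def w_def qx)
    qed
    then show ?thesis by (simp add: w_def qx)
  qed
  have G': "(G has_vector_derivative ?g s) (at s)" for s
    unfolding has_vector_derivative_def G_def
    apply (rule has_derivative_eq_rhs)
     apply (rule has_derivative_mult[OF has_derivative_prod w'])
     apply (rule L'[OF R(2)], assumption)
    apply (auto simp: fun_eq_iff x_def[symmetric] algebra_simps sum_distrib_left sum_distrib_right
        scaleR_conv_of_real intro!: sum.cong)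
    done
  have gcont: "isCont ?g s" for s
  proof -
    have c: "isCont (\<lambda>s. L (z + s *\<^sub>R b)) s" if "linear L" for L :: "'v \<Rightarrow> complex"
      using that by (simp add: linear_add linear_scale)
    have cw: "isCont (\<lambda>s. w (z + s *\<^sub>R b)) s"
    proof (rule isCont_o2[where g=w])
      show "isCont (\<lambda>s. z + s *\<^sub>R b) s" by (intro continuous_intros)
      show "isCont w (z + s *\<^sub>R b)" using w_cont by (simp add: continuous_on_eq_continuous_at)
    qed
    show ?thesis
      by (intro continuous_intros cw c q_linear) (use R in auto)
  qed
  have bound: "\<exists>C. \<forall>s. norm (f (x s) * w (x s)) \<le> C * exp (- norm b * \<bar>s\<bar>)"
    if "\<And>x. norm (f x) \<le> K * exp (c * norm x)" for f :: "'v \<Rightarrow> complex" and K c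
  proof -
    obtain C where C: "C > 0" "\<And>x. x\<in>span B \<Longrightarrow> exp (c * norm x) * norm (w x) \<le> C * exp (- 1 * norm x)"
      using norm_w_exp_le by blast
    have K0: "K \<ge> 0" using order_trans[OF norm_ge_zero that[of 0]] by simp
    have "norm (f (x s) * w (x s)) \<le> (K * C * exp (norm z)) * exp (- norm b * \<bar>s\<bar>)" for s
    proof -
      have "norm (f (x s) * w (x s)) \<le> (K * exp (c * norm (x s))) * norm (w (x s))"
        unfolding norm_mult by (intro mult_right_mono that) auto
      also have "\<dots> \<le> K * (C * exp (- 1 * norm (x s)))"
        using C(2)[OF xs] K0 by (simp add: mult.assoc mult_left_mono)
      \<comment> \<open>By the triangle inequality the norm of x s is at least |s| |b| - |z|, so
        decay in the norm of x s becomes decay in |s|.\<close>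
      also have "\<dots> \<le> K * (C * exp (norm z - norm b * \<bar>s\<bar>))"
      proof -
        have "norm b * \<bar>s\<bar> = norm (x s - z)" by (simp add: x_def)
        also have "\<dots> \<le> norm (x s) + norm z" by (rule norm_triangle_ineq4)
        finally show ?thesis using K0 C(1) by (intro mult_left_mono) auto
      qed
      also have "\<dots> = (K * C * exp (norm z)) * exp (- norm b * \<bar>s\<bar>)"
        by (simp add: exp_diff exp_minus divide_inverse)
      finally show ?thesis .
    qed
    then show ?thesis by blast
  qed
  have dom: "\<exists>C. \<forall>s. norm ((\<Prod>r\<in>R'. L' r (x s)) * w (x s)) \<le> C * exp (- norm b * \<bar>s\<bar>)"
    if "finite R'" "\<And>r. r \<in> R' \<Longrightarrow> linear (L' r)" for R' :: "'q set" and L' :: "'q \<Rightarrow> 'v \<Rightarrow> complex"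
  proof -
    from norm_prod_linear_le[of R' L', OF that]
    obtain K c where "\<And>x. norm (\<Prod>r\<in>R'. L' r x) \<le> K * exp (c * norm x)" by blast
    from bound[OF this] show ?thesis .
  qed
  have xcont: "continuous_on UNIV x" unfolding x_def by (intro continuous_intros)
  \<comment> \<open>The index type is left free: the fact is applied to subfamilies of R and, with
    \<open>q b\<close> adjoined, to an option type.\<close>
  have int: "integrable lborel (\<lambda>s. (\<Prod>r\<in>R'. L' r (x s)) * w (x s))"
    if "finite R'" "\<And>r. r \<in> R' \<Longrightarrow> linear (L' r)" for R' :: "'q set" and L' :: "'q \<Rightarrow> 'v \<Rightarrow> complex"
  proof -
    have [measurable]: "L' r \<in> borel_measurable borel" if "r \<in> R'" for r
      using measurable_linear that \<open>\<And>r. r \<in> R' \<Longrightarrow> linear (L' r)\<close> by blast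
    have [measurable]: "x \<in> borel_measurable borel"
      using xcont by (rule borel_measurable_continuous_onI)
    from dom[of R' L', OF that]
    obtain C where C: "\<And>s. norm ((\<Prod>r\<in>R'. L' r (x s)) * w (x s)) \<le> C * exp (- norm b * \<bar>s\<bar>)"
      by blast
    have "integrable lborel (\<lambda>s. C * exp (- norm b * \<bar>s\<bar>))"
      using b0 by (intro integrable_mult_right integrable_exp_neg_abs) auto
    then show ?thesis
    proof (rule Bochner_Integration.integrable_bound)
      show "(\<lambda>s. (\<Prod>r\<in>R'. L' r (x s)) * w (x s)) \<in> borel_measurable lborel" by measurable
      show "AE s in lborel. norm ((\<Prod>r\<in>R'. L' r (x s)) * w (x s)) \<le> norm (C * exp (- norm b * \<bar>s\<bar>))"
        using C by (intro AE_I2) (rule order_trans[OF C], simp)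
    qed
  qed
  have gint: "integrable lborel ?g"
  proof -
    have 1: "integrable lborel (\<lambda>s. (\<Sum>r\<in>R. L r b * ((\<Prod>r'\<in>R-{r}. L r' (x s)) * w (x s))))"
      by (intro Bochner_Integration.integrable_sum integrable_mult_right int) (use R in auto)
    define L2 where "L2 r = (case r of None \<Rightarrow> q b | Some r \<Rightarrow> L r)" for r
    have 2: "integrable lborel (\<lambda>s. (\<Prod>r\<in>insert None (Some ` R). L2 r (x s)) * w (x s))"
      by (intro int) (use R q_linear in \<open>auto simp: L2_def\<close>)
    have "(\<Prod>r\<in>insert None (Some ` R). L2 r y) = q b y * (\<Prod>r\<in>R. L r y)" for y
      using R(1) by (subst prod.insert) (auto simp: L2_def prod.reindex)
    with 2 have 2: "integrable lborel (\<lambda>s. q b (x s) * (\<Prod>r\<in>R. L r (x s)) * w (x s))" by simp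
    from Bochner_Integration.integrable_diff[OF 1 2] show ?thesis
      by (simp add: x_def algebra_simps sum_distrib_left)
  qed
  obtain C where C: "\<And>s. norm (G s) \<le> C * exp (- norm b * \<bar>s\<bar>)"
    using dom[of R L, OF R] unfolding G_def by blast
  have G_top: "(G \<longlongrightarrow> 0) at_top"
  proof (rule Lim_null_comparison)
    show "eventually (\<lambda>s. norm (G s) \<le> C * exp (- norm b * s)) at_top"
      using eventually_ge_at_top[of "0::real"] by eventually_elim (use C in \<open>metis abs_of_nonneg\<close>)
    have "filterlim (\<lambda>s. - norm b * s) at_bot at_top"
      using b0 by (intro filterlim_tendsto_neg_mult_at_bot[OF tendsto_const _ filterlim_ident]) auto
    then have "((\<lambda>s. exp (- norm b * s)) \<longlongrightarrow> 0) at_top"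
      by (rule filterlim_compose[OF exp_at_bot])
    then show "((\<lambda>s. C * exp (- norm b * s)) \<longlongrightarrow> 0) at_top"
      by (rule tendsto_mult_right_zero)
  qed
  have G_bot: "(G \<longlongrightarrow> 0) at_bot"
  proof (rule Lim_null_comparison)
    show "eventually (\<lambda>s. norm (G s) \<le> C * exp (norm b * s)) at_bot"
      using eventually_le_at_bot[of "0::real"]
      by eventually_elim (use C in \<open>smt (verit, ccfv_threshold) mult_minus_left mult_minus_right\<close>)
    have "filterlim (\<lambda>s. norm b * s) at_bot at_bot"
      using b0 by (intro filterlim_tendsto_pos_mult_at_bot[OF tendsto_const _ filterlim_ident]) auto
    then have "((\<lambda>s. exp (norm b * s)) \<longlongrightarrow> 0) at_bot"
      by (rule filterlim_compose[OF exp_at_bot])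
    then show "((\<lambda>s. C * exp (norm b * s)) \<longlongrightarrow> 0) at_bot"
      by (rule tendsto_mult_right_zero)
  qed
  have "(LBINT s=-\<infinity>..\<infinity>. ?g s) = 0 - 0"
  proof (rule interval_integral_FTC_integrable[where F=G])
    show "set_integrable lborel (einterval (- \<infinity>) \<infinity>) ?g"
      using gint by (simp add: set_integrable_def)
    show "((G \<circ> real_of_ereal) \<longlongrightarrow> 0) (at_right (- \<infinity>))"
      using G_bot by (simp add: ereal_tendsto_simps)
    show "((G \<circ> real_of_ereal) \<longlongrightarrow> 0) (at_left \<infinity>)"
      using G_top by (simp add: ereal_tendsto_simps)
  qed (use G' gcont in auto)
  then show ?thesis
    by (simp add: interval_lebesgue_integral_def set_lebesgue_integral_def)
qed

text \<open>Fubini singles out the coefficient of b. The inner integral then runs along a line in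
  direction b and vanishes because its integrand is a total derivative.\<close>

lemma integration_by_parts:
  fixes L :: "'r \<Rightarrow> 'v \<Rightarrow> complex"
  assumes R: "finite R" "\<And>r. r \<in> R \<Longrightarrow> linear (L r)" and b: "b \<in> B"
  shows "(LINT t|\<mu>. q b (T t) * (\<Prod>r\<in>R. L r (T t)) * w (T t)) =
         (\<Sum>r\<in>R. L r b * (LINT t|\<mu>. (\<Prod>r'\<in>R-{r}. L r' (T t)) * w (T t)))"
proof -
  interpret product_sigma_finite "\<lambda>_. lborel :: real measure" by standard
  let ?I = "B - {b}"
  let ?h = "\<lambda>y. ((\<Sum>r\<in>R. L r b * (\<Prod>r'\<in>R-{r}. L r' y)) - q b y * (\<Prod>r\<in>R. L r y)) * w y"
  have B: "insert b ?I = B" using b by auto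
  have 1: "integrable \<mu> (\<lambda>t. (\<Sum>r\<in>R. L r b * ((\<Prod>r'\<in>R-{r}. L r' (T t)) * w (T t))))"
    by (intro Bochner_Integration.integrable_sum integrable_mult_right integrable_prod_linear) (use R in auto)
  have 2: "integrable \<mu> (\<lambda>t. q b (T t) * (\<Prod>r\<in>R. L r (T t)) * w (T t))"
    by (rule integrable_form_prod_linear[of R L, OF R])
  have int: "integrable \<mu> (\<lambda>t. ?h (T t))"
    using Bochner_Integration.integrable_diff[OF 1 2] by (simp add: algebra_simps sum_distrib_left)
  have upd: "T (x(b := s)) = (\<Sum>b'\<in>?I. x b' *\<^sub>R b') + s *\<^sub>R b" for x s
    unfolding T_def using b finite_B by (subst sum.remove[of B b]) auto
  have "(LINT t|\<mu>. ?h (T t)) = (LINT x|PiM ?I (\<lambda>_. lborel). (LBINT s. ?h (T (x(b := s)))))"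
    using product_integral_insert[of ?I b "\<lambda>t. ?h (T t)"] int finite_B unfolding B by simp
  also have "\<dots> = (LINT x|PiM ?I (\<lambda>_. lborel). 0)"
  proof -
    have "(LBINT s. ?h (T (x(b := s)))) = 0" for x
      unfolding upd by (rule integral_line_derivative_zero[of R L, OF R b])
        (auto intro: span_sum span_scale span_base)
    then show ?thesis by simp
  qed
  finally have "(LINT t|\<mu>. ?h (T t)) = 0" by simp
  moreover have "(LINT t|\<mu>. ?h (T t)) =
      (LINT t|\<mu>. (\<Sum>r\<in>R. L r b * ((\<Prod>r'\<in>R-{r}. L r' (T t)) * w (T t)))) -
      (LINT t|\<mu>. q b (T t) * (\<Prod>r\<in>R. L r (T t)) * w (T t))"
    by (subst Bochner_Integration.integral_diff[OF 1 2, symmetric])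
       (simp add: algebra_simps sum_distrib_left)
  moreover have "(LINT t|\<mu>. (\<Sum>r\<in>R. L r b * ((\<Prod>r'\<in>R-{r}. L r' (T t)) * w (T t)))) =
     (\<Sum>r\<in>R. L r b * (LINT t|\<mu>. (\<Prod>r'\<in>R-{r}. L r' (T t)) * w (T t)))"
    by (subst Bochner_Integration.integral_sum)
       (auto intro!: integrable_mult_right integrable_prod_linear R)
  ultimately show ?thesis by simp
qed

text \<open>Here \<open>\<Sum>b. \<gamma> b b\<close> plays the role of a vector of the complexification of \<open>span B\<close>.\<close>

lemma stein:
  fixes L :: "'r \<Rightarrow> 'v \<Rightarrow> complex"
  assumes R: "finite R" "\<And>r. r \<in> R \<Longrightarrow> linear (L r)"
    and M: "\<And>x. x \<in> span B \<Longrightarrow> M x = (\<Sum>b\<in>B. \<gamma> b * q b x)"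
  shows "(LINT t|\<mu>. M (T t) * (\<Prod>r\<in>R. L r (T t)) * w (T t)) =
         (\<Sum>r\<in>R. (\<Sum>b\<in>B. \<gamma> b * L r b) * (LINT t|\<mu>. (\<Prod>r'\<in>R-{r}. L r' (T t)) * w (T t)))"
proof -
  have "(LINT t|\<mu>. M (T t) * (\<Prod>r\<in>R. L r (T t)) * w (T t)) =
    (LINT t|\<mu>. (\<Sum>b\<in>B. \<gamma> b * (q b (T t) * (\<Prod>r\<in>R. L r (T t)) * w (T t))))"
    by (intro Bochner_Integration.integral_cong refl)
       (simp add: M[OF T_in_span] sum_distrib_right mult.assoc)
  also have "\<dots> = (\<Sum>b\<in>B. \<gamma> b * (\<Sum>r\<in>R. L r b * (LINT t|\<mu>. (\<Prod>r'\<in>R-{r}. L r' (T t)) * w (T t))))"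
    by (subst Bochner_Integration.integral_sum)
       (auto simp: integration_by_parts[of R L, OF R] intro!: integrable_mult_right integrable_form_prod_linear[of R L, OF R])
  also have "\<dots> = (\<Sum>r\<in>R. (\<Sum>b\<in>B. \<gamma> b * L r b) * (LINT t|\<mu>. (\<Prod>r'\<in>R-{r}. L r' (T t)) * w (T t)))"
    by (simp add: sum_distrib_left sum_distrib_right mult.assoc) (rule sum.swap)
  finally show ?thesis .
qed

end

section \<open>Pairings and the Wick formula\<close>

text \<open>Perfect matchings, encoded as involutions without fixed points in \<open>R\<close>.
  Being the identity outside \<open>R\<close> makes each matching a single function, so that
  matchings can be counted.\<close>

definition pairings :: "'a set \<Rightarrow> ('a \<Rightarrow> 'a) set" where
  "pairings R = {\<sigma>. \<sigma> permutes R \<and> (\<forall>r\<in>R. \<sigma> r \<noteq> r \<and> \<sigma> (\<sigma> r) = r)}"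

lemma finite_pairings: "finite R \<Longrightarrow> finite (pairings R)"
  unfolding pairings_def by (rule finite_subset[OF _ finite_permutations]) auto

lemma permutes_involution:
  assumes "\<And>r. r \<in> R \<Longrightarrow> \<sigma> r \<in> R" "\<And>r. r \<in> R \<Longrightarrow> \<sigma> (\<sigma> r) = r" "\<And>r. r \<notin> R \<Longrightarrow> \<sigma> r = r"
  shows "\<sigma> permutes R"
proof (rule bij_imp_permutes)
  show "bij_betw \<sigma> R R" by (rule bij_betw_byWitness[where f' = \<sigma>]) (use assms in auto)
qed (use assms in auto)

lemma pairingsI:
  assumes "\<And>r. r \<in> R \<Longrightarrow> \<sigma> r \<in> R" "\<And>r. r \<in> R \<Longrightarrow> \<sigma> (\<sigma> r) = r" "\<And>r. r \<notin> R \<Longrightarrow> \<sigma> r = r"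
    "\<And>r. r \<in> R \<Longrightarrow> \<sigma> r \<noteq> r"
  shows "\<sigma> \<in> pairings R"
  using assms permutes_involution[of R \<sigma>] by (auto simp: pairings_def)

lemma pairingsD:
  assumes "\<sigma> \<in> pairings R"
  shows "r \<in> R \<Longrightarrow> \<sigma> r \<in> R" "r \<in> R \<Longrightarrow> \<sigma> (\<sigma> r) = r" "r \<notin> R \<Longrightarrow> \<sigma> r = r" "r \<in> R \<Longrightarrow> \<sigma> r \<noteq> r"
  using assms by (auto simp: pairings_def permutes_in_image permutes_not_in)

text \<open>A pairing amounts to the partner r1 of r0 together with an arbitrary pairing of the
  rest. This is the recursion that the induction for the Wick formula follows.\<close>

lemma sum_pairings_remove:
  fixes f :: "('a \<Rightarrow> 'a) \<Rightarrow> 'b::comm_monoid_add"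
  assumes "finite R" "r0 \<in> R"
  shows "(\<Sum>\<sigma>\<in>pairings R. f \<sigma>) =
    (\<Sum>r1\<in>R-{r0}. \<Sum>\<sigma>\<in>pairings (R-{r0,r1}). f (\<sigma>(r0 := r1, r1 := r0)))"
proof -
  have "(\<Sum>r1\<in>R-{r0}. \<Sum>\<sigma>\<in>pairings (R-{r0,r1}). f (\<sigma>(r0 := r1, r1 := r0))) =
     (\<Sum>(r1,\<sigma>)\<in>(SIGMA r1:R-{r0}. pairings (R-{r0,r1})). f (\<sigma>(r0 := r1, r1 := r0)))"
    using assms by (intro sum.Sigma) (auto intro: finite_pairings)
  also have "\<dots> = (\<Sum>\<sigma>\<in>pairings R. f \<sigma>)"
  proof (rule sum.reindex_bij_witness[where j = "\<lambda>(r1,\<sigma>). \<sigma>(r0 := r1, r1 := r0)"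
        and i = "\<lambda>\<sigma>. (\<sigma> r0, \<sigma>(r0 := r0, \<sigma> r0 := \<sigma> r0))"])
    fix a assume a: "a \<in> (SIGMA r1:R-{r0}. pairings (R-{r0,r1}))"
    then obtain r1 \<sigma> where [simp]: "a = (r1, \<sigma>)" and r1: "r1 \<in> R" "r1 \<noteq> r0" and s: "\<sigma> \<in> pairings (R-{r0,r1})"
      by auto
    note D = pairingsD[OF s]
    have fixd: "\<sigma> r0 = r0" "\<sigma> r1 = r1" using D(3)[of r0] D(3)[of r1] by auto
    show "(\<lambda>\<sigma>. (\<sigma> r0, \<sigma>(r0 := r0, \<sigma> r0 := \<sigma> r0))) ((\<lambda>(r1,\<sigma>). \<sigma>(r0 := r1, r1 := r0)) a) = a"
      using r1 fixd by (auto simp: fun_eq_iff)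
    have in_out: "\<sigma> r \<in> R - {r0,r1}" if "r \<in> R" "r \<noteq> r0" "r \<noteq> r1" for r
      using D(1)[of r] that by auto
    show "(\<lambda>(r1,\<sigma>). \<sigma>(r0 := r1, r1 := r0)) a \<in> pairings R"
    proof -
      have "\<sigma>(r0 := r1, r1 := r0) \<in> pairings R"
      proof (rule pairingsI)
        fix r assume r: "r \<in> R"
        consider "r = r0" | "r = r1" | "r \<noteq> r0" "r \<noteq> r1" by blast
        note cs = this
        show "(\<sigma>(r0 := r1, r1 := r0)) r \<in> R"
          by (cases rule: cs) (use r r1 assms(2) in_out in auto)
        show "(\<sigma>(r0 := r1, r1 := r0)) ((\<sigma>(r0 := r1, r1 := r0)) r) = r"
          by (cases rule: cs) (use r r1 in_out[of r] D(2)[of r] in auto)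
        show "(\<sigma>(r0 := r1, r1 := r0)) r \<noteq> r"
          by (cases rule: cs) (use r r1 D(4)[of r] in auto)
      next
        fix r assume "r \<notin> R"
        then show "(\<sigma>(r0 := r1, r1 := r0)) r = r" using D(3)[of r] r1 assms(2) by auto
      qed
      then show ?thesis by simp
    qed
    show "f ((\<lambda>(r1,\<sigma>). \<sigma>(r0 := r1, r1 := r0)) a) = (case a of (r1,\<sigma>) \<Rightarrow> f (\<sigma>(r0 := r1, r1 := r0)))"
      by simp
  next
    fix \<sigma> assume s: "\<sigma> \<in> pairings R"
    note D = pairingsD[OF s]
    show "(\<lambda>(r1,\<sigma>). \<sigma>(r0 := r1, r1 := r0)) (\<sigma> r0, \<sigma>(r0 := r0, \<sigma> r0 := \<sigma> r0)) = \<sigma>"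
      using D assms(2) by (auto simp: fun_eq_iff)
    show "(\<sigma> r0, \<sigma>(r0 := r0, \<sigma> r0 := \<sigma> r0)) \<in> (SIGMA r1:R-{r0}. pairings (R-{r0,r1}))"
    proof (simp, intro conjI)
      show "\<sigma> r0 \<in> R" "\<sigma> r0 \<noteq> r0" using D assms(2) by auto
      show "\<sigma>(r0 := r0, \<sigma> r0 := \<sigma> r0) \<in> pairings (R - {r0, \<sigma> r0})"
        by (rule pairingsI) (use D assms(2) in \<open>auto, metis+\<close>)
    qed
  qed
  finally show ?thesis by simp
qed

section \<open>The quadratic form on \<open>E_space\<close> and the covariance of the matrix
  entries\<close>

lemma s_matrix_nth: "CARD('k) \<ge> 2 \<Longrightarrow>
   (s_matrix :: real^'k^'k) $ i $ j = 1 / (real CARD('k) - 1) - (if i = j then 1 else 0)"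
  by (auto simp: s_matrix_def mat_def right_diff_distrib)

text \<open>The factor N of the exponent is absorbed here, so that the weight is exp(-q/2) as in
  \<open>gaussian_form\<close> and covariances acquire the factor 1 / N.\<close>

definition polar_form :: "(complex^'n^'n)^'k \<Rightarrow> (complex^'n^'n)^'k \<Rightarrow> complex" where
  "polar_form u v = of_nat CARD('n) *
     (\<Sum>i\<in>UNIV. \<Sum>j\<in>UNIV. complex_of_real (s_matrix $ i $ j) * trace (u $ i ** v $ j))"

lemma gauss_weight_eq: "gauss_weight A = exp (- polar_form A A / 2)"
  by (simp add: gauss_weight_def polar_form_def H_form_def)

lemma trace_mult_eq: "trace ((A :: complex^'n^'n) ** B) = (\<Sum>a\<in>UNIV. \<Sum>b\<in>UNIV. A $ a $ b * B $ b $ a)"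
  by (simp add: trace_def matrix_matrix_mult_def)

lemma polar_form_expand: "polar_form u (v :: (complex^'n^'n)^'k) = of_nat CARD('n) *
     (\<Sum>i\<in>UNIV. \<Sum>j\<in>UNIV. \<Sum>a\<in>UNIV. \<Sum>b\<in>UNIV.
        complex_of_real (s_matrix $ i $ j) * (u $ i $ a $ b * v $ j $ b $ a))"
  by (simp add: polar_form_def trace_mult_eq sum_distrib_left)

lemma bilinear_polar_form: "bilinear (polar_form :: (complex^'n^'n)^'k \<Rightarrow> (complex^'n^'n)^'k \<Rightarrow> complex)"
  unfolding bilinear_def linear_iff polar_form_expand
  by (simp add: ring_distribs sum.distrib scaleR_conv_of_real[where 'a = complex] sum_distrib_left mult_ac)

lemma polar_form_sym: "CARD('k) \<ge> 2 \<Longrightarrow> polar_form u (v :: (complex^'n^'n)^'k) = polar_form v u"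
proof -
  assume k: "CARD('k) \<ge> 2"
  have "(s_matrix :: real^'k^'k) $ i $ j = s_matrix $ j $ i" for i j
    using k by (simp add: s_matrix_nth)
  then show ?thesis
    unfolding polar_form_def
    by (subst sum.swap, intro arg_cong2[where f = "(*)"] sum.cong refl)
       (metis | rule trace_mul_sym)+
qed

lemma norm_matrix_sq: "(norm (X :: complex^'n^'n))\<^sup>2 = (\<Sum>a\<in>UNIV. \<Sum>b\<in>UNIV. (cmod (X $ a $ b))\<^sup>2)"
  by (simp add: norm_vec_def L2_set_def sum_nonneg)

lemma trace_hermitian_sq:
  assumes "hermitian X"
  shows "trace (X ** X) = of_real ((norm X)\<^sup>2)"
proof -
  have "X $ b $ a = cnj (X $ a $ b)" for a b
  proof -
    have "conj_transpose X $ b $ a = cnj (X $ a $ b)"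
      by (simp add: conj_transpose_def map_matrix_def transpose_def)
    then show ?thesis using assms by (simp add: hermitian_def)
  qed
  then have *: "X $ a $ b * X $ b $ a = of_real ((cmod (X $ a $ b))\<^sup>2)" for a b
    using complex_norm_square[of "X $ a $ b"] by metis
  show ?thesis
    unfolding trace_mult_eq * by (simp add: norm_matrix_sq)
qed

lemma trace_skew_hermitian_sq:
  assumes "skew_hermitian X"
  shows "trace (X ** X) = - of_real ((norm X)\<^sup>2)"
proof -
  have "X $ b $ a = - cnj (X $ a $ b)" for a b
  proof -
    have "conj_transpose X $ b $ a = cnj (X $ a $ b)"
      by (simp add: conj_transpose_def map_matrix_def transpose_def)
    then show ?thesis
      using assms unfolding skew_hermitian_def by (metis minus_minus vector_uminus_component)
  qed
  then have *: "X $ a $ b * X $ b $ a = - (of_real ((cmod (X $ a $ b))\<^sup>2))" for a b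
    using complex_norm_square[of "X $ a $ b"] by (metis mult_minus_right)
  show ?thesis
    unfolding trace_mult_eq * by (simp add: norm_matrix_sq sum_negf)
qed

lemma trace_linear: "linear (\<lambda>v :: complex^'n^'n. trace (u ** v))" "linear (\<lambda>v :: complex^'n^'n. trace (v ** u))"
  unfolding linear_iff trace_mult_eq
  by (simp_all add: ring_distribs sum.distrib scaleR_conv_of_real[where 'a = complex] sum_distrib_left mult_ac)

text \<open>Write A_i = X + Y_i. As the Y_i sum to 0, the A_i sum to k X and the cross terms Tr(X
  Y_i) cancel. The part J / (k - 1) of s yields k^2 / (k - 1) |X|^2, the part -I yields -k |X|^2 +
  \<Sum> |Y_i|^2, the sign being reversed for skew-hermitian matrices. Altogether H = k / (k - 1)
  |X|^2 + \<Sum> |Y_i|^2. The constant N / (2 k) comes from |A|^2 \<le> 2 k |X|^2 + 2 \<Sum>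
  |Y_i|^2, where both terms are at most 2 k times those of H.\<close>

lemma polar_form_E:
  fixes A :: "(complex^'n^'n)^'k"
  assumes k: "CARD('k) \<ge> 2" and A: "A \<in> E_space"
  shows "\<exists>h. polar_form A A = of_real h \<and> (real CARD('n) / (2 * real CARD('k))) * (norm A)\<^sup>2 \<le> h"
proof -
  obtain X Y where X: "hermitian X" and Y: "\<And>i. skew_hermitian (Y i)" and Y0: "(\<Sum>i\<in>UNIV. Y i) = 0"
    and AXY: "\<And>i. A $ i = X + Y i"
    using A unfolding E_space_def by blast
  let ?k = "real CARD('k)" and ?N = "real CARD('n)"
  define h where "h = ?N * (?k / (?k - 1) * (norm X)\<^sup>2 + (\<Sum>i\<in>UNIV. (norm (Y i))\<^sup>2))"
  have tXY: "(\<Sum>i\<in>UNIV. trace (X ** Y i)) = 0"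
  proof -
    have "trace (X ** (\<Sum>i\<in>UNIV. Y i)) = (\<Sum>i\<in>UNIV. trace (X ** Y i))"
      by (rule linear_sum[OF trace_linear(1)])
    moreover have "trace (X ** 0) = 0" by (rule linear_0[OF trace_linear(1)])
    ultimately show ?thesis by (simp only: Y0)
  qed
  have tYX: "trace (Y i ** X) = trace (X ** Y i)" for i by (rule trace_mul_sym)
  have tA: "trace (A $ i ** A $ i) = trace (X ** X) + 2 * trace (X ** Y i) + trace (Y i ** Y i)" for i
    unfolding AXY linear_add[OF trace_linear(1)] linear_add[OF trace_linear(2)] tYX by simp
  have sumA: "(\<Sum>i\<in>UNIV. A $ i) = ?k *\<^sub>R X"
    by (simp add: AXY sum.distrib Y0 sum_constant_scaleR del: sum_constant)
  have ss: "(\<Sum>i\<in>UNIV. \<Sum>j\<in>UNIV. trace (A $ i ** A $ j)) = of_real (?k\<^sup>2) * trace (X ** X)"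
  proof -
    have "(\<Sum>i\<in>UNIV. \<Sum>j\<in>UNIV. trace (A $ i ** A $ j)) = trace ((\<Sum>i\<in>UNIV. A $ i) ** (\<Sum>j\<in>UNIV. A $ j))"
      by (simp only: linear_sum[OF trace_linear(1)] linear_sum[OF trace_linear(2)])
         (rule sum.swap)
    also have "\<dots> = of_real (?k\<^sup>2) * trace (X ** X)"
      unfolding sumA linear_scale[OF trace_linear(1)] linear_scale[OF trace_linear(2)]
      by (simp add: scaleR_conv_of_real[where 'a = complex] power2_eq_square)
    finally show ?thesis .
  qed
  have "(\<Sum>i\<in>UNIV. \<Sum>j\<in>UNIV. complex_of_real (s_matrix $ i $ j) * trace (A $ i ** A $ j)) =
    of_real (1 / (?k - 1)) * (\<Sum>i\<in>UNIV. \<Sum>j\<in>UNIV. trace (A $ i ** A $ j)) - (\<Sum>i\<in>UNIV. trace (A $ i ** A $ i))"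
  proof -
    have "complex_of_real ((s_matrix :: real^'k^'k) $ i $ j) * z = of_real (1 / (?k - 1)) * z - (if i = j then z else 0)" for i j z
      by (simp add: s_matrix_nth[OF k] left_diff_distrib)
    then show ?thesis by (simp only: sum_subtractf sum_distrib_left [symmetric]) simp
  qed
  also have "\<dots> = of_real (1 / (?k - 1)) * (of_real (?k\<^sup>2) * trace (X ** X)) -
     (of_real ?k * trace (X ** X) + (\<Sum>i\<in>UNIV. trace (Y i ** Y i)))"
    unfolding ss tA sum.distrib sum_distrib_left [symmetric] tXY by simp
  also have "\<dots> = of_real (?k / (?k - 1) * (norm X)\<^sup>2 + (\<Sum>i\<in>UNIV. (norm (Y i))\<^sup>2))"
  proof -
    have "1 / (?k - 1) * (?k\<^sup>2 * (norm X)\<^sup>2) - ?k * (norm X)\<^sup>2 = ?k / (?k - 1) * (norm X)\<^sup>2"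
      using k by (simp add: field_simps power2_eq_square)
    then have "complex_of_real (1 / (?k - 1)) * (of_real (?k\<^sup>2) * of_real ((norm X)\<^sup>2)) - of_real ?k * of_real ((norm X)\<^sup>2)
      = of_real (?k / (?k - 1) * (norm X)\<^sup>2)"
      by (metis of_real_diff of_real_mult)
    then show ?thesis
      unfolding trace_hermitian_sq[OF X] trace_skew_hermitian_sq[OF Y]
      by (simp add: sum_negf algebra_simps del: of_real_mult of_real_power of_real_divide)
  qed
  finally have 1: "polar_form A A = of_real h"
    unfolding polar_form_def h_def by simp
  have "(norm A)\<^sup>2 = (\<Sum>i\<in>UNIV. (norm (X + Y i))\<^sup>2)"
    by (simp add: norm_vec_def[of A] L2_set_def sum_nonneg AXY)
  also have "\<dots> \<le> (\<Sum>i\<in>UNIV. 2 * (norm X)\<^sup>2 + 2 * (norm (Y i))\<^sup>2)"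
  proof (intro sum_mono)
    fix i
    have "(norm (X + Y i))\<^sup>2 \<le> (norm X + norm (Y i))\<^sup>2" by (intro power_mono norm_triangle_ineq) auto
    also have "\<dots> \<le> 2 * (norm X)\<^sup>2 + 2 * (norm (Y i))\<^sup>2"
      using sum_squares_bound[of "norm X" "norm (Y i)"] by (simp add: power2_sum)
    finally show "(norm (X + Y i))\<^sup>2 \<le> 2 * (norm X)\<^sup>2 + 2 * (norm (Y i))\<^sup>2" .
  qed
  also have "\<dots> = 2 * ?k * (norm X)\<^sup>2 + 2 * (\<Sum>i\<in>UNIV. (norm (Y i))\<^sup>2)"
    by (simp add: sum.distrib sum_distrib_left)
  also have "\<dots> \<le> 2 * ?k * (?k / (?k - 1) * (norm X)\<^sup>2) + 2 * ?k * (\<Sum>i\<in>UNIV. (norm (Y i))\<^sup>2)"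
  proof (intro add_mono mult_left_mono mult_right_mono)
    have "1 * (norm X)\<^sup>2 \<le> ?k / (?k - 1) * (norm X)\<^sup>2"
      using k by (intro mult_right_mono) (auto simp: field_simps)
    then show "(norm X)\<^sup>2 \<le> ?k / (?k - 1) * (norm X)\<^sup>2" by simp
  qed (use k in \<open>auto intro: sum_nonneg\<close>)
  finally have "(norm A)\<^sup>2 \<le> 2 * ?k * (?k / (?k - 1) * (norm X)\<^sup>2 + (\<Sum>i\<in>UNIV. (norm (Y i))\<^sup>2))"
    by (simp only: distrib_left)
  then have "?N / (2 * ?k) * (norm A)\<^sup>2 \<le> ?N / (2 * ?k) * (2 * ?k * (?k / (?k - 1) * (norm X)\<^sup>2 + (\<Sum>i\<in>UNIV. (norm (Y i))\<^sup>2)))"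
    by (intro mult_left_mono) auto
  also have "\<dots> = h" unfolding h_def using k by simp
  finally have 2: "?N / (2 * ?k) * (norm A)\<^sup>2 \<le> h" .
  from 1 2 show ?thesis by blast
qed

text \<open>\<open>E_space\<close> is the real form of the space of all tuples of matrices fixed by this
  antilinear involution.\<close>

definition real_structure :: "(complex^'n^'n)^'k \<Rightarrow> (complex^'n^'n)^'k" where
  "real_structure A = (\<chi> i a b. - cnj (A $ i $ b $ a) + 2 / of_nat CARD('k) * (\<Sum>j\<in>UNIV. cnj (A $ j $ b $ a)))"

lemma real_structure_nth [simp]: "real_structure (A :: (complex^'n^'n)^'k) $ i $ a $ b =
    - cnj (A $ i $ b $ a) + 2 / of_nat CARD('k) * (\<Sum>j\<in>UNIV. cnj (A $ j $ b $ a))"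
  by (simp add: real_structure_def)

text \<open>The k correction terms with coefficient 2 / k turn the factor -1 into -1 + 2 = 1. So the
  involution acts on the mean of the A_i as the conjugate transpose and on the deviations from the
  mean as its negative; its fixed points have hermitian mean and skew-hermitian deviations.\<close>

lemma real_structure_sum: "(\<Sum>i\<in>UNIV. real_structure (A :: (complex^'n^'n)^'k) $ i $ a $ b) = (\<Sum>j\<in>UNIV. cnj (A $ j $ b $ a))"
  by (simp add: sum.distrib sum_subtractf)

lemma real_structure_involution: "real_structure (real_structure A) = (A :: (complex^'n^'n)^'k)"
proof -
  have "(\<Sum>j\<in>UNIV. cnj (real_structure A $ j $ b $ a)) = (\<Sum>j\<in>UNIV. A $ j $ a $ b)" for a b
    by (simp only: cnj_sum [symmetric] real_structure_sum) simp
  then have "real_structure (real_structure A) $ i $ a $ b = A $ i $ a $ b" for i a b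
    by (subst real_structure_nth, simp only:) simp
  then show ?thesis by (simp add: vec_eq_iff)
qed

lemma E_spaceI:
  fixes A :: "(complex^'n^'n)^'k"
  assumes "real_structure A = A"
  shows "A \<in> E_space"
proof -
  \<comment> \<open>The hermitian part has to be the mean of the A_i, because the Y_i sum to
    0.\<close>
  define X where "X = (1 / real CARD('k)) *\<^sub>R (\<Sum>j\<in>UNIV. A $ j)"
  have X: "X $ a $ b = 1 / of_nat CARD('k) * (\<Sum>j\<in>UNIV. A $ j $ a $ b)" for a b
    by (simp add: X_def scaleR_conv_of_real[where 'a = complex])
  have s: "(\<Sum>j\<in>UNIV. cnj (A $ j $ b $ a)) = (\<Sum>j\<in>UNIV. A $ j $ a $ b)" for a b
    using real_structure_sum[of A a b] assms by simp
  have fx: "A $ i $ a $ b = - cnj (A $ i $ b $ a) + 2 / of_nat CARD('k) * (\<Sum>j\<in>UNIV. A $ j $ a $ b)" for i a b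
    using real_structure_nth[of A i a b] unfolding assms s .
  have Xc: "cnj (X $ b $ a) = X $ a $ b" for a b
    unfolding X by (simp add: s)
  have "hermitian X"
    unfolding hermitian_def by (simp add: vec_eq_iff conj_transpose_def map_matrix_def transpose_def Xc)
  moreover have "skew_hermitian (A $ i - X)" for i
  proof -
    have "cnj (A $ i $ b $ a) - X $ a $ b = X $ a $ b - A $ i $ a $ b" for a b
      using fx[of i a b] unfolding X by simp
    then show ?thesis
      unfolding skew_hermitian_def
      by (simp add: vec_eq_iff conj_transpose_def map_matrix_def transpose_def Xc)
  qed
  moreover have "(\<Sum>i\<in>UNIV. A $ i - X) = 0"
    by (simp add: sum_subtractf X_def sum_constant_scaleR del: sum_component sum_constant)
  ultimately show ?thesis
    unfolding E_space_def by (intro CollectI exI[of _ X] exI[of _ "\<lambda>i. A $ i - X"]) auto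
qed

text \<open>For an antilinear involution \<tau>, both (v + \<tau> v) / 2 and (v - \<tau> v) / (2 i)
  are fixed, and v is the first plus i times the second.\<close>

lemma E_space_complexification:
  fixes v :: "(complex^'n^'n)^'k"
  shows "\<exists>v1\<in>E_space. \<exists>v2\<in>E_space. \<forall>i a b. v $ i $ a $ b = v1 $ i $ a $ b + \<i> * v2 $ i $ a $ b"
proof -
  let ?w = "real_structure v"
  define v1 where "v1 = (\<chi> i a b. (v $ i $ a $ b + ?w $ i $ a $ b) / 2)"
  define v2 where "v2 = (\<chi> i a b. (v $ i $ a $ b - ?w $ i $ a $ b) / (2 * \<i>))"
  have inv: "- cnj (?w $ i $ b $ a) + 2 / of_nat CARD('k) * (\<Sum>j\<in>UNIV. cnj (?w $ j $ b $ a))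
      = v $ i $ a $ b" for i a b
    using real_structure_nth[of ?w i a b] unfolding real_structure_involution by (simp only:)
  have "real_structure v1 $ i $ a $ b = v1 $ i $ a $ b" for i a b
  proof -
    have sum2: "(\<Sum>j\<in>UNIV. cnj (v1 $ j $ b $ a)) =
        ((\<Sum>j\<in>UNIV. cnj (v $ j $ b $ a)) + (\<Sum>j\<in>UNIV. cnj (?w $ j $ b $ a))) / 2"
      unfolding v1_def by (simp add: sum.distrib sum_divide_distrib [symmetric] del: real_structure_nth)
    have v1c: "cnj (v1 $ i $ b $ a) = (cnj (v $ i $ b $ a) + cnj (?w $ i $ b $ a)) / 2"
      unfolding v1_def by (simp del: real_structure_nth)
    have alg: "- ((p + r) / 2) + c * ((P + Q) / 2) = ((- p + c * P) + (- r + c * Q)) / 2" for p r c P Q :: complex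
      by (simp add: field_simps)
    have "real_structure v1 $ i $ a $ b =
      (?w $ i $ a $ b + (- cnj (?w $ i $ b $ a) + 2 / of_nat CARD('k) * (\<Sum>j\<in>UNIV. cnj (?w $ j $ b $ a)))) / 2"
      unfolding real_structure_nth[of v1] sum2 v1c real_structure_nth[of v i a b] by (rule alg)
    then show ?thesis unfolding inv by (simp add: v1_def add.commute del: real_structure_nth)
  qed
  then have 1: "v1 \<in> E_space" by (intro E_spaceI) (simp add: vec_eq_iff)
  have "real_structure v2 $ i $ a $ b = v2 $ i $ a $ b" for i a b
  proof -
    have sum2: "(\<Sum>j\<in>UNIV. cnj (v2 $ j $ b $ a)) =
        - ((\<Sum>j\<in>UNIV. cnj (v $ j $ b $ a)) - (\<Sum>j\<in>UNIV. cnj (?w $ j $ b $ a))) / (2 * \<i>)"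
      unfolding v2_def by (simp add: sum_divide_distrib [symmetric] del: real_structure_nth)
        (simp add: sum_distrib_left sum_subtractf right_diff_distrib del: real_structure_nth)
    have v2c: "cnj (v2 $ i $ b $ a) = - (cnj (v $ i $ b $ a) - cnj (?w $ i $ b $ a)) / (2 * \<i>)"
      unfolding v2_def by (simp add: right_diff_distrib del: real_structure_nth)
    have alg: "- (- (p - r) / (2 * \<i>)) + c * (- (P - Q) / (2 * \<i>)) = - ((- p + c * P) - (- r + c * Q)) / (2 * \<i>)"
      for p r c P Q :: complex
      by (simp add: field_simps)
    have "real_structure v2 $ i $ a $ b =
      - (?w $ i $ a $ b - (- cnj (?w $ i $ b $ a) + 2 / of_nat CARD('k) * (\<Sum>j\<in>UNIV. cnj (?w $ j $ b $ a)))) / (2 * \<i>)"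
      unfolding real_structure_nth[of v2] sum2 v2c real_structure_nth[of v i a b] by (rule alg)
    then show ?thesis unfolding inv by (simp add: v2_def del: real_structure_nth)
  qed
  then have 2: "v2 \<in> E_space" by (intro E_spaceI) (simp add: vec_eq_iff)
  have "v $ i $ a $ b = v1 $ i $ a $ b + \<i> * v2 $ i $ a $ b" for i a b
    by (simp add: v1_def v2_def field_simps del: real_structure_nth)
  with 1 2 show ?thesis by blast
qed

text \<open>The inverse of \<open>s_matrix\<close> is the matrix with diagonal entries 0 and all other entries 1, so
  only entries of matrices of different colors are correlated.\<close>

lemma entry_as_polar_form:
  fixes B :: "((complex^'n^'n)^'k) set"
  assumes k: "CARD('k) \<ge> 2" and B: "finite B" "span B = E_space"
  shows "\<exists>\<gamma>. (\<forall>A. A $ i0 $ a0 $ b0 = (\<Sum>\<beta>\<in>B. \<gamma> \<beta> * polar_form \<beta> A)) \<and>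
     (\<forall>i a b. (\<Sum>\<beta>\<in>B. \<gamma> \<beta> * \<beta> $ i $ a $ b) =
        (if i \<noteq> i0 \<and> a = b0 \<and> b = a0 then 1 / of_nat CARD('n) else 0))"
proof -
  \<comment> \<open>This vector represents the entry: the transposed position (b0, a0) comes from
    the trace, 1 / N cancels the factor N of \<open>polar_form\<close>, and the dependence on the
    color is column i0 of J - I.\<close>
  define v :: "(complex^'n^'n)^'k" where
    "v = (\<chi> i a b. if i \<noteq> i0 \<and> a = b0 \<and> b = a0 then 1 / of_nat CARD('n) else 0)"
  obtain v1 v2 where v12: "v1 \<in> E_space" "v2 \<in> E_space"
    "\<And>i a b. v $ i $ a $ b = v1 $ i $ a $ b + \<i> * v2 $ i $ a $ b"
    using E_space_complexification[of v] by blast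
  obtain x where x: "v1 = (\<Sum>\<beta>\<in>B. x \<beta> *\<^sub>R \<beta>)"
    using v12(1) B span_finite[OF B(1)] by (metis (no_types, lifting) imageE)
  obtain y where y: "v2 = (\<Sum>\<beta>\<in>B. y \<beta> *\<^sub>R \<beta>)"
    using v12(2) B span_finite[OF B(1)] by (metis (no_types, lifting) imageE)
  define \<gamma> where "\<gamma> \<beta> = of_real (x \<beta>) + \<i> * of_real (y \<beta>)" for \<beta>
  have g: "(\<Sum>\<beta>\<in>B. \<gamma> \<beta> * \<beta> $ i $ a $ b) = v $ i $ a $ b" for i a b
    unfolding v12(3) x y \<gamma>_def
    by (simp add: sum_distrib_left sum.distrib ring_distribs scaleR_conv_of_real[where 'a = complex] mult_ac)
  have "(\<Sum>\<beta>\<in>B. \<gamma> \<beta> * polar_form \<beta> A) = A $ i0 $ a0 $ b0" for A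
  proof -
    have "(\<Sum>\<beta>\<in>B. \<gamma> \<beta> * polar_form \<beta> A) = polar_form v A"
    proof -
      have "(\<Sum>\<beta>\<in>B. \<gamma> \<beta> * polar_form \<beta> A) = (\<Sum>\<beta>\<in>B. \<Sum>i\<in>UNIV. \<Sum>j\<in>UNIV. \<Sum>a\<in>UNIV. \<Sum>b\<in>UNIV.
        of_nat CARD('n) * complex_of_real (s_matrix $ i $ j) * (\<gamma> \<beta> * \<beta> $ i $ a $ b) * A $ j $ b $ a)"
        by (simp add: polar_form_expand sum_distrib_left mult_ac)
      also have "\<dots> = (\<Sum>i\<in>UNIV. \<Sum>j\<in>UNIV. \<Sum>a\<in>UNIV. \<Sum>b\<in>UNIV. \<Sum>\<beta>\<in>B.
        of_nat CARD('n) * complex_of_real (s_matrix $ i $ j) * (\<gamma> \<beta> * \<beta> $ i $ a $ b) * A $ j $ b $ a)"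
        by (simp only: sum.swap[of _ _ B])
      also have "\<dots> = polar_form v A"
        unfolding polar_form_expand g [symmetric]
        by (simp add: sum_distrib_left sum_distrib_right mult_ac)
      finally show ?thesis .
    qed
    also have "\<dots> = of_nat CARD('n) * (\<Sum>i\<in>UNIV. \<Sum>j\<in>UNIV.
        complex_of_real (s_matrix $ i $ j) * (if i \<noteq> i0 then A $ j $ a0 $ b0 / of_nat CARD('n) else 0))"
    proof -
      have "(\<Sum>a\<in>UNIV. \<Sum>b\<in>UNIV. complex_of_real (s_matrix $ i $ j) * (v $ i $ a $ b * A $ j $ b $ a)) =
        complex_of_real (s_matrix $ i $ j) * (if i \<noteq> i0 then A $ j $ a0 $ b0 / of_nat CARD('n) else 0)" for i j
      proof -
        have "(\<Sum>a\<in>UNIV. \<Sum>b\<in>UNIV. complex_of_real (s_matrix $ i $ j) * (v $ i $ a $ b * A $ j $ b $ a)) =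
         (\<Sum>a\<in>UNIV. \<Sum>b\<in>UNIV. if b = a0 then if a = b0 then complex_of_real (s_matrix $ i $ j) *
            ((if i \<noteq> i0 then 1 / of_nat CARD('n) else 0) * A $ j $ b $ a) else 0 else 0)"
          by (intro sum.cong refl) (auto simp: v_def)
        also have "\<dots> = complex_of_real (s_matrix $ i $ j) * (if i \<noteq> i0 then A $ j $ a0 $ b0 / of_nat CARD('n) else 0)"
          by (simp add: sum.delta)
        finally show ?thesis .
      qed
      then show ?thesis unfolding polar_form_expand by simp
    qed
    also have "\<dots> = (\<Sum>j\<in>UNIV. (\<Sum>i\<in>UNIV - {i0}. complex_of_real (s_matrix $ i $ j)) * A $ j $ a0 $ b0)"
    proof -
      have "(\<Sum>i\<in>UNIV. complex_of_real (s_matrix $ i $ j) * (if i \<noteq> i0 then A $ j $ a0 $ b0 / of_nat CARD('n) else 0))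
        = (\<Sum>i\<in>UNIV-{i0}. complex_of_real (s_matrix $ i $ j) * (A $ j $ a0 $ b0 / of_nat CARD('n)))" for j
        by (rule sum.mono_neutral_cong_right) auto
      then show ?thesis
        by (subst sum.swap) (simp add: sum_distrib_left sum_distrib_right)
    qed
    also have "\<dots> = (\<Sum>j\<in>UNIV. if j = i0 then A $ j $ a0 $ b0 else 0)"
    proof (intro sum.cong refl)
      fix j
      \<comment> \<open>This is row i0 of the identity (J - I) s = I.\<close>
      have "(\<Sum>i\<in>UNIV-{i0}. (s_matrix :: real^'k^'k) $ i $ j) = (if j = i0 then 1 else 0)"
        using k by (simp add: s_matrix_nth sum_subtractf sum.delta of_nat_diff)
      then have "(\<Sum>i\<in>UNIV-{i0}. complex_of_real ((s_matrix :: real^'k^'k) $ i $ j)) = (if j = i0 then 1 else 0)"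
        by (metis (mono_tags, lifting) of_real_0 of_real_1 of_real_sum sum.cong)
      then show "(\<Sum>i\<in>UNIV-{i0}. complex_of_real (s_matrix $ i $ j)) * A $ j $ a0 $ b0 = (if j = i0 then A $ j $ a0 $ b0 else 0)"
        by simp
    qed
    also have "\<dots> = A $ i0 $ a0 $ b0" by simp
    finally show ?thesis .
  qed
  then show ?thesis using g by (intro exI[of _ \<gamma>]) (auto simp: v_def)
qed

section \<open>The Wick formula for matrix entries\<close>

locale matrix_gaussian =
  fixes B :: "((complex^'n^'n)^'k) set"
  assumes k2: "CARD('k) \<ge> 2" and indepB: "independent B" and spanB: "span B = E_space"
begin

sublocale gaussian_form B polar_form "real CARD('n) / (2 * real CARD('k))"
proof
  fix x :: "(complex^'n^'n)^'k" assume "x \<in> span B"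
  then show "real CARD('n) / (2 * real CARD('k)) * (norm x)\<^sup>2 \<le> Re (polar_form x x)"
    using polar_form_E[OF k2, of x] spanB by auto
qed (use indepB bilinear_polar_form polar_form_sym[OF k2] k2 in auto)

lemma w_eq: "w = gauss_weight"
  by (simp add: fun_eq_iff w_def gauss_weight_eq)

lemma linear_entry: "linear (\<lambda>A :: (complex^'n^'n)^'k. A $ i $ a $ b)"
  by (simp add: linear_iff)

text \<open>On the space the weight is a positive real number. Were its integral 0, the whole
  coefficient space would be a null set, although it contains the unit cube.\<close>

lemma integral_w_nonzero: "(LINT t|\<mu>. w (T t)) \<noteq> 0"
proof
  assume 0: "(LINT t|\<mu>. w (T t)) = 0"
  interpret product_sigma_finite "\<lambda>_. lborel :: real measure" by standard
  have int: "integrable \<mu> (\<lambda>t. w (T t))"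
    using integrable_exponential_growth[of "\<lambda>_. 1" 1 0] by simp
  have re: "w (T t) = of_real (Re (w (T t)))" "Re (w (T t)) > 0" for t
  proof -
    obtain h where h: "polar_form (T t) (T t) = of_real h"
      using polar_form_E[OF k2, of "T t"] T_in_span[of t] spanB by auto
    have "w (T t) = of_real (exp (- h / 2))"
      unfolding w_def h exp_of_real [symmetric] by simp
    then show "w (T t) = of_real (Re (w (T t)))" "Re (w (T t)) > 0" by simp_all
  qed
  have "(LINT t|\<mu>. Re (w (T t))) = 0" using 0 integral_Re[OF int] by simp
  moreover have "integrable \<mu> (\<lambda>t. Re (w (T t)))" using int by (rule integrable_Re)
  ultimately have "AE t in \<mu>. Re (w (T t)) = 0"
    by (subst (asm) integral_nonneg_eq_0_iff_AE) (use re in \<open>auto intro: less_imp_le\<close>)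
  then have "AE t in \<mu>. False" by (rule AE_mp) (use re(2) in \<open>auto simp: less_imp_neq[symmetric]\<close>)
  then have "emeasure \<mu> (space \<mu>) = 0"
    using AE_E2[where M = \<mu> and P = "\<lambda>_. False"] by simp
  moreover have "emeasure \<mu> (PiE B (\<lambda>_. {0..1})) = 1"
    by (subst emeasure_PiM) (auto simp: finite_B)
  moreover have "PiE B (\<lambda>_. {0..1}) \<subseteq> space \<mu>" by (auto simp: space_PiM PiE_def)
  ultimately show False
    by (metis emeasure_mono le_zero_eq sets.top zero_neq_one)
qed

text \<open>Stein's identity removes one entry r0 and pairs it with each remaining entry in turn;
  the induction hypothesis then handles all others. A set of odd size has no pairings, so the
  rounding in \<open>div\<close> does no harm.\<close>

theorem wick:
  fixes col :: "'r \<Rightarrow> 'k" and x y :: "'r \<Rightarrow> 'n"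
  assumes "finite R"
  shows "(LINT t|\<mu>. (\<Prod>r\<in>R. T t $ col r $ x r $ y r) * w (T t)) =
    (\<Sum>\<sigma>\<in>pairings R. if \<forall>r\<in>R. col r \<noteq> col (\<sigma> r) \<and> x r = y (\<sigma> r)
        then (1 / of_nat CARD('n)) ^ (card R div 2) else 0) * (LINT t|\<mu>. w (T t))"
  using assms
proof (induction R rule: finite_psubset_induct)
  case (psubset R)
  let ?Z = "LINT t|\<mu>. w (T t)"
  let ?P = "\<lambda>r s. col r \<noteq> col s \<and> x r = y s"
  let ?W = "\<lambda>R \<sigma>. if \<forall>r\<in>R. ?P r (\<sigma> r) then (1 / of_nat CARD('n) :: complex) ^ (card R div 2) else 0"
  show ?case
  proof (cases "R = {}")
    case True
    have "pairings {} = {id :: 'r \<Rightarrow> 'r}" by (auto simp: pairings_def)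
    with True show ?thesis by simp
  next
    case False
    then obtain r0 where r0: "r0 \<in> R" by blast
    obtain \<gamma> where g1: "\<And>A. A $ col r0 $ x r0 $ y r0 = (\<Sum>\<beta>\<in>B. \<gamma> \<beta> * polar_form \<beta> A)"
      and g2: "\<And>i a b. (\<Sum>\<beta>\<in>B. \<gamma> \<beta> * \<beta> $ i $ a $ b) =
        (if i \<noteq> col r0 \<and> a = y r0 \<and> b = x r0 then 1 / of_nat CARD('n) else 0)"
      using entry_as_polar_form[OF k2 finite_B spanB, of "col r0" "x r0" "y r0"] by blast
    have "(LINT t|\<mu>. (\<Prod>r\<in>R. T t $ col r $ x r $ y r) * w (T t)) =
      (LINT t|\<mu>. T t $ col r0 $ x r0 $ y r0 * (\<Prod>r\<in>R-{r0}. T t $ col r $ x r $ y r) * w (T t))"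
      using r0 psubset.hyps by (simp add: prod.remove)
    also have "\<dots> = (\<Sum>r\<in>R-{r0}. (\<Sum>\<beta>\<in>B. \<gamma> \<beta> * \<beta> $ col r $ x r $ y r) *
        (LINT t|\<mu>. (\<Prod>r'\<in>R-{r0}-{r}. T t $ col r' $ x r' $ y r') * w (T t)))"
      by (rule stein[where M = "\<lambda>A. A $ col r0 $ x r0 $ y r0"]) (use psubset.hyps linear_entry g1 in auto)
    \<comment> \<open>The covariance enforces both index identities at once, which is what the
      condition on a pairing demands at r0 and at its partner r together.\<close>
    also have "\<dots> = (\<Sum>r\<in>R-{r0}. (if ?P r0 r \<and> ?P r r0 then 1 / of_nat CARD('n) else 0) *
        ((\<Sum>\<sigma>\<in>pairings (R-{r0,r}). ?W (R-{r0,r}) \<sigma>) * ?Z))"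
    proof (intro sum.cong refl arg_cong2[where f = "(*)"])
      fix r assume r: "r \<in> R - {r0}"
      show "(\<Sum>\<beta>\<in>B. \<gamma> \<beta> * \<beta> $ col r $ x r $ y r) = (if ?P r0 r \<and> ?P r r0 then 1 / of_nat CARD('n) else 0)"
        unfolding g2 by auto
      have "R - {r0} - {r} = R - {r0, r}" by auto
      then show "(LINT t|\<mu>. (\<Prod>r'\<in>R-{r0}-{r}. T t $ col r' $ x r' $ y r') * w (T t)) =
        (\<Sum>\<sigma>\<in>pairings (R-{r0,r}). ?W (R-{r0,r}) \<sigma>) * ?Z"
        using psubset.IH[of "R - {r0, r}"] r0 by auto
    qed
    also have "\<dots> = (\<Sum>r\<in>R-{r0}. (\<Sum>\<sigma>\<in>pairings (R-{r0,r}). ?W R (\<sigma>(r0 := r, r := r0))) * ?Z)"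
    proof (intro sum.cong refl)
      fix r assume r: "r \<in> R - {r0}"
      have "(if ?P r0 r \<and> ?P r r0 then 1 / of_nat CARD('n) else 0) * ?W (R-{r0,r}) \<sigma> = ?W R (\<sigma>(r0 := r, r := r0))"
        if s: "\<sigma> \<in> pairings (R-{r0,r})" for \<sigma>
      proof -
        have s2: "{r0, r} \<subseteq> R" "card {r0, r} = 2" using r r0 by (auto simp: card_2_iff)
        have "card R \<ge> 2" using card_mono[OF psubset.hyps(1) s2(1)] s2(2) by simp
        then have c: "card R div 2 = Suc (card (R - {r0, r}) div 2)"
          using s2 psubset.hyps by (simp add: card_Diff_subset)
        have "(\<forall>q\<in>R. ?P q ((\<sigma>(r0 := r, r := r0)) q)) \<longleftrightarrow> ?P r0 r \<and> ?P r r0 \<and> (\<forall>q\<in>R-{r0,r}. ?P q (\<sigma> q))"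
          using r r0 by auto
        then show ?thesis unfolding c by auto
      qed
      then have "(if ?P r0 r \<and> ?P r r0 then 1 / of_nat CARD('n) else 0) *
          (\<Sum>\<sigma>\<in>pairings (R-{r0,r}). ?W (R-{r0,r}) \<sigma>) =
          (\<Sum>\<sigma>\<in>pairings (R-{r0,r}). ?W R (\<sigma>(r0 := r, r := r0)))"
        by (subst sum_distrib_left) (intro sum.cong refl)
      then show "(if ?P r0 r \<and> ?P r r0 then 1 / of_nat CARD('n) else 0) *
          ((\<Sum>\<sigma>\<in>pairings (R-{r0,r}). ?W (R-{r0,r}) \<sigma>) * ?Z) =
          (\<Sum>\<sigma>\<in>pairings (R-{r0,r}). ?W R (\<sigma>(r0 := r, r := r0))) * ?Z"
        by (simp only: mult.assoc [symmetric])
    qed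
    also have "\<dots> = (\<Sum>r\<in>R-{r0}. \<Sum>\<sigma>\<in>pairings (R-{r0,r}). ?W R (\<sigma>(r0 := r, r := r0))) * ?Z"
      by (rule sum_distrib_right [symmetric])
    also have "\<dots> = (\<Sum>\<sigma>\<in>pairings R. ?W R \<sigma>) * ?Z"
      by (subst sum_pairings_remove[OF psubset.hyps(1) r0]) simp
    finally show ?thesis .
  qed
qed

end

section \<open>Gluings as pairings of darts\<close>

text \<open>This turns a base point on a circle into a numbering of the gluing points on it.\<close>

lemma cyclic_on_funpow:
  assumes "cyclic_on f P" "s \<in> P"
  shows "bij_betw (\<lambda>t. (f ^^ t) s) {..<card P} P" "(f ^^ card P) s = s"
proof -
  have P: "P = orbit f s" "s \<in> orbit f s" using assms by (auto simp: cyclic_on_alldef)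
  let ?d = "funpow_dist1 f s s"
  have im: "P = (\<lambda>t. (f ^^ t) s) ` {0..<?d}" using P orbit_conv_funpow_dist1[OF P(2)] by simp
  have inj: "inj_on (\<lambda>t. (f ^^ t) s) {0..<?d}" using inj_on_funpow_dist1[OF P(2)] .
  have c: "card P = ?d" using card_image[OF inj] im by simp
  show "bij_betw (\<lambda>t. (f ^^ t) s) {..<card P} P"
    unfolding bij_betw_def c using inj im by (simp add: atLeast0LessThan)
  show "(f ^^ card P) s = s" unfolding c using funpow_dist1_prop[OF P(2)] .
qed

text \<open>\<open>orbit\<close> consists of the iterates with positive exponent, so it takes
  finiteness for a point to recur. Restricting the map to \<open>R\<close> makes it a permutation of
  a finite set and leaves the orbit unchanged.\<close>

lemma self_in_orbit_bij_betw:
  assumes "finite R" "bij_betw g R R" "r \<in> R"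
  shows "r \<in> orbit g r"
proof -
  have "perm_restrict g R permutes R"
    by (rule bij_imp_permutes)
       (use assms(2) in \<open>auto simp: perm_restrict_def cong: bij_betw_cong\<close>)
  then have "permutation (perm_restrict g R)" using assms(1) by (auto simp: permutation_permutes)
  then have "r \<in> orbit (perm_restrict g R) r" by (rule permutation_self_in_orbit)
  also have "orbit (perm_restrict g R) r = orbit g r"
    by (rule orbit_cong0[OF assms(3)]) (use assms(2) in \<open>auto simp: perm_restrict_def bij_betw_def\<close>)
  finally show ?thesis .
qed

lemma orbit_subset_of_maps:
  assumes "\<And>x. x \<in> R \<Longrightarrow> g x \<in> R" "r \<in> R"
  shows "orbit g r \<subseteq> R"
proof
  fix y assume "y \<in> orbit g r"
  then show "y \<in> R" by induction (use assms in auto)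
qed

text \<open>\<open>\<Phi>\<close> conjugates \<open>g\<close> to \<open>h\<close> and hence carries
  orbits to orbits. It serves to count the faces of a gluing on the darts.\<close>

lemma card_orbits_transport:
  assumes "finite R" "bij_betw g R R" "bij_betw \<Phi> R A" "\<And>r. r \<in> R \<Longrightarrow> \<Phi> (g r) = h (\<Phi> r)"
  shows "card (orbit h ` A) = card (orbit g ` R)"
proof -
  have gR: "g r \<in> R" if "r \<in> R" for r using assms(2) that by (auto simp: bij_betw_def)
  have sub: "orbit g r \<subseteq> R" if "r \<in> R" for r using orbit_subset_of_maps gR that by metis
  have "\<Phi> ` orbit g r = orbit h (\<Phi> r)" if "r \<in> R" for r
  proof (rule orbit_inverse)
    show "r \<in> orbit g r" by (rule self_in_orbit_bij_betw[OF assms(1,2) that])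
    fix x assume "x \<in> orbit g r"
    then have "x \<in> R" using sub[OF that] by blast
    then show "h (\<Phi> x) = \<Phi> (g x)" using assms(4) by simp
  qed
  then have "orbit h ` A = (`) \<Phi> ` (orbit g ` R)"
    using assms(3) by (auto simp: bij_betw_def image_image)
  moreover have "inj_on ((`) \<Phi>) (orbit g ` R)"
    by (rule inj_on_subset[OF inj_on_image_Pow[of \<Phi> R]]) (use assms(3) sub in \<open>auto simp: bij_betw_def\<close>)
  ultimately show ?thesis by (simp add: card_image)
qed

section \<open>Darts, labellings and the pairings they induce\<close>

definition darts :: "'c set \<Rightarrow> ('c \<Rightarrow> nat) \<Rightarrow> ('c \<times> nat) set" where
  "darts S n = (SIGMA c:S. {..<n c})"

definition next_dart :: "('c \<Rightarrow> nat) \<Rightarrow> 'c \<times> nat \<Rightarrow> 'c \<times> nat" where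
  "next_dart n r = (fst r, if Suc (snd r) = n (fst r) then 0 else Suc (snd r))"

definition prev_dart :: "('c \<Rightarrow> nat) \<Rightarrow> 'c \<times> nat \<Rightarrow> 'c \<times> nat" where
  "prev_dart n r = (fst r, if snd r = 0 then n (fst r) - 1 else snd r - 1)"

lemma finite_darts: "finite S \<Longrightarrow> finite (darts S n)"
  by (auto simp: darts_def)

lemma next_dart_in: "r \<in> darts S n \<Longrightarrow> next_dart n r \<in> darts S n"
  by (auto simp: darts_def next_dart_def)

lemma prev_dart_in: "r \<in> darts S n \<Longrightarrow> prev_dart n r \<in> darts S n"
  by (auto simp: darts_def prev_dart_def)

lemma prev_next_dart: "r \<in> darts S n \<Longrightarrow> prev_dart n (next_dart n r) = r"
  by (auto simp: darts_def prev_dart_def next_dart_def)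

lemma next_prev_dart: "r \<in> darts S n \<Longrightarrow> next_dart n (prev_dart n r) = r"
  by (auto simp: darts_def prev_dart_def next_dart_def)

lemma fst_next_dart [simp]: "fst (next_dart n r) = fst r"
  by (simp add: next_dart_def)

lemma bij_betw_next_dart: "bij_betw (next_dart n) (darts S n) (darts S n)"
  by (rule bij_betw_byWitness[where f' = "prev_dart n"])
     (auto simp: prev_next_dart next_prev_dart next_dart_in prev_dart_in)

lemma cyclic_on_next_dart:
  assumes "0 < n c"
  shows "cyclic_on (next_dart n) ({c} \<times> {..<n c})"
proof -
  have f: "(next_dart n ^^ t) (c, 0) = (c, t)" if "t < n c" for t
    using that by (induction t) (auto simp: next_dart_def)
  have "(next_dart n ^^ n c) (c, 0) = next_dart n ((next_dart n ^^ (n c - 1)) (c, 0))"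
    using assms by (metis Suc_diff_1 comp_apply funpow.simps(2))
  also have "\<dots> = (c, 0)" using assms by (simp add: f next_dart_def)
  finally have "orbit (next_dart n) (c, 0) = {(next_dart n ^^ t) (c, 0) |t. t < n c}"
    using assms by (rule orbit_altdef_bounded)
  also have "\<dots> = {c} \<times> {..<n c}" using f by force
  finally show ?thesis using assms by (intro cyclic_on_singleI[of "(c, 0)"]) auto
qed

text \<open>A dart r stands for the arc of the circle \<open>fst r\<close> that starts at the gluing
  point \<open>\<pi> r\<close>. Since labels must follow the orientation, a labelling is a choice of
  base points \<open>(c, 0)\<close>; extensionality makes such choices countable as
  functions.\<close>

definition labelling :: "'k circle set \<Rightarrow> ('k circle \<Rightarrow> nat) \<Rightarrow> 'k gluing \<Rightarrow> ('k circle \<times> nat \<Rightarrow> nat) \<Rightarrow> bool" where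
  "labelling S n D \<pi> \<longleftrightarrow> \<pi> \<in> extensional (darts S n) \<and>
     bij_betw (\<lambda>r. (\<pi> r, fst r)) (darts S n) (arcs D) \<and>
     (\<forall>r\<in>darts S n. \<pi> (next_dart n r) = succ_on D (fst r) (\<pi> r))"

definition compatible :: "'k circle set \<Rightarrow> ('k circle \<Rightarrow> nat) \<Rightarrow> ('k circle \<times> nat \<Rightarrow> nat) \<Rightarrow>
    ('k circle \<times> nat \<Rightarrow> 'k circle \<times> nat) \<Rightarrow> bool" where
  "compatible S n \<pi> \<sigma> \<longleftrightarrow> \<sigma> \<in> pairings (darts S n) \<and> (\<forall>r\<in>darts S n. \<pi> (\<sigma> r) = \<pi> r)"

definition num_points :: "'k circle set \<Rightarrow> 'k gluing \<Rightarrow> 'k circle \<Rightarrow> nat" where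
  "num_points S D = (\<lambda>c\<in>S. card (points_on D c))"

text \<open>\<open>gluing_iso\<close> constrains a map on the gluing points only; extensionality
  selects one function for each automorphism.\<close>

definition automorphisms :: "'k gluing \<Rightarrow> (nat \<Rightarrow> nat) set" where
  "automorphisms D = {f \<in> extensional (points D). gluing_iso f D D}"

lemma admissibleD:
  assumes "D \<in> admissible S"
  shows "finite (points D)" "p \<in> points D \<Longrightarrow> circles_at D p \<subseteq> S"
    "p \<in> points D \<Longrightarrow> card (circles_at D p) = 2" "p \<in> points D \<Longrightarrow> inj_on fst (circles_at D p)"
    "c \<in> S \<Longrightarrow> points_on D c \<noteq> {}" "c \<in> S \<Longrightarrow> cyclic_on (succ_on D c) (points_on D c)"
  using assms unfolding admissible_def constellation_def isolated_def no_triple_points_def by force+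

lemma finite_points_on: "D \<in> admissible S \<Longrightarrow> finite (points_on D c)"
  by (simp add: points_on_def admissibleD(1))

lemma num_points_in: "D \<in> admissible S \<Longrightarrow> num_points S D \<in> S \<rightarrow>\<^sub>E {1..}"
  using admissibleD(5) finite_points_on by (fastforce simp: num_points_def Suc_le_eq card_gt_0_iff)

lemma arcs_Sigma: "arcs D = (SIGMA p:points D. circles_at D p)"
  by (auto simp: arcs_def)

lemma succ_on_in_points:
  assumes "D \<in> admissible S" "p \<in> points D" "c \<in> circles_at D p"
  shows "succ_on D c p \<in> points D"
proof -
  have "c \<in> S" using admissibleD(2)[OF assms(1,2)] assms(3) by blast
  moreover have "p \<in> points_on D c" using assms(2,3) by (simp add: points_on_def)
  ultimately have "succ_on D c p \<in> points_on D c" using admissibleD(6)[OF assms(1)] cyclic_on_inI by metis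
  then show ?thesis by (simp add: points_on_def)
qed

lemma labelling_num_points:
  assumes "labelling S n D \<pi>" "c \<in> S"
  shows "n c = card (points_on D c)"
proof -
  let ?\<Phi> = "\<lambda>r. (\<pi> r, fst r)"
  have b: "bij_betw ?\<Phi> (darts S n) (arcs D)" using assms(1) by (simp add: labelling_def)
  have "?\<Phi> ` ({c} \<times> {..<n c}) = points_on D c \<times> {c}"
  proof
    show "?\<Phi> ` ({c} \<times> {..<n c}) \<subseteq> points_on D c \<times> {c}"
    proof (rule image_subsetI)
      fix r assume "r \<in> {c} \<times> {..<n c}"
      then have r: "r \<in> darts S n" "fst r = c" using assms(2) by (auto simp: darts_def)
      have "?\<Phi> r \<in> arcs D" by (rule bij_betw_apply[OF b r(1)])
      then show "?\<Phi> r \<in> points_on D c \<times> {c}" using r(2) by (simp add: arcs_def points_on_def)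
    qed
    show "points_on D c \<times> {c} \<subseteq> ?\<Phi> ` ({c} \<times> {..<n c})"
    proof (rule subsetI)
      fix x assume "x \<in> points_on D c \<times> {c}"
      then obtain p where p: "x = (p, c)" "p \<in> points_on D c" by blast
      then have "(p, c) \<in> ?\<Phi> ` darts S n" using b by (simp add: bij_betw_def points_on_def arcs_def)
      then obtain r where r: "r \<in> darts S n" "p = \<pi> r" "fst r = c" by auto
      then show "x \<in> ?\<Phi> ` ({c} \<times> {..<n c})"
        unfolding p by (intro image_eqI[of _ _ r]) (auto simp: darts_def)
    qed
  qed
  moreover have "card (?\<Phi> ` ({c} \<times> {..<n c})) = card ({c} \<times> {..<n c})"
    by (intro card_image, rule inj_on_subset[of ?\<Phi> "darts S n"]) (use b assms(2) in \<open>auto simp: bij_betw_def darts_def\<close>)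
  ultimately have "card (points_on D c \<times> {c}) = card ({c} \<times> {..<n c})" by simp
  then show ?thesis by (simp add: card_cartesian_product)
qed

lemma labelling_num_points_eq:
  assumes "labelling S n D \<pi>" "n \<in> S \<rightarrow>\<^sub>E {1..}"
  shows "n = num_points S D"
proof
  fix c show "n c = num_points S D c"
    using labelling_num_points[OF assms(1), of c] assms(2)
    by (cases "c \<in> S") (simp_all add: num_points_def PiE_arb[OF assms(2)])
qed

text \<open>The label of \<open>(c, t)\<close> is obtained from that of \<open>(c, 0)\<close> by t
  steps along the circle, and any point of the circle may serve as base point because the successor
  map is a single cycle.\<close>

lemma bij_betw_labellings:
  assumes D: "D \<in> admissible S"
  shows "bij_betw (\<lambda>\<pi>. \<lambda>c\<in>S. \<pi> (c, 0)) {\<pi>. labelling S (num_points S D) D \<pi>} (PiE S (points_on D))"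
proof -
  let ?n = "num_points S D" and ?R = "darts S (num_points S D)"
  define lab where "lab s = restrict (\<lambda>r. (succ_on D (fst r) ^^ snd r) (s (fst r))) ?R" for s :: "'a circle \<Rightarrow> nat"
  have n: "?n c = card (points_on D c)" "?n c > 0" if "c \<in> S" for c
    using that PiE_mem[OF num_points_in[OF D] that] by (auto simp: num_points_def)
  have lab: "labelling S ?n D (lab s)" if s: "s \<in> PiE S (points_on D)" for s
    unfolding labelling_def
  proof (intro conjI ballI)
    show "lab s \<in> extensional ?R" by (simp add: lab_def)
    have bc: "bij_betw (\<lambda>t. (succ_on D c ^^ t) (s c)) {..<?n c} (points_on D c)"
      and lc: "(succ_on D c ^^ ?n c) (s c) = s c" if c: "c \<in> S" for c
      using cyclic_on_funpow[OF admissibleD(6)[OF D c], of "s c"] s c n(1)[OF c] by auto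
    show "bij_betw (\<lambda>r. (lab s r, fst r)) ?R (arcs D)"
    proof (rule bij_betw_imageI)
      show "inj_on (\<lambda>r. (lab s r, fst r)) ?R"
      proof (rule inj_onI)
        fix r r' assume r: "r \<in> ?R" "r' \<in> ?R" and "(lab s r, fst r) = (lab s r', fst r')"
        then have eq: "lab s r = lab s r'" "fst r' = fst r" by auto
        have m: "fst r \<in> S" "snd r < ?n (fst r)" "snd r' < ?n (fst r)"
          using r eq(2) by (auto simp: darts_def)
        have "(succ_on D (fst r) ^^ snd r) (s (fst r)) = (succ_on D (fst r) ^^ snd r') (s (fst r))"
          using eq r by (simp add: lab_def)
        then have "snd r = snd r'"
          using bc[OF m(1)] m by (auto simp: bij_betw_def inj_on_def)
        then show "r = r'" using eq(2) by (simp add: prod_eq_iff)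
      qed
      show "(\<lambda>r. (lab s r, fst r)) ` ?R = arcs D"
      proof
        show "(\<lambda>r. (lab s r, fst r)) ` ?R \<subseteq> arcs D"
        proof (rule image_subsetI)
          fix r assume r: "r \<in> ?R"
          then have "fst r \<in> S" "snd r \<in> {..<?n (fst r)}" by (auto simp: darts_def)
          then have "(succ_on D (fst r) ^^ snd r) (s (fst r)) \<in> points_on D (fst r)"
            using bij_betw_apply[OF bc] by blast
          then show "(lab s r, fst r) \<in> arcs D" using r by (simp add: lab_def arcs_def points_on_def)
        qed
        show "arcs D \<subseteq> (\<lambda>r. (lab s r, fst r)) ` ?R"
        proof (rule subsetI)
          fix x assume "x \<in> arcs D"
          then obtain p c where x: "x = (p, c)" and "p \<in> points D" "c \<in> circles_at D p" by (auto simp: arcs_def)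
          then have p: "p \<in> points_on D c" "c \<in> S"
            using admissibleD(2)[OF D] by (auto simp: points_on_def)
          then obtain t where "t < ?n c" "p = (succ_on D c ^^ t) (s c)"
            using bc[of c] by (auto simp: bij_betw_def)
          with p show "x \<in> (\<lambda>r. (lab s r, fst r)) ` ?R"
            unfolding x by (intro image_eqI[of _ _ "(c, t)"]) (auto simp: lab_def darts_def)
        qed
      qed
    qed
    fix r assume r: "r \<in> ?R"
    then have c: "fst r \<in> S" "snd r < ?n (fst r)" by (auto simp: darts_def)
    show "lab s (next_dart ?n r) = succ_on D (fst r) (lab s r)"
    proof (cases "Suc (snd r) = ?n (fst r)")
      \<comment> \<open>At the last dart \<open>next_dart\<close> wraps around to 0, and the labels
        must close up: \<open>n c\<close> steps along the cycle lead back to the base point.\<close>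
      case True
      then have "next_dart ?n r = (fst r, 0)" by (simp add: next_dart_def)
      moreover have "succ_on D (fst r) (lab s r) = (succ_on D (fst r) ^^ Suc (snd r)) (s (fst r))"
        using r by (simp add: lab_def)
      ultimately show ?thesis
        using lc[OF c(1)] next_dart_in[OF r] unfolding True by (simp add: lab_def)
    next
      case False
      then show ?thesis using r next_dart_in[OF r] by (simp add: lab_def next_dart_def)
    qed
  qed
  show ?thesis
  proof (rule bij_betw_byWitness[where f' = lab])
    show "\<forall>\<pi>\<in>{\<pi>. labelling S ?n D \<pi>}. lab (\<lambda>c\<in>S. \<pi> (c, 0)) = \<pi>"
    proof
      fix \<pi> assume "\<pi> \<in> {\<pi>. labelling S ?n D \<pi>}"
      then have l: "labelling S ?n D \<pi>" by simp
      have "\<pi> (c, t) = (succ_on D c ^^ t) (\<pi> (c, 0))" if "c \<in> S" "t < ?n c" for c t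
        using that(2)
      proof (induction t)
        case (Suc t)
        have "(c, t) \<in> ?R" using Suc that by (simp add: darts_def)
        then have "\<pi> (next_dart ?n (c, t)) = succ_on D c (\<pi> (c, t))"
          using l by (auto simp: labelling_def)
        then show ?case using Suc by (simp add: next_dart_def)
      qed simp
      note iter = this
      show "lab (\<lambda>c\<in>S. \<pi> (c, 0)) = \<pi>"
      proof (rule extensionalityI[of _ ?R])
        fix r assume r: "r \<in> ?R"
        then have m: "fst r \<in> S" "snd r < ?n (fst r)" by (auto simp: darts_def)
        show "lab (\<lambda>c\<in>S. \<pi> (c, 0)) r = \<pi> r"
          using iter[OF m] r m(1) by (simp add: lab_def)
      qed (use l in \<open>auto simp: lab_def labelling_def\<close>)
    qed
    show "\<forall>s\<in>PiE S (points_on D). (\<lambda>c\<in>S. lab s (c, 0)) = s"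
    proof
      fix s assume s: "s \<in> PiE S (points_on D)"
      show "(\<lambda>c\<in>S. lab s (c, 0)) = s"
      proof (rule extensionalityI[of _ S])
        fix c assume c: "c \<in> S"
        then have "(c, 0) \<in> ?R" using n(2) by (simp add: darts_def)
        then show "(\<lambda>c\<in>S. lab s (c, 0)) c = s c" using c by (simp add: lab_def)
      qed (use s in \<open>auto simp: PiE_def\<close>)
    qed
    show "(\<lambda>\<pi>. \<lambda>c\<in>S. \<pi> (c, 0)) ` {\<pi>. labelling S ?n D \<pi>} \<subseteq> PiE S (points_on D)"
    proof (rule image_subsetI)
      fix \<pi> assume "\<pi> \<in> {\<pi>. labelling S ?n D \<pi>}"
      then have l: "labelling S ?n D \<pi>" by simp
      have "\<pi> (c, 0) \<in> points_on D c" if "c \<in> S" for c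
      proof -
        have "(c, 0) \<in> ?R" using that n by (simp add: darts_def)
        then have "(\<pi> (c, 0), fst (c, 0::nat)) \<in> arcs D" using l by (force simp: labelling_def bij_betw_def)
        then show ?thesis by (simp add: arcs_def points_on_def)
      qed
      then show "(\<lambda>c\<in>S. \<pi> (c, 0)) \<in> PiE S (points_on D)" by auto
    qed
    show "lab ` PiE S (points_on D) \<subseteq> {\<pi>. labelling S ?n D \<pi>}" using lab by auto
  qed
qed

lemma card_labellings:
  assumes "finite S" "D \<in> admissible S"
  shows "finite {\<pi>. labelling S (num_points S D) D \<pi>}"
    "card {\<pi>. labelling S (num_points S D) D \<pi>} = (\<Prod>c\<in>S. num_points S D c)"
proof -
  have fin: "finite (PiE S (points_on D))"
    using assms finite_points_on by (intro finite_PiE) auto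
  show "finite {\<pi>. labelling S (num_points S D) D \<pi>}"
    using bij_betw_finite[OF bij_betw_labellings[OF assms(2)]] fin by simp
  show "card {\<pi>. labelling S (num_points S D) D \<pi>} = (\<Prod>c\<in>S. num_points S D c)"
    using bij_betw_same_card[OF bij_betw_labellings[OF assms(2)]] card_PiE[OF assms(1), of "points_on D"]
    by (simp add: num_points_def)
qed

lemma labelling_arc:
  assumes "labelling S n D \<pi>" "r \<in> darts S n"
  shows "\<pi> r \<in> points D" "fst r \<in> circles_at D (\<pi> r)"
proof -
  have "(\<pi> r, fst r) \<in> arcs D" using assms by (force simp: labelling_def bij_betw_def)
  then show "\<pi> r \<in> points D" "fst r \<in> circles_at D (\<pi> r)" by (auto simp: arcs_def)
qed

lemma labelling_inj:
  assumes "labelling S n D \<pi>" "r \<in> darts S n" "r' \<in> darts S n" "\<pi> r = \<pi> r'" "fst r = fst r'"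
  shows "r = r'"
  using assms unfolding labelling_def bij_betw_def inj_on_def by blast

lemma labelling_surj:
  assumes "labelling S n D \<pi>" "p \<in> points D" "c \<in> circles_at D p"
  obtains r where "r \<in> darts S n" "\<pi> r = p" "fst r = c"
proof -
  have "(p, c) \<in> (\<lambda>r. (\<pi> r, fst r)) ` darts S n" using assms by (auto simp: labelling_def bij_betw_def arcs_def)
  then show ?thesis using that by auto
qed

lemma circles_at_nonempty: "D \<in> admissible S \<Longrightarrow> p \<in> points D \<Longrightarrow> circles_at D p \<noteq> {}"
  using admissibleD(3) by fastforce

text \<open>Exactly two circles meet at a gluing point, and each has exactly one dart there.\<close>

lemma labelling_partner:
  assumes "D \<in> admissible S" "labelling S n D \<pi>" "r \<in> darts S n"
  shows "\<exists>!r'. r' \<in> darts S n \<and> r' \<noteq> r \<and> \<pi> r' = \<pi> r"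
proof -
  have p: "\<pi> r \<in> points D" "fst r \<in> circles_at D (\<pi> r)" using labelling_arc[OF assms(2,3)] .
  obtain c' where c': "circles_at D (\<pi> r) = {fst r, c'}" "c' \<noteq> fst r"
    using admissibleD(3)[OF assms(1) p(1)] p(2) unfolding card_2_iff by (metis doubleton_eq_iff insertE singletonD)
  obtain r' where r': "r' \<in> darts S n" "\<pi> r' = \<pi> r" "fst r' = c'"
    using labelling_surj[OF assms(2) p(1), of c'] c' by blast
  show ?thesis
  proof (rule ex1I[of _ r'])
    show "r' \<in> darts S n \<and> r' \<noteq> r \<and> \<pi> r' = \<pi> r" using r' c' by auto
    fix q assume q: "q \<in> darts S n \<and> q \<noteq> r \<and> \<pi> q = \<pi> r"
    then have "fst q \<in> {fst r, c'}" using labelling_arc(2)[OF assms(2), of q] c' by auto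
    moreover have "fst q \<noteq> fst r" using labelling_inj[OF assms(2), of q r] q assms(3) by auto
    ultimately show "q = r'" using labelling_inj[OF assms(2), of q r'] q r' by auto
  qed
qed

lemma compatible_eq_iff:
  assumes "D \<in> admissible S" "labelling S n D \<pi>" "compatible S n \<pi> \<sigma>" "r \<in> darts S n" "r' \<in> darts S n"
  shows "\<pi> r' = \<pi> r \<longleftrightarrow> r' = r \<or> r' = \<sigma> r"
proof -
  have "\<sigma> r \<in> darts S n" "\<sigma> r \<noteq> r" "\<pi> (\<sigma> r) = \<pi> r"
    using assms(3,4) pairingsD[of \<sigma> "darts S n" r] by (auto simp: compatible_def)
  then show ?thesis using labelling_partner[OF assms(1,2,4)] assms(5) by metis
qed

lemma ex1_compatible:
  assumes "D \<in> admissible S" "labelling S n D \<pi>"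
  shows "\<exists>!\<sigma>. compatible S n \<pi> \<sigma>"
proof -
  let ?Q = "\<lambda>r r'. r' \<in> darts S n \<and> r' \<noteq> r \<and> \<pi> r' = \<pi> r"
  define \<sigma> where "\<sigma> r = (if r \<in> darts S n then THE r'. ?Q r r' else r)" for r
  have Q: "?Q r (\<sigma> r)" if "r \<in> darts S n" for r
    using theI'[OF labelling_partner[OF assms that]] that by (simp add: \<sigma>_def)
  have "\<sigma> (\<sigma> r) = r" if "r \<in> darts S n" for r
    using labelling_partner[OF assms, of "\<sigma> r"] Q[OF that] Q[of "\<sigma> r"] that by metis
  then have "compatible S n \<pi> \<sigma>"
    unfolding compatible_def using Q by (auto intro!: pairingsI simp: \<sigma>_def[of "_ :: _ \<times> _"])
  moreover have "\<tau> = \<sigma>" if "compatible S n \<pi> \<tau>" for \<tau>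
  proof
    fix r show "\<tau> r = \<sigma> r"
    proof (cases "r \<in> darts S n")
      case True
      have "?Q r (\<tau> r)" using that True pairingsD[of \<tau> "darts S n" r] by (auto simp: compatible_def)
      then show ?thesis using labelling_partner[OF assms True] Q[OF True] by metis
    next
      case False
      then show ?thesis using that pairingsD(3)[of \<tau> "darts S n" r] by (auto simp: compatible_def \<sigma>_def)
    qed
  qed
  ultimately show ?thesis by blast
qed

lemma compatible_colors:
  assumes "D \<in> admissible S" "labelling S n D \<pi>" "compatible S n \<pi> \<sigma>" "r \<in> darts S n"
  shows "fst (fst r) \<noteq> fst (fst (\<sigma> r))" "circles_at D (\<pi> r) = {fst r, fst (\<sigma> r)}"
proof -
  have s: "\<sigma> r \<in> darts S n" "\<sigma> r \<noteq> r" "\<pi> (\<sigma> r) = \<pi> r"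
    using assms(3,4) pairingsD[of \<sigma> "darts S n" r] by (auto simp: compatible_def)
  have ne: "fst r \<noteq> fst (\<sigma> r)" using labelling_inj[OF assms(2,4) s(1)] s by auto
  have c: "fst r \<in> circles_at D (\<pi> r)" "fst (\<sigma> r) \<in> circles_at D (\<pi> r)"
    using labelling_arc(2)[OF assms(2)] assms(4) s by metis+
  have p: "\<pi> r \<in> points D" using labelling_arc(1)[OF assms(2,4)] .
  show "fst (fst r) \<noteq> fst (fst (\<sigma> r))"
    using admissibleD(4)[OF assms(1) p] c ne by (auto simp: inj_on_def)
  show "circles_at D (\<pi> r) = {fst r, fst (\<sigma> r)}"
  proof (rule card_subset_eq[symmetric])
    show "finite (circles_at D (\<pi> r))"
      using admissibleD(3)[OF assms(1) p] by (intro card_ge_0_finite) simp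
    show "{fst r, fst (\<sigma> r)} \<subseteq> circles_at D (\<pi> r)" using c by blast
    show "card {fst r, fst (\<sigma> r)} = card (circles_at D (\<pi> r))"
      using admissibleD(3)[OF assms(1) p] ne by (simp del: prod.collapse)
  qed
qed

lemma gluing_iso_arcs:
  assumes "gluing_iso f D D'"
  shows "bij_betw (\<lambda>(p, c). (f p, c)) (arcs D) (arcs D')"
proof -
  have f: "bij_betw f (points D) (points D')" "\<And>p. p \<in> points D \<Longrightarrow> circles_at D' (f p) = circles_at D p"
    using assms by (auto simp: gluing_iso_def)
  have i: "inj_on f (points D)" "points D' = f ` points D" using f(1) by (auto simp: bij_betw_def)
  show ?thesis
  proof (rule bij_betw_imageI)
    show "inj_on (\<lambda>(p, c). (f p, c)) (arcs D)" using i(1) by (auto simp: inj_on_def arcs_def)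
    show "(\<lambda>(p, c). (f p, c)) ` arcs D = arcs D'"
      using f(2) unfolding arcs_def i(2) by force
  qed
qed

lemma labelling_iso:
  assumes "labelling S n D \<pi>" "gluing_iso f D D'"
  shows "labelling S n D' (restrict (\<lambda>r. f (\<pi> r)) (darts S n))"
proof -
  have "bij_betw ((\<lambda>(p, c). (f p, c)) \<circ> (\<lambda>r. (\<pi> r, fst r))) (darts S n) (arcs D')"
    using assms(1) gluing_iso_arcs[OF assms(2)] by (auto simp: labelling_def intro: bij_betw_trans)
  then have "bij_betw (\<lambda>r. (restrict (\<lambda>r. f (\<pi> r)) (darts S n) r, fst r)) (darts S n) (arcs D')"
    by (rule bij_betw_cong[THEN iffD1, rotated]) auto
  moreover have "f (\<pi> (next_dart n r)) = succ_on D' (fst r) (f (\<pi> r))" if "r \<in> darts S n" for r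
    using assms that labelling_arc[OF assms(1) that] by (simp add: labelling_def gluing_iso_def)
  ultimately show ?thesis by (simp add: labelling_def next_dart_in)
qed

lemma compatible_iso:
  assumes "compatible S n \<pi> \<sigma>"
  shows "compatible S n (restrict (\<lambda>r. f (\<pi> r)) (darts S n)) \<sigma>"
  using assms pairingsD(1)[of \<sigma> "darts S n"] by (auto simp: compatible_def)

text \<open>The pairing tells which darts share a gluing point, so two labellings with the same
  pairing differ by a renaming f of the points. It respects the successors because both labellings
  translate \<open>next_dart\<close> into them. Thus a pairing determines its gluing up to
  isomorphism; for a single gluing the renaming is an automorphism.\<close>

lemma iso_of_labellings:
  assumes D: "D \<in> admissible S" "labelling S n D \<pi>" "compatible S n \<pi> \<sigma>"
    and D': "D' \<in> admissible S" "labelling S n D' \<pi>'" "compatible S n \<pi>' \<sigma>"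
  shows "\<exists>f\<in>extensional (points D). gluing_iso f D D' \<and> (\<forall>r\<in>darts S n. \<pi>' r = f (\<pi> r))"
proof -
  let ?R = "darts S n"
  define f where "f = restrict (\<lambda>p. \<pi>' (SOME r. r \<in> ?R \<and> \<pi> r = p)) (points D)"
  have eq: "\<pi> r' = \<pi> r \<longleftrightarrow> \<pi>' r' = \<pi>' r" if "r \<in> ?R" "r' \<in> ?R" for r r'
    using compatible_eq_iff[OF D that] compatible_eq_iff[OF D' that] by simp
  have f: "f (\<pi> r) = \<pi>' r" if r: "r \<in> ?R" for r
  proof -
    have "(SOME q. q \<in> ?R \<and> \<pi> q = \<pi> r) \<in> ?R \<and> \<pi> (SOME q. q \<in> ?R \<and> \<pi> q = \<pi> r) = \<pi> r"
      by (rule someI[of _ r]) (use r in auto)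
    then have "\<pi>' (SOME q. q \<in> ?R \<and> \<pi> q = \<pi> r) = \<pi>' r" using eq[OF r] by blast
    then show ?thesis using labelling_arc(1)[OF D(2) r] by (simp add: f_def)
  qed
  have sur: "\<exists>r\<in>?R. \<pi> r = p" if "p \<in> points D" for p
    using circles_at_nonempty[OF D(1) that] labelling_surj[OF D(2) that] by blast
  have sur': "\<exists>r\<in>?R. \<pi>' r = p" if "p \<in> points D'" for p
    using circles_at_nonempty[OF D'(1) that] labelling_surj[OF D'(2) that] by blast
  have "bij_betw f (points D) (points D')"
  proof (rule bij_betw_imageI)
    show "inj_on f (points D)"
      by (rule inj_onI) (metis sur f eq)
    show "f ` points D = points D'"
    proof
      show "f ` points D \<subseteq> points D'" using sur f labelling_arc(1)[OF D'(2)] by (metis image_subsetI)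
      show "points D' \<subseteq> f ` points D" using sur' f labelling_arc(1)[OF D(2)] by (metis image_eqI subsetI)
    qed
  qed
  moreover have "circles_at D' (f p) = circles_at D p \<and>
        (\<forall>c\<in>circles_at D p. succ_on D' c (f p) = f (succ_on D c p))" if p: "p \<in> points D" for p
  proof (intro conjI ballI)
    obtain r where r: "r \<in> ?R" "\<pi> r = p" using sur[OF p] by blast
    show "circles_at D' (f p) = circles_at D p"
      using compatible_colors(2)[OF D r(1)] compatible_colors(2)[OF D' r(1)] f r by metis
    fix c assume "c \<in> circles_at D p"
    then obtain q where q: "q \<in> ?R" "\<pi> q = p" "fst q = c" using labelling_surj[OF D(2) p] by blast
    have "succ_on D' c (f p) = \<pi>' (next_dart n q)"
      using D'(2) q f[OF q(1)] by (auto simp: labelling_def)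
    also have "\<dots> = f (\<pi> (next_dart n q))" using f[OF next_dart_in[OF q(1)]] by simp
    also have "\<dots> = f (succ_on D c p)" using D(2) q by (auto simp: labelling_def)
    finally show "succ_on D' c (f p) = f (succ_on D c p)" .
  qed
  ultimately have "gluing_iso f D D'" by (simp add: gluing_iso_def)
  then show ?thesis using f by (intro bexI[of _ f]) (auto simp: f_def)
qed

definition pairings_of :: "'k circle set \<Rightarrow> 'k gluing \<Rightarrow> ('k circle \<times> nat \<Rightarrow> 'k circle \<times> nat) set" where
  "pairings_of S D = {\<sigma>. \<exists>\<pi>. labelling S (num_points S D) D \<pi> \<and> compatible S (num_points S D) \<pi> \<sigma>}"

text \<open>The automorphism group acts freely on the labellings, and its orbits are the sets of
  labellings that induce the same pairing.\<close>

lemma card_pairings_of: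
  assumes "finite S" "D \<in> admissible S"
  shows "card (pairings_of S D) * card (automorphisms D) = (\<Prod>c\<in>S. num_points S D c)"
proof -
  let ?n = "num_points S D" and ?R = "darts S (num_points S D)"
  let ?Lab = "{\<pi>. labelling S ?n D \<pi>}"
  define sg where "sg \<pi> = (THE \<sigma>. compatible S ?n \<pi> \<sigma>)" for \<pi>
  have sg: "compatible S ?n \<pi> \<sigma> \<longleftrightarrow> \<sigma> = sg \<pi>" if "\<pi> \<in> ?Lab" for \<pi> \<sigma>
    using ex1_compatible[OF assms(2), of ?n \<pi>] that theI'[of "compatible S ?n \<pi>"] unfolding sg_def by auto
  have P: "pairings_of S D = sg ` ?Lab" unfolding pairings_of_def using sg by auto
  have fib: "card {\<pi>\<in>?Lab. sg \<pi> = \<sigma>} = card (automorphisms D)" if s: "\<sigma> \<in> sg ` ?Lab" for \<sigma>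
  proof -
    obtain \<pi>0 where p0: "labelling S ?n D \<pi>0" "compatible S ?n \<pi>0 \<sigma>" using s sg by auto
    let ?mv = "\<lambda>f. restrict (\<lambda>r. f (\<pi>0 r)) ?R"
    have sur: "\<exists>r\<in>?R. \<pi>0 r = p" if "p \<in> points D" for p
      using circles_at_nonempty[OF assms(2) that] labelling_surj[OF p0(1) that] by blast
    have "bij_betw ?mv (automorphisms D) {\<pi>\<in>?Lab. sg \<pi> = \<sigma>}"
    proof (rule bij_betw_imageI)
      show "inj_on ?mv (automorphisms D)"
      proof (rule inj_onI)
        fix f g assume fg: "f \<in> automorphisms D" "g \<in> automorphisms D"
          and eq: "?mv f = ?mv g"
        show "f = g"
        proof (rule extensionalityI[of _ "points D"])
          fix p assume "p \<in> points D"
          then obtain r where r: "r \<in> ?R" "\<pi>0 r = p" using sur by blast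
          then show "f p = g p" using fun_cong[OF eq, of r] by simp
        qed (use fg in \<open>auto simp: automorphisms_def\<close>)
      qed
      show "?mv ` automorphisms D = {\<pi>\<in>?Lab. sg \<pi> = \<sigma>}"
      proof
        show "?mv ` automorphisms D \<subseteq> {\<pi>\<in>?Lab. sg \<pi> = \<sigma>}"
        proof (rule image_subsetI)
          fix f assume "f \<in> automorphisms D"
          then have "gluing_iso f D D" by (simp add: automorphisms_def)
          then have l: "labelling S ?n D (?mv f)" by (rule labelling_iso[OF p0(1)])
          then show "?mv f \<in> {\<pi>\<in>?Lab. sg \<pi> = \<sigma>}"
            using sg[of "?mv f" \<sigma>] compatible_iso[OF p0(2), of f] by simp
        qed
        show "{\<pi>\<in>?Lab. sg \<pi> = \<sigma>} \<subseteq> ?mv ` automorphisms D"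
        proof (rule subsetI)
          fix \<pi> assume "\<pi> \<in> {\<pi>\<in>?Lab. sg \<pi> = \<sigma>}"
          then have p: "labelling S ?n D \<pi>" "\<sigma> = sg \<pi>" by auto
          then have c: "compatible S ?n \<pi> \<sigma>" using sg by auto
          obtain f where f: "f \<in> extensional (points D)" "gluing_iso f D D" "\<And>r. r \<in> ?R \<Longrightarrow> \<pi> r = f (\<pi>0 r)"
            using iso_of_labellings[OF assms(2) p0 assms(2) p(1) c] by blast
          have "\<pi> = ?mv f"
            using f(3) p(1) by (auto simp: labelling_def extensional_def restrict_def fun_eq_iff)
          then show "\<pi> \<in> ?mv ` automorphisms D"
            using f(1,2) by (auto simp: automorphisms_def)
        qed
      qed
    qed
    then show ?thesis by (simp add: bij_betw_same_card)
  qed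
  have "card ?Lab = (\<Sum>\<sigma>\<in>sg ` ?Lab. card {\<pi>\<in>?Lab. sg \<pi> = \<sigma>})"
    using sum.image_gen[OF card_labellings(1)[OF assms], of "\<lambda>_. 1::nat" sg] by simp
  also have "\<dots> = card (sg ` ?Lab) * card (automorphisms D)" using fib by simp
  finally show ?thesis using card_labellings(2)[OF assms] P by simp
qed

text \<open>The gluing is the quotient of the darts by \<sigma>. The color condition ensures that
  the two circles at a point are distinct and of different colors, and positivity of n that no
  circle is isolated.\<close>

lemma gluing_of_pairing:
  assumes S: "finite S" and n: "n \<in> S \<rightarrow>\<^sub>E {1..}" and s: "\<sigma> \<in> pairings (darts S n)"
    and col: "\<And>r. r \<in> darts S n \<Longrightarrow> fst (fst r) \<noteq> fst (fst (\<sigma> r))"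
  shows "\<exists>D\<in>admissible S. \<exists>\<pi>. labelling S n D \<pi> \<and> compatible S n \<pi> \<sigma>"
proof -
  let ?R = "darts S n"
  note P = pairingsD[OF s]
  obtain enc :: "'a circle \<times> nat \<Rightarrow> nat" where enc: "inj_on enc ?R"
    using finite_imp_inj_to_nat_seg[OF finite_darts[OF S]] by blast
  \<comment> \<open>Gluing points have to be natural numbers, so the class {r, \<sigma> r} is named
    by the smaller of the two codes.\<close>
  define pt where "pt r = min (enc r) (enc (\<sigma> r))" for r
  have pt: "pt r' = pt r \<longleftrightarrow> r' = r \<or> r' = \<sigma> r" if "r \<in> ?R" "r' \<in> ?R" for r r'
  proof
    have i: "enc a = enc b \<Longrightarrow> a = b" if "a \<in> ?R" "b \<in> ?R" for a b using enc that by (auto simp: inj_on_def)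
    assume "pt r' = pt r"
    then have "enc r' = enc r \<or> enc r' = enc (\<sigma> r) \<or> enc (\<sigma> r') = enc r \<or> enc (\<sigma> r') = enc (\<sigma> r)"
      unfolding pt_def by (metis min_def)
    then show "r' = r \<or> r' = \<sigma> r" using that P i by metis
  next
    assume "r' = r \<or> r' = \<sigma> r"
    then show "pt r' = pt r" using P(2)[OF that(1)] by (auto simp: pt_def min.commute)
  qed
  have fne: "fst (\<sigma> r) \<noteq> fst r" if "r \<in> ?R" for r using col[OF that] by metis
  \<comment> \<open>Partners lie on different circles, so a circle passes through a point only once;
    this makes the definite description in \<open>succ_on\<close> below well defined.\<close>
  have inj: "r = r'" if "r \<in> ?R" "r' \<in> ?R" "pt r = pt r'" "fst r = fst r'" for r r'
    using pt[OF that(2,1)] that fne by metis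
  define D where "D = \<lparr>points = pt ` ?R, circles_at = (\<lambda>p. fst ` {r \<in> ?R. pt r = p}),
     succ_on = (\<lambda>c p. pt (next_dart n (THE r. r \<in> ?R \<and> fst r = c \<and> pt r = p)))\<rparr>"
  have succ: "succ_on D (fst r) (pt r) = pt (next_dart n r)" if "r \<in> ?R" for r
  proof -
    have "(THE q. q \<in> ?R \<and> fst q = fst r \<and> pt q = pt r) = r"
      by (rule the_equality) (use that inj in auto)
    then show ?thesis by (simp add: D_def)
  qed
  have ca: "circles_at D (pt r) = {fst r, fst (\<sigma> r)}" if "r \<in> ?R" for r
  proof -
    have "{q \<in> ?R. pt q = pt r} = {r, \<sigma> r}" using pt[OF that] P(1)[OF that] that by blast
    then show ?thesis by (simp add: D_def)
  qed
  have po: "points_on D c = pt ` ({c} \<times> {..<n c})" if c: "c \<in> S" for c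
  proof
    show "points_on D c \<subseteq> pt ` ({c} \<times> {..<n c})"
    proof
      fix p assume "p \<in> points_on D c"
      then obtain r where "r \<in> ?R" "pt r = p" "fst r = c" by (auto simp: points_on_def D_def)
      then show "p \<in> pt ` ({c} \<times> {..<n c})" by (intro image_eqI[of _ _ r]) (auto simp: darts_def)
    qed
    show "pt ` ({c} \<times> {..<n c}) \<subseteq> points_on D c"
    proof (rule image_subsetI)
      fix r assume "r \<in> {c} \<times> {..<n c}"
      then have "r \<in> ?R" "fst r = c" using c by (auto simp: darts_def)
      then show "pt r \<in> points_on D c" by (auto simp: points_on_def D_def)
    qed
  qed
  have n1: "n c > 0" if "c \<in> S" for c using PiE_mem[OF n that] by simp
  have "D \<in> admissible S"
    unfolding admissible_def constellation_def no_triple_points_def isolated_def mem_Collect_eq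
  proof (intro conjI ballI impI)
    show "finite (points D)" using finite_darts[OF S] by (simp add: D_def)
    fix p assume "p \<in> points D"
    then obtain r where r: "r \<in> ?R" "p = pt r" by (auto simp: D_def)
    show "circles_at D p \<subseteq> S" using ca[OF r(1)] r P(1)[OF r(1)] by (auto simp: darts_def)
    show "2 \<le> card (circles_at D p)" "card (circles_at D p) < 3"
      unfolding r(2) ca[OF r(1)] using fne[OF r(1)] by auto
    show "inj_on fst (circles_at D p)"
      unfolding r(2) ca[OF r(1)] using col[OF r(1)] by auto
  next
    fix c assume c: "c \<in> S"
    show "cyclic_on (succ_on D c) (points_on D c)"
      unfolding po[OF c]
    proof (rule cyclic_on_image[OF cyclic_on_next_dart[of n c, OF n1[OF c]]])
      fix r assume "r \<in> {c} \<times> {..<n c}"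
      then have "r \<in> ?R" "fst r = c" using c by (auto simp: darts_def)
      then show "succ_on D c (pt r) = pt (next_dart n r)" using succ by blast
    qed
    show "points_on D c \<noteq> {}" using po[OF c] n1[OF c] by auto
  qed
  moreover have "labelling S n D (restrict pt ?R)"
    unfolding labelling_def
  proof (intro conjI ballI)
    show "bij_betw (\<lambda>r. (restrict pt ?R r, fst r)) ?R (arcs D)"
    proof (rule bij_betw_imageI)
      show "inj_on (\<lambda>r. (restrict pt ?R r, fst r)) ?R"
        by (rule inj_onI) (use inj in auto)
      show "(\<lambda>r. (restrict pt ?R r, fst r)) ` ?R = arcs D"
      proof (rule set_eqI)
        fix x :: "nat \<times> 'a circle"
        obtain p c where x: "x = (p, c)" by (cases x)
        have "x \<in> arcs D \<longleftrightarrow> p \<in> pt ` ?R \<and> c \<in> fst ` {r \<in> ?R. pt r = p}"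
          by (simp add: x arcs_def D_def)
        also have "\<dots> \<longleftrightarrow> (\<exists>r\<in>?R. pt r = p \<and> fst r = c)" by blast
        also have "\<dots> \<longleftrightarrow> x \<in> (\<lambda>r. (restrict pt ?R r, fst r)) ` ?R"
          unfolding x image_iff by (metis Pair_inject restrict_apply')
        finally show "x \<in> (\<lambda>r. (restrict pt ?R r, fst r)) ` ?R \<longleftrightarrow> x \<in> arcs D" by simp
      qed
    qed
    fix r assume "r \<in> ?R"
    then show "restrict pt ?R (next_dart n r) = succ_on D (fst r) (restrict pt ?R r)"
      using succ next_dart_in by (metis restrict_apply')
  qed auto
  moreover have "compatible S n (restrict pt ?R) \<sigma>"
    unfolding compatible_def
  proof (intro conjI ballI s)
    fix r assume r: "r \<in> ?R"
    then show "restrict pt ?R (\<sigma> r) = restrict pt ?R r" using pt[OF r P(1)[OF r]] P(1)[OF r] by simp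
  qed
  ultimately show ?thesis by blast
qed

text \<open>With two circles at a point, the direct and the wrapping branch of
  \<open>next_color\<close> both lead to the other circle. So the order of the colors leaves no
  trace at double points.\<close>

lemma next_color_pair:
  assumes "circles_at D p = {c, c'}" "fst c \<noteq> fst c'"
  shows "next_color D p c = c'"
proof (cases "fst c < fst c'")
  case True
  then have "{b \<in> {c, c'}. fst c < fst b} = {c'}" by auto
  then show ?thesis unfolding next_color_def assms(1) Let_def
    using arg_min_if_finite(1)[of "{c'}" fst] by auto
next
  case False
  with assms(2) have lt: "fst c' < fst c" by simp
  then have "{b \<in> {c, c'}. fst c < fst b} = {}" by auto
  then have "next_color D p c = arg_min_on fst {c, c'}" unfolding next_color_def assms(1) Let_def by simp
  moreover have "arg_min_on fst {c, c'} \<in> {c, c'}" "\<not> (\<exists>x\<in>{c, c'}. fst x < fst (arg_min_on fst {c, c'}))"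
    using arg_min_if_finite[of "{c, c'}" fst] by auto
  ultimately show ?thesis using lt by auto
qed

lemma bij_betw_pairing: "\<sigma> \<in> pairings R \<Longrightarrow> bij_betw \<sigma> R R"
  by (auto simp: pairings_def permutes_imp_bij)

text \<open>Darts correspond to arcs and pairs of darts to points, so V - E is minus half the number
  of darts. A step of \<open>face_step\<close> goes to the end of an arc and changes to the other
  circle there; on darts this is \<open>next_dart\<close> followed by \<sigma>.\<close>

lemma euler_char_labelling:
  assumes S: "finite S" and D: "D \<in> admissible S" "labelling S n D \<pi>" "compatible S n \<pi> \<sigma>"
  shows "euler_char S D = int (card S) - int (card (darts S n) div 2)
      + int (card (orbit (\<sigma> \<circ> next_dart n) ` darts S n))"
proof -
  let ?R = "darts S n"
  have ca: "card (arcs D) = card ?R"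
    using D(2) by (auto simp: labelling_def dest: bij_betw_same_card)
  have "card (arcs D) = (\<Sum>p\<in>points D. card (circles_at D p))"
    unfolding arcs_Sigma using admissibleD(1,2)[OF D(1)] S by (intro card_SigmaI) (auto intro: finite_subset)
  also have "\<dots> = 2 * card (points D)" using admissibleD(3)[OF D(1)] by simp
  finally have cp: "card ?R = 2 * card (points D)" using ca by simp
  have iso: "{c \<in> S. isolated D c} = {}" using D(1) by (auto simp: admissible_def)
  have "card (orbit (face_step D) ` arcs D) = card (orbit (\<sigma> \<circ> next_dart n) ` ?R)"
  proof (rule card_orbits_transport)
    show "finite ?R" using S by (rule finite_darts)
    show "bij_betw (\<sigma> \<circ> next_dart n) ?R ?R"
      using D(3) by (intro bij_betw_trans[OF bij_betw_next_dart]) (auto simp: compatible_def bij_betw_pairing)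
    show "bij_betw (\<lambda>r. (\<pi> r, fst r)) ?R (arcs D)" using D(2) by (simp add: labelling_def)
    fix r assume r: "r \<in> ?R"
    let ?q = "next_dart n r"
    have q: "?q \<in> ?R" "fst ?q = fst r" using next_dart_in[OF r] by auto
    have "next_color D (\<pi> ?q) (fst r) = fst (\<sigma> ?q)"
      using compatible_colors[OF D q(1)] q(2) by (intro next_color_pair) auto
    moreover have "\<pi> ?q = succ_on D (fst r) (\<pi> r)" using D(2) r by (auto simp: labelling_def)
    moreover have "\<pi> (\<sigma> ?q) = \<pi> ?q" using D(3) q(1) by (auto simp: compatible_def)
    ultimately show "(\<pi> ((\<sigma> \<circ> next_dart n) r), fst ((\<sigma> \<circ> next_dart n) r)) = face_step D (\<pi> r, fst r)"
      by (simp add: face_step_def)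
  qed
  then show ?thesis unfolding euler_char_def iso ca cp by simp
qed

section \<open>Volumes\<close>

text \<open>The exceptional set is the graph of a function of the other coordinates: every line in
  direction i meets it in at most one point, so it is null by Fubini.\<close>

lemma AE_PiM_neq:
  fixes h :: "('i \<Rightarrow> real) \<Rightarrow> real"
  assumes I: "finite I" "i \<in> I" and h [measurable]: "h \<in> borel_measurable (PiM I (\<lambda>_. lborel))"
    and inv: "\<And>y s. h (y(i := s)) = h y"
  shows "AE y in PiM I (\<lambda>_. lborel). y i \<noteq> h y"
proof -
  interpret product_sigma_finite "\<lambda>_. lborel :: real measure" by standard
  let ?M = "PiM I (\<lambda>_. lborel :: real measure)" and ?J = "I - {i}"
  let ?X = "{y \<in> space ?M. y i = h y}"
  have IJ: "insert i ?J = I" using I by auto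
  have [measurable]: "(\<lambda>y. y i) \<in> borel_measurable ?M"
    using measurable_component_singleton[OF I(2), of "\<lambda>_. lborel :: real measure"] by simp
  have sets: "?X \<in> sets ?M" by measurable
  have "emeasure ?M ?X = (\<integral>\<^sup>+y. indicator ?X y \<partial>?M)"
    using sets by simp
  also have "\<dots> = (\<integral>\<^sup>+x. \<integral>\<^sup>+s. indicator ?X (x(i := s)) \<partial>lborel \<partial>PiM ?J (\<lambda>_. lborel))"
    using product_nn_integral_insert[of ?J i "indicator ?X"] I sets unfolding IJ by simp
  also have "\<dots> \<le> (\<integral>\<^sup>+x. \<integral>\<^sup>+s. indicator {h x} s \<partial>lborel \<partial>PiM ?J (\<lambda>_. lborel))"
    by (intro nn_integral_mono) (auto simp: indicator_def inv)
  also have "\<dots> = 0" by simp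
  finally have "emeasure ?M ?X = 0" by simp
  then show ?thesis by (intro AE_I[of _ _ "?X"]) (use sets in auto)
qed

text \<open>One block of coordinates, hence one simplex of volume t^d / d!, per circle. The
  induction splits off a block by Fubini; measurability is proved along with the volume because
  Fubini needs it for the smaller product.\<close>

lemma emeasure_product_of_simplices:
  fixes J :: "'c \<Rightarrow> 'i set" and t :: "'c \<Rightarrow> real"
  assumes "finite S" "\<And>c. c \<in> S \<Longrightarrow> finite (J c)" "\<And>c. c \<in> S \<Longrightarrow> t c \<ge> 0"
    "\<And>c c'. c \<in> S \<Longrightarrow> c' \<in> S \<Longrightarrow> c \<noteq> c' \<Longrightarrow> J c \<inter> J c' = {}"
  shows "{y \<in> space (PiM (\<Union>c\<in>S. J c) (\<lambda>_. lborel)). \<forall>c\<in>S. (\<forall>i\<in>J c. 0 \<le> y i) \<and> sum y (J c) \<le> t c}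
       \<in> sets (PiM (\<Union>c\<in>S. J c) (\<lambda>_. lborel)) \<and>
     emeasure (PiM (\<Union>c\<in>S. J c) (\<lambda>_. lborel))
      {y \<in> space (PiM (\<Union>c\<in>S. J c) (\<lambda>_. lborel)). \<forall>c\<in>S. (\<forall>i\<in>J c. 0 \<le> y i) \<and> sum y (J c) \<le> t c}
    = ennreal (\<Prod>c\<in>S. t c ^ card (J c) / fact (card (J c)))"
  using assms
proof (induction S rule: finite_induct)
  case empty
  then show ?case by (simp add: PiM_empty)
next
  case (insert c S)
  interpret product_sigma_finite "\<lambda>_. lborel :: real measure" by standard
  let ?U = "\<Union>c\<in>S. J c"
  let ?M = "\<lambda>I. PiM I (\<lambda>_. lborel :: real measure)"
  define X where "X = {y \<in> space (?M (J c)). (\<forall>i\<in>J c. 0 \<le> y i) \<and> sum y (J c) \<le> t c}"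
  define Y where "Y = {y \<in> space (?M ?U). \<forall>c\<in>S. (\<forall>i\<in>J c. 0 \<le> y i) \<and> sum y (J c) \<le> t c}"
  define Z where "Z = {y \<in> space (?M (J c \<union> ?U)). \<forall>c\<in>insert c S. (\<forall>i\<in>J c. 0 \<le> y i) \<and> sum y (J c) \<le> t c}"
  have fin: "finite (J c)" "finite ?U" using insert by auto
  have disj: "J c \<inter> ?U = {}" using insert.prems(3) insert.hyps(2) by blast
  have Y: "Y \<in> sets (?M ?U)" "emeasure (?M ?U) Y = ennreal (\<Prod>c\<in>S. t c ^ card (J c) / fact (card (J c)))"
    unfolding Y_def using insert.IH insert.prems by auto
  have comp [measurable]: "(\<lambda>y. y i) \<in> borel_measurable (?M I)" if "i \<in> I" for i I
    using measurable_component_singleton[OF that, of "\<lambda>_. lborel :: real measure"] by simp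
  have msum: "(\<lambda>y. sum y I) \<in> borel_measurable (?M I')" if "I \<subseteq> I'" for I I'
    using that by (intro borel_measurable_sum comp) auto
  have Xs: "X \<in> sets (?M (J c))"
  proof -
    have "X = space (?M (J c)) \<inter> PiE (J c) (\<lambda>_. {0..}) \<inter> {y \<in> space (?M (J c)). sum y (J c) \<le> t c}"
      by (auto simp: X_def space_PiM PiE_def)
    moreover have "PiE (J c) (\<lambda>_. {0..}) \<in> sets (?M (J c))" using fin by (intro sets_PiM_I_finite) auto
    moreover have "{y \<in> space (?M (J c)). sum y (J c) \<le> t c} \<in> sets (?M (J c))"
      using msum[of "J c" "J c"] by measurable
    ultimately show ?thesis by auto
  qed
  have Xe: "emeasure (?M (J c)) X = ennreal (t c ^ card (J c) / fact (card (J c)))"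
  proof -
    have "X = {x. (\<forall>i\<in>J c. 0 \<le> x i) \<and> sum x (J c) \<le> t c} \<inter> space (?M (J c))" by (auto simp: X_def)
    then show ?thesis using emeasure_std_simplex_aux[of "J c" "t c"] fin insert.prems(2)[of c]
      by (simp add: divide_ennreal ennreal_fact)
  qed
  have Zs: "Z \<in> sets (?M (J c \<union> ?U))"
  proof -
    have "{y \<in> space (?M (J c \<union> ?U)). (\<forall>i\<in>J a. 0 \<le> y i) \<and> sum y (J a) \<le> t a} \<in> sets (?M (J c \<union> ?U))"
      if a: "a \<in> insert c S" for a
    proof -
      have sub: "J a \<subseteq> J c \<union> ?U" using a by auto
      have "{y \<in> space (?M (J c \<union> ?U)). \<forall>i\<in>J a. 0 \<le> y i} \<in> sets (?M (J c \<union> ?U))"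
        using insert.prems(1)[OF a] sub by (intro sets.sets_Collect_finite_All) (auto intro!: borel_measurable_le comp)
      moreover have "{y \<in> space (?M (J c \<union> ?U)). sum y (J a) \<le> t a} \<in> sets (?M (J c \<union> ?U))"
        using msum[OF sub] by measurable
      ultimately show ?thesis by (simp add: sets.sets_Collect_conj)
    qed
    then show ?thesis unfolding Z_def using insert.hyps(1) by (intro sets.sets_Collect_finite_All) auto
  qed
  \<comment> \<open>The blocks are disjoint, so the conditions on a merged point decouple.\<close>
  have ind: "indicator Z (merge (J c) ?U (x, y)) = (indicator X x * indicator Y y :: ennreal)"
    if x: "x \<in> space (?M (J c))" and y: "y \<in> space (?M ?U)" for x y
  proof -
    let ?m = "merge (J c) ?U (x, y)"
    have m: "?m \<in> space (?M (J c \<union> ?U))"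
      using x y disj by (auto simp: space_PiM PiE_def extensional_def merge_def)
    have mx: "?m i = x i" if "i \<in> J c" for i using that by (simp add: merge_def)
    have my: "?m i = y i" if "i \<in> J a" "a \<in> S" for i a using that disj by (auto simp: merge_def)
    have "sum ?m (J c) = sum x (J c)" using mx by (intro sum.cong) auto
    moreover have "sum ?m (J a) = sum y (J a)" if "a \<in> S" for a using my that by (intro sum.cong) auto
    ultimately have "?m \<in> Z \<longleftrightarrow> x \<in> X \<and> y \<in> Y"
      using m x y mx my unfolding Z_def X_def Y_def by simp
    then show ?thesis by (simp add: indicator_def)
  qed
  have "emeasure (?M (J c \<union> ?U)) Z = (\<integral>\<^sup>+z. indicator Z z \<partial>?M (J c \<union> ?U))" using Zs by simp
  also have "\<dots> = (\<integral>\<^sup>+x. \<integral>\<^sup>+y. indicator Z (merge (J c) ?U (x, y)) \<partial>?M ?U \<partial>?M (J c))"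
    using Zs by (intro product_nn_integral_fold[OF disj fin]) auto
  also have "\<dots> = (\<integral>\<^sup>+x. \<integral>\<^sup>+y. indicator X x * indicator Y y \<partial>?M ?U \<partial>?M (J c))"
    by (intro nn_integral_cong) (simp add: ind)
  also have "\<dots> = emeasure (?M (J c)) X * emeasure (?M ?U) Y"
    using Xs Y(1) by (simp add: nn_integral_cmult nn_integral_multc)
  also have "\<dots> = ennreal (\<Prod>c\<in>insert c S. t c ^ card (J c) / fact (card (J c)))"
    unfolding Xe Y(2) using insert.hyps insert.prems(2)
    by (subst ennreal_mult [symmetric]) (auto intro!: prod_nonneg divide_nonneg_nonneg zero_le_power)
  finally show ?case using Zs unfolding Z_def by simp
qed

locale glued_circles =
  fixes S :: "'k circle set" and l :: "'k \<Rightarrow> nat \<Rightarrow> real" and D :: "'k gluing"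
  assumes S: "finite S" and l_pos: "\<And>i j. (i, j) \<in> S \<Longrightarrow> l i j > 0" and D: "D \<in> admissible S"
begin

abbreviation len :: "'k circle \<Rightarrow> real" where "len c \<equiv> l (fst c) (snd c)"
abbreviation P where "P \<equiv> points_on D"
definition free_points :: "'k circle \<Rightarrow> nat set" where "free_points c = P c - {Min (P c)}"

lemma finite_P: "finite (P c)" using D by (rule finite_points_on)
lemma P_nonempty: "c \<in> S \<Longrightarrow> P c \<noteq> {}" using D by (rule admissibleD(5))
lemma Min_in_P: "c \<in> S \<Longrightarrow> Min (P c) \<in> P c" using finite_P P_nonempty by simp
lemma finite_free_points: "finite (free_points c)" using finite_P by (simp add: free_points_def)

lemma arc_iff: "(p, c) \<in> arcs D \<longleftrightarrow> c \<in> S \<and> p \<in> P c"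
  using admissibleD(2)[OF D] by (auto simp: arcs_def points_on_def)

lemma coordinate_arc_iff: "(p, c) \<in> coordinate_arcs D \<longleftrightarrow> c \<in> S \<and> p \<in> free_points c"
  by (auto simp: coordinate_arcs_def arc_iff free_points_def)

lemma coordinate_arcs_Union: "coordinate_arcs D = (\<Union>c\<in>S. (\<lambda>p. (p, c)) ` free_points c)"
proof (rule set_eqI)
  fix x :: "nat \<times> 'k circle" obtain p c where "x = (p, c)" by (cases x)
  then show "x \<in> coordinate_arcs D \<longleftrightarrow> x \<in> (\<Union>c\<in>S. (\<lambda>p. (p, c)) ` free_points c)"
    using coordinate_arc_iff[of p c] by auto
qed

lemma finite_coordinate_arcs: "finite (coordinate_arcs D)"
  unfolding coordinate_arcs_Union using S finite_free_points by auto

lemma sum_P: "c \<in> S \<Longrightarrow> (\<Sum>p\<in>P c. x (p, c)) = x (Min (P c), c) + (\<Sum>p\<in>free_points c. x (p, c) :: real)"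
  unfolding free_points_def using finite_P Min_in_P by (intro sum.remove) auto

text \<open>The inverse of \<open>coordinates\<close>: the omitted arc receives what is left of the
  circumference.\<close>

definition full_length :: "(nat \<times> 'k circle \<Rightarrow> real) \<Rightarrow> nat \<times> 'k circle \<Rightarrow> real" where
  "full_length y a = (if fst a = Min (P (snd a)) then len (snd a) - (\<Sum>p\<in>free_points (snd a). y (p, snd a)) else y a)"

lemma arc_lengths_iff: "x \<in> arc_lengths S l D \<longleftrightarrow>
   x \<in> extensional (arcs D) \<and> (\<forall>c\<in>S. \<forall>p\<in>P c. 0 \<le> x (p, c)) \<and> (\<forall>c\<in>S. (\<Sum>p\<in>P c. x (p, c)) = len c)"
proof -
  have "(\<forall>a\<in>arcs D. 0 \<le> x a) \<longleftrightarrow> (\<forall>c\<in>S. \<forall>p\<in>P c. 0 \<le> x (p, c))"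
    using arc_iff by (metis surj_pair)
  moreover have "(\<forall>(i, j)\<in>S. (\<Sum>p\<in>P (i, j). x (p, (i, j))) = l i j) \<longleftrightarrow> (\<forall>c\<in>S. (\<Sum>p\<in>P c. x (p, c)) = len c)"
    by (intro ball_cong refl) (simp split: prod.split)
  moreover have "x \<in> arcs D \<rightarrow>\<^sub>E {0..} \<longleftrightarrow> x \<in> extensional (arcs D) \<and> (\<forall>a\<in>arcs D. 0 \<le> x a)"
    unfolding PiE_def Pi_def by blast
  ultimately show ?thesis unfolding arc_lengths_def mem_Collect_eq by blast
qed

lemma full_length_coordinates:
  assumes "x \<in> arc_lengths S l D"
  shows "restrict (full_length (coordinates D x)) (arcs D) = x"
proof (rule extensionalityI[of _ "arcs D"])
  show "x \<in> extensional (arcs D)" using assms arc_lengths_iff by blast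
  fix a assume a: "a \<in> arcs D"
  obtain p c where pc: "a = (p, c)" by (cases a)
  have c: "c \<in> S" "p \<in> P c" using a pc arc_iff by auto
  have co: "coordinates D x (q, c) = x (q, c)" if "q \<in> free_points c" for q
    using that c coordinate_arc_iff by (simp add: coordinates_def)
  show "restrict (full_length (coordinates D x)) (arcs D) a = x a"
  proof (cases "p = Min (P c)")
    case True
    then show ?thesis using a assms c(1) sum_P[OF c(1), of x]
      by (simp add: pc full_length_def co arc_lengths_iff)
  next
    case False
    then have "p \<in> free_points c" using c by (simp add: free_points_def)
    then show ?thesis using a False co by (simp add: pc full_length_def)
  qed
qed auto

text \<open>Phrased so that \<open>emeasure_product_of_simplices\<close> applies to it literally;
  \<open>domain_iff\<close> is the convenient description.\<close>

definition domain :: "(nat \<times> 'k circle \<Rightarrow> real) set" where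
  "domain = {y \<in> space (PiM (coordinate_arcs D) (\<lambda>_. lborel)).
     \<forall>c\<in>S. (\<forall>i\<in>(\<lambda>p. (p, c)) ` free_points c. 0 \<le> y i) \<and> sum y ((\<lambda>p. (p, c)) ` free_points c) \<le> len c}"

lemma domain_iff: "y \<in> domain \<longleftrightarrow> y \<in> extensional (coordinate_arcs D) \<and>
    (\<forall>c\<in>S. (\<forall>p\<in>free_points c. 0 \<le> y (p, c)) \<and> (\<Sum>p\<in>free_points c. y (p, c)) \<le> len c)"
proof -
  have "sum y ((\<lambda>p. (p, c)) ` free_points c) = (\<Sum>p\<in>free_points c. y (p, c))" for c
    by (subst sum.reindex) (auto simp: inj_on_def)
  then show ?thesis by (simp add: domain_def space_PiM PiE_def)
qed

lemma coordinates_full_length: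
  assumes "y \<in> domain"
  shows "restrict (full_length y) (arcs D) \<in> arc_lengths S l D"
    "coordinates D (restrict (full_length y) (arcs D)) = y"
proof -
  let ?x = "restrict (full_length y) (arcs D)"
  have fr: "?x (p, c) = y (p, c)" if "c \<in> S" "p \<in> free_points c" for p c
    using that by (auto simp: arc_iff free_points_def full_length_def)
  have mi: "?x (Min (P c), c) = len c - (\<Sum>p\<in>free_points c. y (p, c))" if "c \<in> S" for c
    using that Min_in_P by (auto simp: arc_iff full_length_def)
  show "?x \<in> arc_lengths S l D"
    unfolding arc_lengths_iff
  proof (intro conjI ballI)
    fix c assume c: "c \<in> S"
    show "(\<Sum>p\<in>P c. ?x (p, c)) = len c" 
    proof -
      have "(\<Sum>p\<in>free_points c. ?x (p, c)) = (\<Sum>p\<in>free_points c. y (p, c))"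
        using fr[OF c] by (intro sum.cong) blast+
      then show ?thesis by (simp only: sum_P[OF c] mi[OF c])
    qed
    fix p assume p: "p \<in> P c"
    show "0 \<le> ?x (p, c)"
    proof (cases "p = Min (P c)")
      case True
      then show ?thesis using mi[OF c] assms c by (simp add: domain_iff)
    next
      case False
      then have "p \<in> free_points c" using p by (simp add: free_points_def)
      then show ?thesis using fr[OF c] assms c by (simp add: domain_iff)
    qed
  qed auto
  show "coordinates D ?x = y"
  proof (rule extensionalityI[of _ "coordinate_arcs D"])
    fix a assume a: "a \<in> coordinate_arcs D"
    obtain p c where "a = (p, c)" by (cases a)
    then show "coordinates D ?x a = y a" using fr[of c p] a coordinate_arc_iff[of p c] unfolding coordinates_def by simp
  qed (use assms in \<open>auto simp: coordinates_def domain_iff\<close>)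
qed

lemma coordinates_domain: "coordinates D ` arc_lengths S l D = domain"
proof
  show "coordinates D ` arc_lengths S l D \<subseteq> domain"
  proof (rule image_subsetI)
    fix x assume x: "x \<in> arc_lengths S l D"
    have co: "coordinates D x (q, c) = x (q, c)" if "c \<in> S" "q \<in> free_points c" for q c
      using that coordinate_arc_iff by (simp add: coordinates_def)
    show "coordinates D x \<in> domain"
      unfolding domain_iff
    proof (intro conjI ballI)
      show "coordinates D x \<in> extensional (coordinate_arcs D)" by (simp add: coordinates_def)
      fix c assume c: "c \<in> S"
      show "0 \<le> coordinates D x (p, c)" if "p \<in> free_points c" for p
        using co[OF c that] x c that by (auto simp: arc_lengths_iff free_points_def)
      have "0 \<le> x (Min (P c), c)" using x c Min_in_P by (auto simp: arc_lengths_iff)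
      moreover have "x (Min (P c), c) + (\<Sum>p\<in>free_points c. x (p, c)) = len c"
        using sum_P[OF c, of x] x c by (auto simp: arc_lengths_iff)
      ultimately show "(\<Sum>p\<in>free_points c. coordinates D x (p, c)) \<le> len c"
        using co[OF c] by simp
    qed
  qed
  show "domain \<subseteq> coordinates D ` arc_lengths S l D"
    using coordinates_full_length by (metis image_eqI subsetI)
qed

text \<open>Of two distinct points on a circle at least one is the start of a coordinate arc.
  Equality of the two lengths then expresses the coordinate of that arc through the others, which
  happens on a null set only.\<close>

lemma AE_generic:
  "AE y in PiM (coordinate_arcs D) (\<lambda>_. lborel).
     \<forall>c\<in>S. \<forall>p\<in>P c. \<forall>q\<in>P c. p \<noteq> q \<longrightarrow> full_length y (p, c) \<noteq> full_length y (q, c)"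
proof -
  let ?I = "coordinate_arcs D" and ?M = "PiM (coordinate_arcs D) (\<lambda>_. lborel :: real measure)"
  have comp: "(\<lambda>y. y a) \<in> borel_measurable ?M" if "a \<in> ?I" for a
    using measurable_component_singleton[OF that, of "\<lambda>_. lborel :: real measure"] by simp
  have free: "AE y in ?M. full_length y (p, c) \<noteq> full_length y (q, c)"
    if c: "c \<in> S" and p: "p \<in> P c" and q: "q \<in> free_points c" and pq: "p \<noteq> q" for c p q
  proof (cases "p = Min (P c)")
    case True
    \<comment> \<open>The solution for y_q of the equation that sets y_q equal to the length of the
      omitted arc. The 2 arises because y_q also enters that remainder.\<close>
    let ?h = "\<lambda>y. (len c - (\<Sum>r\<in>free_points c - {q}. y (r, c))) / 2"
    have "AE y in ?M. y (q, c) \<noteq> ?h y"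
    proof (rule AE_PiM_neq[OF finite_coordinate_arcs])
      show "(q, c) \<in> ?I" using c q coordinate_arc_iff by blast
      show "?h \<in> borel_measurable ?M"
        by (intro borel_measurable_divide borel_measurable_diff borel_measurable_sum borel_measurable_const comp)
           (use c coordinate_arc_iff in auto)
    qed (auto intro!: sum.cong)
    then show ?thesis
    proof eventually_elim
      case (elim y)
      have "(\<Sum>r\<in>free_points c. y (r, c)) = y (q, c) + (\<Sum>r\<in>free_points c - {q}. y (r, c))"
        using q finite_free_points by (intro sum.remove) auto
      then show ?case using elim True q by (auto simp: full_length_def free_points_def field_simps)
    qed
  next
    case False
    then have pf: "p \<in> free_points c" using p by (simp add: free_points_def)
    have "AE y in ?M. y (q, c) \<noteq> y (p, c)"
      by (rule AE_PiM_neq[OF finite_coordinate_arcs])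
         (use c q pf pq coordinate_arc_iff comp in auto)
    then show ?thesis
      by eventually_elim (use False q in \<open>auto simp: full_length_def free_points_def\<close>)
  qed
  have "AE y in ?M. full_length y (p, c) \<noteq> full_length y (q, c)"
    if c: "c \<in> S" and p: "p \<in> P c" and q: "q \<in> P c" and pq: "p \<noteq> q" for c p q
  proof (cases "q = Min (P c)")
    case True
    then have "p \<in> free_points c" using p pq by (simp add: free_points_def)
    from free[OF c q this pq[symmetric]] show ?thesis by eventually_elim auto
  next
    case False
    then have "q \<in> free_points c" using q by (simp add: free_points_def)
    from free[OF c p this pq] show ?thesis .
  qed
  then show ?thesis
    using S finite_P by (intro AE_finite_allI) (auto intro: AE_impI)
qed

lemma automorphism_facts:
  assumes "gluing_iso f D D"
  shows "bij_betw f (P c) (P c)" "p \<in> points D \<Longrightarrow> circles_at D (f p) = circles_at D p"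
    "inj_on f (points D)" "f ` points D = points D"
proof -
  have f: "bij_betw f (points D) (points D)" "\<And>p. p \<in> points D \<Longrightarrow> circles_at D (f p) = circles_at D p"
    using assms by (auto simp: gluing_iso_def)
  show "p \<in> points D \<Longrightarrow> circles_at D (f p) = circles_at D p" by (rule f(2))
  show i: "inj_on f (points D)" "f ` points D = points D" using f(1) by (auto simp: bij_betw_def)
  show "bij_betw f (P c) (P c)"
  proof (rule bij_betw_imageI)
    show "inj_on f (P c)" by (rule inj_on_subset[OF i(1)]) (auto simp: points_on_def)
    show "f ` P c = P c"
    proof
      show "f ` P c \<subseteq> P c" using i(2) f(2) by (auto simp: points_on_def)
      show "P c \<subseteq> f ` P c"
      proof
        fix p assume p: "p \<in> P c"
        then obtain q where "q \<in> points D" "p = f q" using i(2) by (auto simp: points_on_def)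
        then show "p \<in> f ` P c" using p f(2) by (auto simp: points_on_def)
      qed
    qed
  qed
qed

text \<open>\<open>same_constellation\<close> admits arbitrary maps, whereas
  \<open>automorphisms\<close> contains extensional ones; this passes from the former to the
  latter.\<close>

lemma gluing_iso_restrict:
  assumes "gluing_iso f D D"
  shows "gluing_iso (restrict f (points D)) D D"
proof -
  show ?thesis
    using assms succ_on_in_points[OF D] unfolding gluing_iso_def by (auto cong: bij_betw_cong)
qed

text \<open>The class is the orbit of the length assignment under the automorphisms. The orbit is
  free when lengths on a circle are pairwise distinct: automorphisms fix every circle, so if f and g
  produce the same assignment and f p = g q, then the arcs at p and q lie on a common circle and
  have equal length, whence p = q.\<close>

lemma card_iso_class:
  assumes y: "y \<in> domain"
    and gen: "\<And>c p q. c \<in> S \<Longrightarrow> p \<in> P c \<Longrightarrow> q \<in> P c \<Longrightarrow> p \<noteq> q \<Longrightarrow> full_length y (p, c) \<noteq> full_length y (q, c)"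
  shows "card (iso_class S l D y) = card (automorphisms D)"
proof -
  define x where "x = restrict (full_length y) (arcs D)"
  have x: "x \<in> arc_lengths S l D" "coordinates D x = y"
    using coordinates_full_length[OF y] by (auto simp: x_def)
  have x_unique: "x1 = x2" if "x1 \<in> arc_lengths S l D" "x2 \<in> arc_lengths S l D" "coordinates D x1 = coordinates D x2" for x1 x2
    using full_length_coordinates[OF that(1)] full_length_coordinates[OF that(2)] that(3) by metis
  \<comment> \<open>\<open>same_constellation\<close> asks for x' (f p) = x p, hence the inverse of
    f in the transported assignment.\<close>
  define mv where "mv f = restrict (\<lambda>a. x (inv_into (points D) f (fst a), snd a)) (arcs D)" for f
  have mv: "mv f (f p, c) = x (p, c)" if f: "gluing_iso f D D" and a: "(p, c) \<in> arcs D" for f p c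
  proof -
    have p: "p \<in> points D" "c \<in> circles_at D p" using a by (auto simp: arcs_def)
    have "(f p, c) \<in> arcs D" using automorphism_facts[OF f] p by (auto simp: arcs_def)
    then show ?thesis using automorphism_facts(3)[OF f] p by (simp add: mv_def)
  qed
  have mv_in: "mv f \<in> arc_lengths S l D" if f: "gluing_iso f D D" for f
    unfolding arc_lengths_iff
  proof (intro conjI ballI)
    show "mv f \<in> extensional (arcs D)" by (simp add: mv_def)
    fix c assume c: "c \<in> S"
    note b = automorphism_facts(1)[OF f, of c]
    have *: "mv f (f p, c) = x (p, c)" if "p \<in> P c" for p using mv[OF f] that c arc_iff by blast
    have "(\<Sum>p\<in>P c. mv f (p, c)) = (\<Sum>p\<in>P c. mv f (f p, c))"
      using sum.reindex_bij_betw[OF b, of "\<lambda>p. mv f (p, c)"] by simp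
    also have "\<dots> = len c" using * x(1) c by (simp add: arc_lengths_iff)
    finally show "(\<Sum>p\<in>P c. mv f (p, c)) = len c" .
    fix p assume "p \<in> P c"
    then obtain q where q: "q \<in> P c" "p = f q" using b by (auto simp: bij_betw_def)
    then show "0 \<le> mv f (p, c)" using * x(1) c by (simp add: arc_lengths_iff)
  qed
  have "iso_class S l D y = (\<lambda>f. coordinates D (mv f)) ` automorphisms D"
  proof
    show "iso_class S l D y \<subseteq> (\<lambda>f. coordinates D (mv f)) ` automorphisms D"
    proof
      fix z assume "z \<in> iso_class S l D y"
      then obtain x1 x' where z: "z = coordinates D x'" and x1: "x1 \<in> arc_lengths S l D" "coordinates D x1 = y"
        and x': "x' \<in> arc_lengths S l D" "same_constellation D x1 x'"
        unfolding iso_class_def by blast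
      have "x1 = x" using x_unique[OF x1(1) x(1)] x1(2) x(2) by simp
      then obtain f where f: "gluing_iso f D D" "\<And>p c. (p, c) \<in> arcs D \<Longrightarrow> x' (f p, c) = x (p, c)"
        using x'(2) unfolding same_constellation_def by blast
      let ?f = "restrict f (points D)"
      have iso: "gluing_iso ?f D D" by (rule gluing_iso_restrict[OF f(1)])
      have "x' = mv ?f"
      proof (rule extensionalityI[of _ "arcs D"])
        show "x' \<in> extensional (arcs D)" using x'(1) arc_lengths_iff by blast
        show "mv ?f \<in> extensional (arcs D)" by (simp add: mv_def)
        fix a assume a: "a \<in> arcs D"
        obtain p c where pc: "a = (p, c)" by (cases a)
        have c: "c \<in> S" "p \<in> P c" using a pc arc_iff by auto
        then obtain q where q: "q \<in> P c" "p = f q"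
          using automorphism_facts(1)[OF f(1), of c] by (auto simp: bij_betw_def)
        have qa: "(q, c) \<in> arcs D" using q c arc_iff by blast
        have "?f q = p" using q by (simp add: points_on_def)
        then show "x' a = mv ?f a" using mv[OF iso qa] f(2)[OF qa] q pc by simp
      qed
      then show "z \<in> (\<lambda>f. coordinates D (mv f)) ` automorphisms D"
        using iso z by (auto simp: automorphisms_def)
    qed
    show "(\<lambda>f. coordinates D (mv f)) ` automorphisms D \<subseteq> iso_class S l D y"
    proof (rule image_subsetI)
      fix f assume "f \<in> automorphisms D"
      then have f: "gluing_iso f D D" by (simp add: automorphisms_def)
      have "same_constellation D x (mv f)"
        unfolding same_constellation_def using f mv[OF f] by blast
      then show "coordinates D (mv f) \<in> iso_class S l D y"
        unfolding iso_class_def using x mv_in[OF f] by blast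
    qed
  qed
  moreover have "inj_on (\<lambda>f. coordinates D (mv f)) (automorphisms D)"
  proof (rule inj_onI)
    fix f g assume "f \<in> automorphisms D" "g \<in> automorphisms D" and eq: "coordinates D (mv f) = coordinates D (mv g)"
    then have f: "gluing_iso f D D" "f \<in> extensional (points D)" and g: "gluing_iso g D D" "g \<in> extensional (points D)"
      by (auto simp: automorphisms_def)
    have e: "mv f = mv g" by (rule x_unique[OF mv_in[OF f(1)] mv_in[OF g(1)] eq])
    show "f = g"
    proof (rule extensionalityI[OF f(2) g(2)])
      fix p assume p: "p \<in> points D"
      \<comment> \<open>One circle through p suffices for the comparison, since both automorphisms
        map its points among themselves.\<close>
      obtain c where c: "c \<in> circles_at D p" using circles_at_nonempty[OF D p] by blast
      have cS: "c \<in> S" "p \<in> P c" using p c admissibleD(2)[OF D p] by (auto simp: points_on_def)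
      have "f p \<in> P c" using bij_betw_apply[OF automorphism_facts(1)[OF f(1)] cS(2)] .
      then obtain q where q: "q \<in> P c" "f p = g q"
        using automorphism_facts(1)[OF g(1), of c] by (auto simp: bij_betw_def)
      have "x (p, c) = mv f (f p, c)" using mv[OF f(1)] cS arc_iff by simp
      also have "\<dots> = mv g (g q, c)" using e q by simp
      also have "\<dots> = x (q, c)" using mv[OF g(1)] q cS arc_iff by simp
      finally have "full_length y (p, c) = full_length y (q, c)"
        using cS q arc_iff by (simp add: x_def)
      then have "p = q" using gen[OF cS(1,2) q(1)] by blast
      then show "f p = g p" using q by simp
    qed
  qed
  ultimately show ?thesis by (simp add: card_image)
qed

text \<open>Almost everywhere the weight is the constant 1 / |Aut|. The domain is a product of
  simplices of dimension n - 1, as one arc on each circle is omitted.\<close>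

theorem gluing_volume_eq:
  "gluing_volume S l D = (\<Prod>c\<in>S. len c ^ (num_points S D c - 1) / fact (num_points S D c - 1)) / real (card (automorphisms D))"
proof -
  let ?M = "PiM (coordinate_arcs D) (\<lambda>_. lborel :: real measure)"
  let ?V = "\<Prod>c\<in>S. len c ^ (num_points S D c - 1) / fact (num_points S D c - 1)"
  have len: "len c \<ge> 0" if "c \<in> S" for c using l_pos[of "fst c" "snd c"] that by simp
  have cf: "card ((\<lambda>p. (p, c)) ` free_points c) = num_points S D c - 1" if "c \<in> S" for c
  proof -
    have "card ((\<lambda>p. (p, c)) ` free_points c) = card (free_points c)"
      by (intro card_image) (auto simp: inj_on_def)
    also have "\<dots> = num_points S D c - 1"
      using that Min_in_P[OF that] finite_P by (simp add: free_points_def num_points_def)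
    finally show ?thesis .
  qed
  have dom: "domain \<in> sets ?M" "emeasure ?M domain = ennreal ?V"
  proof -
    note e = emeasure_product_of_simplices[of S "\<lambda>c. (\<lambda>p. (p, c)) ` free_points c" len]
    show "domain \<in> sets ?M"
      unfolding domain_def coordinate_arcs_Union using e S finite_free_points len by auto
    have "emeasure ?M domain = ennreal (\<Prod>c\<in>S. len c ^ card ((\<lambda>p. (p, c)) ` free_points c) / fact (card ((\<lambda>p. (p, c)) ` free_points c)))"
      unfolding domain_def coordinate_arcs_Union using e S finite_free_points len by auto
    also have "\<dots> = ennreal ?V" using cf by (intro arg_cong[where f = ennreal] prod.cong) auto
    finally show "emeasure ?M domain = ennreal ?V" .
  qed
  have V: "?V \<ge> 0" using len by (intro prod_nonneg ballI divide_nonneg_nonneg zero_le_power) auto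
  have "(\<integral>\<^sup>+ y \<in> coordinates D ` arc_lengths S l D. ennreal (1 / real (card (iso_class S l D y))) \<partial>?M) =
    (\<integral>\<^sup>+ y. ennreal (1 / real (card (automorphisms D))) * indicator domain y \<partial>?M)"
    unfolding coordinates_domain
  proof (rule nn_integral_cong_AE)
    show "AE y in ?M. ennreal (1 / real (card (iso_class S l D y))) * indicator domain y =
        ennreal (1 / real (card (automorphisms D))) * indicator domain y"
      using AE_generic
    proof eventually_elim
      case (elim y)
      then show ?case using card_iso_class[of y] by (cases "y \<in> domain") auto
    qed
  qed
  also have "\<dots> = ennreal (1 / real (card (automorphisms D))) * ennreal ?V"
    using dom by (simp add: nn_integral_cmult_indicator)
  also have "\<dots> = ennreal (?V / real (card (automorphisms D)))"
    using V by (simp add: ennreal_mult [symmetric])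
  finally show ?thesis unfolding gluing_volume_def using V by simp
qed

end

section \<open>Traces of matrix powers\<close>

lemma sum_PiE_insert:
  fixes f :: "('i \<Rightarrow> 'a) \<Rightarrow> 'b::comm_monoid_add"
  assumes "i \<notin> I"
  shows "(\<Sum>a\<in>PiE (insert i I) X. f a) = (\<Sum>z\<in>X i. \<Sum>a\<in>PiE I X. f (a(i := z)))"
proof -
  have "(\<Sum>a\<in>PiE (insert i I) X. f a) = (\<Sum>(z, a)\<in>X i \<times> PiE I X. f (a(i := z)))"
    unfolding PiE_insert_eq
    by (subst sum.reindex[OF inj_combinator[OF assms]]) (simp add: case_prod_unfold o_def)
  then show ?thesis by (simp add: sum.cartesian_product)
qed

lemma matrix_power_Suc: "matrix_power A (Suc r) = A ** matrix_power A r"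
  by (simp add: matrix_power_def)

lemma matrix_power_0: "matrix_power A 0 = mat 1"
  by (simp add: matrix_power_def)

text \<open>The definition multiplies on the left, but the expansion into index paths extends a path
  at its end.\<close>

lemma matrix_power_Suc_right: "matrix_power A (Suc r) = matrix_power A r ** A"
  by (induction r) (simp_all add: matrix_power_Suc matrix_power_0 matrix_mul_assoc)

text \<open>The paths run through x, a 0, ..., a r. The endpoint stays a summation variable subject
  to a r = y, so that the trace can close the path by putting a r in place of x.\<close>

lemma matrix_power_entry:
  fixes A :: "complex^'n^'n"
  shows "matrix_power A (Suc r) $ x $ y = (\<Sum>a\<in>{..<Suc r} \<rightarrow>\<^sub>E UNIV.
     if a r = y then \<Prod>t<Suc r. A $ (if t = 0 then x else a (t - 1)) $ a t else 0)"
proof (induction r arbitrary: y)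
  case 0
  have "(\<Sum>a\<in>{..<Suc 0} \<rightarrow>\<^sub>E (UNIV :: 'n set). if a 0 = y then \<Prod>t<Suc 0. A $ (if t = 0 then x else a (t - 1)) $ a t else 0)
    = (\<Sum>z\<in>UNIV. \<Sum>a\<in>{} \<rightarrow>\<^sub>E (UNIV :: 'n set). if z = y then A $ x $ z else 0)"
    unfolding lessThan_Suc lessThan_0
    by (subst sum_PiE_insert) (simp, intro sum.cong refl, auto)
  then show ?case by (simp add: matrix_power_Suc matrix_power_0)
next
  case (Suc r)
  let ?F = "{..<Suc r} \<rightarrow>\<^sub>E (UNIV :: 'n set)"
  let ?p = "\<lambda>a r. \<Prod>t<Suc r. A $ (if t = 0 then x else a (t - 1)) $ a t"
  have "(\<Sum>a\<in>{..<Suc (Suc r)} \<rightarrow>\<^sub>E (UNIV :: 'n set). if a (Suc r) = y then ?p a (Suc r) else 0)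
    = (\<Sum>z\<in>UNIV. \<Sum>a\<in>?F. if z = y then ?p (a(Suc r := z)) (Suc r) else 0)"
    unfolding lessThan_Suc[of "Suc r"] by (subst sum_PiE_insert) auto
  also have "\<dots> = (\<Sum>z\<in>UNIV. if z = y then \<Sum>a\<in>?F. ?p (a(Suc r := z)) (Suc r) else 0)"
    by (intro sum.cong) auto
  also have "\<dots> = (\<Sum>a\<in>?F. ?p (a(Suc r := y)) (Suc r))"
    by simp
  also have "\<dots> = (\<Sum>a\<in>?F. ?p a r * A $ a r $ y)"
  proof (intro sum.cong refl)
    fix a
    have "(\<Prod>t<Suc r. A $ (if t = 0 then x else (a(Suc r := y)) (t - 1)) $ (a(Suc r := y)) t) = ?p a r"
      by (intro prod.cong refl) auto
    then show "?p (a(Suc r := y)) (Suc r) = ?p a r * A $ a r $ y"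
      by (subst prod.lessThan_Suc) simp
  qed
  also have "\<dots> = (\<Sum>a\<in>?F. \<Sum>v\<in>UNIV. (if a r = v then ?p a r else 0) * A $ v $ y)"
  proof (intro sum.cong refl)
    fix a :: "nat \<Rightarrow> 'n"
    have "(\<Sum>v\<in>UNIV. (if a r = v then ?p a r else 0) * A $ v $ y) = (\<Sum>v\<in>UNIV. if a r = v then ?p a r * A $ v $ y else 0)"
      by (intro sum.cong refl) simp
    then show "?p a r * A $ a r $ y = (\<Sum>v\<in>UNIV. (if a r = v then ?p a r else 0) * A $ v $ y)" by simp
  qed
  also have "\<dots> = (\<Sum>v\<in>UNIV. matrix_power A (Suc r) $ x $ v * A $ v $ y)"
    by (subst sum.swap) (simp only: Suc sum_distrib_right)
  also have "\<dots> = matrix_power A (Suc (Suc r)) $ x $ y"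
    by (subst matrix_power_Suc_right[of A "Suc r"]) (simp add: matrix_matrix_mult_def)
  finally show ?case by simp
qed

text \<open>In a closed path the row index of a factor is the column index of its cyclic
  predecessor, in agreement with \<open>prev_dart\<close>.\<close>

lemma trace_matrix_power:
  fixes A :: "complex^'n^'n"
  assumes "n > 0"
  shows "trace (matrix_power A n) = (\<Sum>a\<in>{..<n} \<rightarrow>\<^sub>E UNIV. \<Prod>t<n. A $ a (if t = 0 then n - 1 else t - 1) $ a t)"
proof -
  obtain r where n: "n = Suc r" using assms by (cases n) auto
  have "trace (matrix_power A n) = (\<Sum>x\<in>UNIV. \<Sum>a\<in>{..<Suc r} \<rightarrow>\<^sub>E UNIV.
     if a r = x then \<Prod>t<Suc r. A $ (if t = 0 then x else a (t - 1)) $ a t else 0)"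
    by (simp add: trace_def n matrix_power_entry)
  also have "\<dots> = (\<Sum>a\<in>{..<Suc r} \<rightarrow>\<^sub>E UNIV. \<Sum>x\<in>UNIV.
     if a r = x then \<Prod>t<Suc r. A $ (if t = 0 then x else a (t - 1)) $ a t else 0)"
    by (rule sum.swap)
  also have "\<dots> = (\<Sum>a\<in>{..<Suc r} \<rightarrow>\<^sub>E UNIV. \<Prod>t<Suc r. A $ (if t = 0 then a r else a (t - 1)) $ a t)"
    by (simp only: sum.delta' finite_class.finite_UNIV UNIV_I if_True)
  also have "\<dots> = (\<Sum>a\<in>{..<Suc r} \<rightarrow>\<^sub>E UNIV. \<Prod>t<Suc r. A $ a (if t = 0 then r else t - 1) $ a t)"
    by (intro sum.cong prod.cong refl) auto
  finally show ?thesis by (simp only: n diff_Suc_1)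
qed

text \<open>An index function on the darts is a family of closed index paths, one on each circle,
  and every dart carries one matrix entry.\<close>

lemma prod_trace_matrix_power:
  fixes A :: "(complex^'n^'n)^'k" and S :: "'k circle set"
  assumes S: "finite S" and n: "\<And>c. c \<in> S \<Longrightarrow> n c > 0"
  shows "(\<Prod>c\<in>S. trace (matrix_power (A $ fst c) (n c))) =
    (\<Sum>a\<in>darts S n \<rightarrow>\<^sub>E UNIV. \<Prod>r\<in>darts S n. A $ fst (fst r) $ a (prev_dart n r) $ a r)"
proof -
  let ?f = "\<lambda>c (g :: nat \<Rightarrow> 'n). \<Prod>t<n c. A $ fst c $ g (if t = 0 then n c - 1 else t - 1) $ g t"
  let ?i = "\<lambda>a. \<lambda>c\<in>S. \<lambda>t\<in>{..<n c}. a (c, t)"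
  let ?j = "\<lambda>g :: 'k circle \<Rightarrow> nat \<Rightarrow> 'n. \<lambda>r\<in>darts S n. g (fst r) (snd r)"
  have "(\<Prod>c\<in>S. trace (matrix_power (A $ fst c) (n c))) = (\<Prod>c\<in>S. \<Sum>g\<in>{..<n c} \<rightarrow>\<^sub>E UNIV. ?f c g)"
    by (intro prod.cong refl) (simp add: trace_matrix_power n)
  also have "\<dots> = (\<Sum>g\<in>PiE S (\<lambda>c. {..<n c} \<rightarrow>\<^sub>E UNIV). \<Prod>c\<in>S. ?f c (g c))"
    by (rule prod_sum_PiE) (auto simp: S intro!: finite_PiE)
  also have "\<dots> = (\<Sum>a\<in>darts S n \<rightarrow>\<^sub>E UNIV. \<Prod>r\<in>darts S n. A $ fst (fst r) $ a (prev_dart n r) $ a r)"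
  proof (rule sum.reindex_bij_witness[where i = ?i
        and j = ?j])
    fix g :: "'k circle \<Rightarrow> nat \<Rightarrow> 'n" assume g: "g \<in> PiE S (\<lambda>c. {..<n c} \<rightarrow>\<^sub>E UNIV)"
    show "?i (?j g) = g"
    proof (rule extensionalityI[of _ S])
      fix c assume c: "c \<in> S"
      show "?i (?j g) c = g c"
        by (rule extensionalityI[of _ "{..<n c}"]) (use c PiE_mem[OF g c] in \<open>auto simp: darts_def PiE_def\<close>)
    qed (use g in \<open>auto simp: PiE_def\<close>)
    show "?j g \<in> darts S n \<rightarrow>\<^sub>E UNIV" by auto
    have "(\<Prod>c\<in>S. ?f c (g c)) = (\<Prod>(c, t)\<in>darts S n. A $ fst c $ g c (if t = 0 then n c - 1 else t - 1) $ g c t)"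
      unfolding darts_def by (rule prod.Sigma) (auto simp: S)
    also have "\<dots> = (\<Prod>r\<in>darts S n. A $ fst (fst r) $ ?j g (prev_dart n r) $
        ?j g r)"
    proof (intro prod.cong refl)
      fix r assume r: "r \<in> darts S n"
      obtain c t where ct: "r = (c, t)" by (cases r)
      show "(case r of (c, t) \<Rightarrow> A $ fst c $ g c (if t = 0 then n c - 1 else t - 1) $ g c t) =
        A $ fst (fst r) $ ?j g (prev_dart n r) $ ?j g r"
        using r prev_dart_in[OF r] by (simp add: ct prev_dart_def)
    qed
    finally show "(\<Prod>r\<in>darts S n. A $ fst (fst r) $ ?j g (prev_dart n r) $
        ?j g r) = (\<Prod>c\<in>S. ?f c (g c))" by simp
  next
    fix a :: "'k circle \<times> nat \<Rightarrow> 'n" assume a: "a \<in> darts S n \<rightarrow>\<^sub>E UNIV"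
    show "?j (?i a) = a"
    proof (rule extensionalityI[of _ "darts S n"])
      fix r assume r: "r \<in> darts S n"
      obtain c t where "r = (c, t)" by (cases r)
      with r show "?j (?i a) r = a r"
        by (simp add: darts_def)
    qed (use a in \<open>auto simp: PiE_def\<close>)
    show "?i a \<in> PiE S (\<lambda>c. {..<n c} \<rightarrow>\<^sub>E UNIV)" by auto
  qed
  finally show ?thesis .
qed

text \<open>Invariant functions factor through the set of orbits, so each orbit carries one free
  index.\<close>

lemma card_functions_constant_on_orbits:
  assumes R: "finite R" and g: "bij_betw g R R"
  shows "card {a \<in> R \<rightarrow>\<^sub>E (UNIV :: 'n::finite set). \<forall>r\<in>R. a (g r) = a r} = CARD('n) ^ card (orbit g ` R)"
proof -
  let ?O = "orbit g ` R" and ?A = "{a \<in> R \<rightarrow>\<^sub>E (UNIV :: 'n set). \<forall>r\<in>R. a (g r) = a r}"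
  let ?i = "\<lambda>b :: 'a set \<Rightarrow> 'n. \<lambda>r\<in>R. b (orbit g r)"
  let ?j = "\<lambda>a :: 'a \<Rightarrow> 'n. \<lambda>Q\<in>?O. a (SOME r. r \<in> Q)"
  have self: "r \<in> orbit g r" if "r \<in> R" for r using self_in_orbit_bij_betw[OF R g that] .
  have gR: "g r \<in> R" if "r \<in> R" for r using bij_betw_apply[OF g that] .
  have sub: "orbit g r \<subseteq> R" if "r \<in> R" for r using orbit_subset_of_maps[of R g r] gR that by blast
  have const: "a s = a r" if "a \<in> ?A" "r \<in> R" "s \<in> orbit g r" for a r s
    using that(3)
  proof induction
    case base
    then show ?case using that by simp
  next
    case (step y)
    then have "y \<in> R" using sub[OF that(2)] by blast
    then show ?case using step that(1) by simp
  qed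
  have "bij_betw ?i (?O \<rightarrow>\<^sub>E (UNIV :: 'n set)) ?A"
  proof (rule bij_betw_byWitness[where f' = ?j])
    show "\<forall>b\<in>?O \<rightarrow>\<^sub>E (UNIV :: 'n set). ?j (?i b) = b"
    proof
      fix b :: "_ \<Rightarrow> 'n" assume b: "b \<in> ?O \<rightarrow>\<^sub>E UNIV"
      show "?j (?i b) = b"
      proof (rule extensionalityI[of _ ?O])
        fix Q assume Q: "Q \<in> ?O"
        then obtain r where r: "r \<in> R" "Q = orbit g r" by blast
        let ?s = "SOME r. r \<in> Q"
        have s: "?s \<in> orbit g r" using someI[of "\<lambda>s. s \<in> Q" r] self[OF r(1)] r(2) by simp
        have "orbit g ?s = orbit g r"
          using s self[OF r(1)] by (auto intro: orbit_trans orbit_swap)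
        then show "?j (?i b) Q = b Q"
          using Q s sub[OF r(1)] r(2) by auto
      qed (use b in \<open>auto simp: PiE_def\<close>)
    qed
    show "\<forall>a\<in>?A. ?i (?j a) = a"
    proof
      fix a assume a: "a \<in> ?A"
      show "?i (?j a) = a"
      proof (rule extensionalityI[of _ R])
        fix r assume r: "r \<in> R"
        have "(SOME s. s \<in> orbit g r) \<in> orbit g r" using someI[of "\<lambda>s. s \<in> orbit g r" r] self[OF r] by simp
        then show "?i (?j a) r = a r"
          using const[OF a r] r by simp
      qed (use a in \<open>auto simp: PiE_def\<close>)
    qed
    show "?i ` (?O \<rightarrow>\<^sub>E (UNIV :: 'n set)) \<subseteq> ?A"
    proof (rule image_subsetI)
      fix b :: "_ \<Rightarrow> 'n"
      show "?i b \<in> ?A" using gR self_in_orbit_step[OF self] by simp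
    qed
    show "?j ` ?A \<subseteq> ?O \<rightarrow>\<^sub>E (UNIV :: 'n set)" by auto
  qed
  then have "card ?A = card (?O \<rightarrow>\<^sub>E (UNIV :: 'n set))" by (simp add: bij_betw_same_card)
  also have "\<dots> = CARD('n) ^ card ?O" using R by (subst card_PiE) auto
  finally show ?thesis .
qed

definition colored_pairings :: "'k circle set \<Rightarrow> ('k circle \<Rightarrow> nat) \<Rightarrow> ('k circle \<times> nat \<Rightarrow> 'k circle \<times> nat) set" where
  "colored_pairings S n = {\<sigma> \<in> pairings (darts S n). \<forall>r\<in>darts S n. fst (fst r) \<noteq> fst (fst (\<sigma> r))}"

text \<open>Only the outer faces; the disc bounded by a circle is accounted for by the factor N in
  front of its trace.\<close>

definition faces :: "'k circle set \<Rightarrow> ('k circle \<Rightarrow> nat) \<Rightarrow> ('k circle \<times> nat \<Rightarrow> 'k circle \<times> nat) \<Rightarrow> nat" where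
  "faces S n \<sigma> = card (orbit (\<sigma> \<circ> next_dart n) ` darts S n)"

lemma finite_colored_pairings: "finite S \<Longrightarrow> finite (colored_pairings S n)"
  unfolding colored_pairings_def by (simp add: finite_pairings finite_darts)

text \<open>For an index function a, the Wick condition at r reads a (prev r) = a (\<sigma> r).
  Applied at \<open>next_dart n r\<close> it says that a is invariant under \<sigma> \<circ> next,
  so a colored pairing admits N^\<open>faces\<close> index functions.\<close>

lemma (in matrix_gaussian) expectation_traces:
  fixes S :: "'k circle set"
  assumes S: "finite S" and n: "\<And>c. c \<in> S \<Longrightarrow> n c > 0"
  shows "(LINT t|\<mu>. (\<Prod>c\<in>S. trace (matrix_power (T t $ fst c) (n c))) * w (T t)) =
    (\<Sum>\<sigma>\<in>colored_pairings S n. (1 / of_nat CARD('n)) ^ (card (darts S n) div 2) * of_nat CARD('n) ^ faces S n \<sigma>)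
      * (LINT t|\<mu>. w (T t))"
proof -
  let ?R = "darts S n" and ?Z = "LINT t|\<mu>. w (T t)"
  let ?e = "(1 / of_nat CARD('n) :: complex) ^ (card (darts S n) div 2)"
  let ?F = "darts S n \<rightarrow>\<^sub>E (UNIV :: 'n set)"
  let ?Q = "\<lambda>(a :: 'k circle \<times> nat \<Rightarrow> 'n) \<sigma>. \<forall>r\<in>?R. fst (fst r) \<noteq> fst (fst (\<sigma> r)) \<and> a (prev_dart n r) = a (\<sigma> r)"
  have R: "finite ?R" by (rule finite_darts[OF S])
  have F: "finite ?F" by (intro finite_PiE R) auto
  have "(LINT t|\<mu>. (\<Prod>c\<in>S. trace (matrix_power (T t $ fst c) (n c))) * w (T t)) =
    (LINT t|\<mu>. (\<Sum>a\<in>?F. (\<Prod>r\<in>?R. T t $ fst (fst r) $ a (prev_dart n r) $ a r) * w (T t)))"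
    by (simp add: prod_trace_matrix_power[OF S n] sum_distrib_right)
  also have "\<dots> = (\<Sum>a\<in>?F. LINT t|\<mu>. (\<Prod>r\<in>?R. T t $ fst (fst r) $ a (prev_dart n r) $ a r) * w (T t))"
    by (intro Bochner_Integration.integral_sum integrable_prod_linear[OF R] linear_entry)
  also have "\<dots> = (\<Sum>a\<in>?F. (\<Sum>\<sigma>\<in>pairings ?R.
      if ?Q a \<sigma> then ?e else 0) * ?Z)"
    by (intro sum.cong refl wick[OF R])
  also have "\<dots> = (\<Sum>a\<in>?F. \<Sum>\<sigma>\<in>pairings ?R.
      if ?Q a \<sigma> then ?e else 0) * ?Z"
    by (rule sum_distrib_right [symmetric])
  also have "(\<Sum>a\<in>?F. \<Sum>\<sigma>\<in>pairings ?R.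
      if ?Q a \<sigma> then ?e else 0) =
    (\<Sum>\<sigma>\<in>pairings ?R. \<Sum>a\<in>?F.
      if ?Q a \<sigma> then ?e else 0)"
    by (rule sum.swap)
  also have "\<dots> = (\<Sum>\<sigma>\<in>pairings ?R. if \<sigma> \<in> colored_pairings S n then ?e * of_nat CARD('n) ^ faces S n \<sigma> else 0)"
  proof (intro sum.cong refl)
    fix \<sigma> assume s: "\<sigma> \<in> pairings ?R"
    show "(\<Sum>a\<in>?F. if ?Q a \<sigma> then ?e else 0) =
      (if \<sigma> \<in> colored_pairings S n then ?e * of_nat CARD('n) ^ faces S n \<sigma> else 0)"
    proof (cases "\<sigma> \<in> colored_pairings S n")
      case False
      then have "\<not> (\<forall>r\<in>?R. fst (fst r) \<noteq> fst (fst (\<sigma> r)))" using s by (simp add: colored_pairings_def)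
      then have nf: "\<not> ?Q a \<sigma>" for a :: "'k circle \<times> nat \<Rightarrow> 'n"
        by blast
      then have "(\<Sum>a\<in>?F. if ?Q a \<sigma> then ?e else 0) = (\<Sum>a\<in>?F. 0)"
        by (intro sum.cong refl) (simp only: if_False)
      then show ?thesis using False by simp
    next
      case True
      have col: "\<And>r. r \<in> ?R \<Longrightarrow> fst (fst r) \<noteq> fst (fst (\<sigma> r))"
        using True unfolding colored_pairings_def by blast
      have iff: "?Q a \<sigma> \<longleftrightarrow>
        (\<forall>r\<in>?R. a ((\<sigma> \<circ> next_dart n) r) = a r)" for a :: "'k circle \<times> nat \<Rightarrow> 'n"
      proof
        assume h: "?Q a \<sigma>"
        show "\<forall>r\<in>?R. a ((\<sigma> \<circ> next_dart n) r) = a r"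
        proof
          fix r assume r: "r \<in> ?R"
          have "a (prev_dart n (next_dart n r)) = a (\<sigma> (next_dart n r))" using h next_dart_in[OF r] by blast
          then show "a ((\<sigma> \<circ> next_dart n) r) = a r" by (simp add: prev_next_dart[OF r])
        qed
      next
        assume h: "\<forall>r\<in>?R. a ((\<sigma> \<circ> next_dart n) r) = a r"
        show "?Q a \<sigma>"
        proof (intro ballI conjI col)
          fix r assume r: "r \<in> ?R"
          have "a ((\<sigma> \<circ> next_dart n) (prev_dart n r)) = a (prev_dart n r)" using h prev_dart_in[OF r] by blast
          then show "a (prev_dart n r) = a (\<sigma> r)" by (simp add: next_prev_dart[OF r])
        qed
      qed
      have "bij_betw (\<sigma> \<circ> next_dart n) ?R ?R"
        by (rule bij_betw_trans[OF bij_betw_next_dart bij_betw_pairing[OF s]])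
      then have "card {a \<in> ?F. \<forall>r\<in>?R. a ((\<sigma> \<circ> next_dart n) r) = a r} = CARD('n) ^ faces S n \<sigma>"
        unfolding faces_def by (rule card_functions_constant_on_orbits[OF R])
      moreover have "(\<Sum>a\<in>?F. if \<forall>r\<in>?R. a ((\<sigma> \<circ> next_dart n) r) = a r then ?e else 0) =
        of_nat (card {a \<in> ?F. \<forall>r\<in>?R. a ((\<sigma> \<circ> next_dart n) r) = a r}) * ?e"
        using F by (subst sum.inter_filter [symmetric]) auto
      ultimately show ?thesis using True unfolding iff by simp
    qed
  qed
  also have "\<dots> = (\<Sum>\<sigma>\<in>colored_pairings S n. ?e * of_nat CARD('n) ^ faces S n \<sigma>)"
    using finite_pairings[OF R]
    by (intro sum.mono_neutral_cong_right) (auto simp: colored_pairings_def)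
  finally show ?thesis .
qed

section \<open>Norm bounds and the series of the matrix exponential\<close>

lemma bounded_bilinear_matrix_mult:
  "bounded_bilinear ((**) :: complex^'n^'n \<Rightarrow> complex^'n^'n \<Rightarrow> complex^'n^'n)"
  unfolding bilinear_conv_bounded_bilinear [symmetric] bilinear_def linear_iff
  by (simp add: vec_eq_iff matrix_matrix_mult_def ring_distribs sum.distrib
      scaleR_conv_of_real[where 'a = complex] sum_distrib_left mult_ac)

text \<open>K bounds matrix multiplication as a bilinear map, and C absorbs the norm of the
  identity; adding 1 makes C visibly positive.\<close>

lemma matrix_power_norm_bound:
  "\<exists>K C. K > 0 \<and> C > 0 \<and> (\<forall>(A :: complex^'n^'n) r. norm (matrix_power A r) \<le> C * (K * norm A) ^ r)"
proof -
  obtain K where K0: "K > 0 \<and> (\<forall>(A :: complex^'n^'n) (B :: complex^'n^'n). norm (A ** B) \<le> norm A * norm B * K)"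
    using bounded_bilinear.pos_bounded[OF bounded_bilinear_matrix_mult[where 'n = 'n]] by blast
  have K: "K > 0" "norm (A ** B) \<le> norm A * norm B * K" for A B :: "complex^'n^'n"
    using K0 by auto
  have "norm (matrix_power A r) \<le> (norm (mat 1 :: complex^'n^'n) + 1) * (K * norm A) ^ r" for A :: "complex^'n^'n" and r
  proof (induction r)
    case 0
    show ?case unfolding matrix_power_0 power_0 mult_1_right by linarith
  next
    case (Suc r)
    have "norm (matrix_power A (Suc r)) \<le> norm A * norm (matrix_power A r) * K"
      unfolding matrix_power_Suc by (rule K(2))
    also have "\<dots> \<le> norm A * ((norm (mat 1 :: complex^'n^'n) + 1) * (K * norm A) ^ r) * K"
      using Suc K(1) by (intro mult_right_mono mult_left_mono) auto
    finally show ?case by (simp add: mult_ac)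
  qed
  moreover have "norm (mat 1 :: complex^'n^'n) + 1 > 0" by (simp add: add_nonneg_pos)
  ultimately show ?thesis using K(1) by blast
qed

lemma continuous_on_matrix_power: "continuous_on UNIV (\<lambda>A :: complex^'n^'n. matrix_power A r)"
proof (induction r)
  case 0
  then show ?case by (simp add: matrix_power_0)
next
  case (Suc r)
  show ?case unfolding matrix_power_Suc
    by (intro bounded_bilinear.continuous_on[OF bounded_bilinear_matrix_mult] continuous_on_id Suc)
qed

lemma bounded_linear_trace: "bounded_linear (trace :: complex^'n^'n \<Rightarrow> complex)"
  unfolding linear_conv_bounded_linear [symmetric] linear_iff
  by (simp add: trace_def sum.distrib scaleR_conv_of_real[where 'a = complex] sum_distrib_left)

lemma matrix_power_scaleR: "matrix_power (s *\<^sub>R A) r = (s ^ r) *\<^sub>R matrix_power (A :: complex^'n^'n) r"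
  by (induction r) (simp_all add: matrix_power_0 matrix_power_Suc vec_eq_iff matrix_matrix_mult_def
      scaleR_conv_of_real[where 'a = complex] sum_distrib_left mult_ac)

text \<open>Subtracting the identity removes the constant term, and division by s lowers the power
  of s; the index r stands for n - 1 gluing points.\<close>

lemma trace_matrix_exp_sums:
  fixes A :: "complex^'n^'n"
  assumes s: "s > 0"
  shows "(\<lambda>r. of_real (s ^ r / fact (Suc r)) * trace (matrix_power A (Suc r))) sums
     trace ((1 / s) *\<^sub>R (matrix_exp (s *\<^sub>R A) - mat 1))"
proof -
  obtain K C where KC: "K > 0" "C > 0" "\<And>(A :: complex^'n^'n) r. norm (matrix_power A r) \<le> C * (K * norm A) ^ r"
    using matrix_power_norm_bound by blast
  let ?f = "\<lambda>r. (1 / fact r) *\<^sub>R matrix_power (s *\<^sub>R A) r"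
  have "summable (\<lambda>r. C * ((K * norm (s *\<^sub>R A)) ^ r /\<^sub>R fact r))"
    by (intro summable_mult summable_exp_generic)
  then have "summable ?f"
  proof (rule summable_comparison_test'[where N = 0])
    fix r :: nat
    have "norm (?f r) = norm (matrix_power (s *\<^sub>R A) r) / fact r" by (simp add: divide_inverse mult.commute)
    also have "\<dots> \<le> C * (K * norm (s *\<^sub>R A)) ^ r / fact r"
      by (intro divide_right_mono KC(3)) auto
    finally show "norm (?f r) \<le> C * ((K * norm (s *\<^sub>R A)) ^ r /\<^sub>R fact r)" by (simp add: divide_inverse mult_ac)
  qed
  then have "?f sums matrix_exp (s *\<^sub>R A)" unfolding matrix_exp_def by (rule summable_sums)
  then have "(\<lambda>r. ?f (Suc r)) sums (matrix_exp (s *\<^sub>R A) - ?f 0)" by (subst sums_Suc_iff) simp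
  then have "(\<lambda>r. (1 / s) *\<^sub>R ?f (Suc r)) sums ((1 / s) *\<^sub>R (matrix_exp (s *\<^sub>R A) - mat 1))"
    by (intro sums_scaleR_right) (simp add: matrix_power_0)
  from bounded_linear.sums[OF bounded_linear_trace this] show ?thesis
  proof (rule sums_cong[THEN iffD1, rotated])
    fix r
    have "(1 / s) *\<^sub>R ?f (Suc r) = (s ^ r / fact (Suc r)) *\<^sub>R matrix_power A (Suc r)"
      unfolding matrix_power_scaleR using s by simp
    then show "trace ((1 / s) *\<^sub>R ?f (Suc r)) = of_real (s ^ r / fact (Suc r)) * trace (matrix_power A (Suc r))"
      
      by (simp only: linear_scale[OF bounded_linear.linear[OF bounded_linear_trace]] scaleR_conv_of_real[where 'a = complex])
  qed
qed

section \<open>Summation over types\<close>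

text \<open>Every finite subset lies in some K M, so for nonnegative terms the limit along one
  exhausting sequence bounds all finite sums and is their supremum.\<close>

lemma has_sum_nonneg_exhaustion:
  fixes f :: "'a \<Rightarrow> real"
  assumes nn: "\<And>x. x \<in> A \<Longrightarrow> 0 \<le> f x" and K: "\<And>M. finite (K M)" "incseq K" "(\<Union>M. K M) = A"
    and lim: "(\<lambda>M. sum f (K M)) \<longlonglongrightarrow> s"
  shows "(f has_sum s) A"
proof -
  have sub: "K M \<subseteq> A" for M using K(3) by blast
  have inc: "incseq (\<lambda>M. sum f (K M))"
    using incseq_SucD[OF K(2)] nn[OF subsetD[OF sub]] by (intro incseq_SucI sum_mono2 K(1)) blast+
  have le: "sum f (K M) \<le> s" for M using incseq_le[OF inc lim] .
  have fin: "sum f F \<le> s" if F: "finite F" "F \<subseteq> A" for F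
  proof -
    have "\<exists>M. F \<subseteq> K M"
      using F
    proof (induction F rule: finite_induct)
      case (insert x F)
      then obtain M1 M2 where "F \<subseteq> K M1" "x \<in> K M2" using K(3) by blast
      then have "insert x F \<subseteq> K (max M1 M2)"
        using incseqD[OF K(2), of M1 "max M1 M2"] incseqD[OF K(2), of M2 "max M1 M2"] by auto
      then show ?case by blast
    qed simp
    then obtain M where M: "F \<subseteq> K M" by blast
    have "sum f F \<le> sum f (K M)" using nn[OF subsetD[OF sub]] by (intro sum_mono2 K(1) M) blast
    then show ?thesis using le[of M] by simp
  qed
  have summ: "f summable_on A"
    by (rule nonneg_bdd_above_summable_on) (use nn fin in \<open>auto intro!: bdd_aboveI[of _ s]\<close>)
  have "infsum f A \<le> s" by (rule infsum_le_finite_sums[OF summ fin])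
  moreover have "sum f (K M) \<le> infsum f A" for M
    using finite_sum_le_infsum[OF summ K(1) sub] nn by auto
  then have "s \<le> infsum f A" by (intro LIMSEQ_le_const2[OF lim]) auto
  ultimately show ?thesis using has_sum_infsum[OF summ] by simp
qed

definition trace_term :: "('k \<Rightarrow> nat \<Rightarrow> real) \<Rightarrow> 'k circle \<Rightarrow> nat \<Rightarrow> (complex^'n^'n)^'k \<Rightarrow> complex" where
  "trace_term l c n A = of_nat CARD('n) * of_real (l (fst c) (snd c) ^ (n - 1) / fact n) *
     trace (matrix_power (A $ fst c) n)"

text \<open>All series are cut at the same M, so that the expanded product runs over the box of all
  n with values in {1..M}, and these boxes exhaust all n.\<close>

definition truncated :: "'k circle set \<Rightarrow> ('k \<Rightarrow> nat \<Rightarrow> real) \<Rightarrow> nat \<Rightarrow> (complex^'n^'n)^'k \<Rightarrow> complex" where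
  "truncated S l M A = (\<Prod>c\<in>S. \<Sum>n\<in>{1..M}. trace_term l c n A)"

lemma finite_circles: "finite (circles (m :: 'k::finite \<Rightarrow> nat))"
  by (simp add: circles_def)

lemma truncated_tendsto:
  fixes m :: "'k::finite \<Rightarrow> nat" and A :: "(complex^'n^'n)^('k::finite)"
  assumes l: "\<And>i j. (i, j) \<in> circles m \<Longrightarrow> l i j > 0"
  shows "(\<lambda>M. truncated (circles m) l M A) \<longlonglongrightarrow> trace_product m l A"
proof -
  have "(\<lambda>M. \<Sum>n\<in>{1..M}. trace_term l c n A) \<longlonglongrightarrow>
      of_nat CARD('n) * trace ((1 / l (fst c) (snd c)) *\<^sub>R (matrix_exp (l (fst c) (snd c) *\<^sub>R A $ fst c) - mat 1))"
    if c: "c \<in> circles m" for c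
  proof -
    have "l (fst c) (snd c) > 0" using l[of "fst c" "snd c"] c by simp
    from sums_mult[OF trace_matrix_exp_sums[OF this], of "of_nat CARD('n)" "A $ fst c"] show ?thesis
      unfolding sums_def trace_term_def by (simp add: sum.atLeast1_atMost_eq mult.assoc del: fact_Suc)
  qed
  then have "(\<lambda>M. truncated (circles m) l M A) \<longlonglongrightarrow>
    (\<Prod>c\<in>circles m. of_nat CARD('n) * trace ((1 / l (fst c) (snd c)) *\<^sub>R (matrix_exp (l (fst c) (snd c) *\<^sub>R A $ fst c) - mat 1)))"
    unfolding truncated_def by (intro tendsto_prod)
  then show ?thesis unfolding trace_product_def by (simp add: case_prod_unfold)
qed

text \<open>The bound does not depend on M, as dominated convergence requires: the norms of the
  terms are majorized by a multiple of the exponential series of l K |A|.\<close>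

lemma truncated_bound:
  fixes S :: "'k::finite circle set"
  assumes l: "\<And>c. c \<in> S \<Longrightarrow> l (fst c) (snd c) > 0"
  shows "\<exists>C \<kappa>. \<forall>M (A :: (complex^'n^'n)^('k::finite)). norm (truncated S l M A) \<le> C * exp (\<kappa> * norm A)"
proof -
  obtain K C where KC: "K > 0" "C > 0" "\<And>(A :: complex^'n^'n) r. norm (matrix_power A r) \<le> C * (K * norm A) ^ r"
    using matrix_power_norm_bound by blast
  obtain \<tau> where tau: "\<tau> > 0" "\<And>A :: complex^'n^'n. norm (trace A) \<le> norm A * \<tau>"
    using bounded_linear.pos_bounded[OF bounded_linear_trace] by blast
  let ?N = "real CARD('n)"
  have single: "norm (\<Sum>n\<in>{1..M}. trace_term l c n A) \<le>
      (?N * \<tau> * C / l (fst c) (snd c)) * exp (l (fst c) (snd c) * K * norm A)"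
    if c: "c \<in> S" for c M and A :: "(complex^'n^'n)^'k"
  proof -
    define s where "s = l (fst c) (snd c)"
    have s: "s > 0" using l[OF c] by (simp add: s_def)
    let ?x = "s * K * norm A"
    have x: "?x \<ge> 0" using s KC by simp
    have "norm (trace_term l c n A) \<le> (?N * \<tau> * C / s) * (?x ^ n / fact n)" if n: "n \<in> {1..M}" for n
    proof -
      have "norm (trace (matrix_power (A $ fst c) n)) \<le> norm (matrix_power (A $ fst c) n) * \<tau>" by (rule tau(2))
      also have "\<dots> \<le> (C * (K * norm (A $ fst c)) ^ n) * \<tau>"
        using KC(3) tau(1) by (intro mult_right_mono) auto
      also have "\<dots> \<le> (C * (K * norm A) ^ n) * \<tau>"
        using KC tau by (intro mult_right_mono mult_left_mono power_mono Finite_Cartesian_Product.norm_nth_le) auto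
      finally have "norm (trace_term l c n A) \<le> ?N * (s ^ (n - 1) / fact n) * ((C * (K * norm A) ^ n) * \<tau>)"
        unfolding trace_term_def norm_mult s_def [symmetric] norm_of_real norm_of_nat using s
        by (intro mult_mono) auto
      also have "\<dots> = (?N * \<tau> * C / s) * (?x ^ n / fact n)"
      proof -
        have "s ^ n = s * s ^ (n - 1)" using n by (metis One_nat_def Suc_pred atLeastAtMost_iff less_eq_Suc_le power_Suc)
        then show ?thesis using s by (simp add: power_mult_distrib)
      qed
      finally show ?thesis .
    qed
    then have "norm (\<Sum>n\<in>{1..M}. trace_term l c n A) \<le> (\<Sum>n\<in>{1..M}. (?N * \<tau> * C / s) * (?x ^ n / fact n))"
      by (rule sum_norm_le)
    also have "\<dots> = (?N * \<tau> * C / s) * (\<Sum>n\<in>{1..M}. ?x ^ n / fact n)" by (rule sum_distrib_left [symmetric])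
    also have "\<dots> \<le> (?N * \<tau> * C / s) * exp ?x"
    proof (rule mult_left_mono)
      have "(\<Sum>n\<in>{1..M}. ?x ^ n /\<^sub>R fact n) \<le> (\<Sum>n. ?x ^ n /\<^sub>R fact n)"
        by (rule sum_le_suminf[OF summable_exp_generic]) (use x in auto)
      then show "(\<Sum>n\<in>{1..M}. ?x ^ n / fact n) \<le> exp ?x" by (simp add: exp_def divide_inverse mult.commute)
      show "0 \<le> ?N * \<tau> * C / s" using tau KC s by simp
    qed
    finally show ?thesis by (simp add: s_def)
  qed
  have "norm (truncated S l M A) \<le> (\<Prod>c\<in>S. ?N * \<tau> * C / l (fst c) (snd c)) * exp ((\<Sum>c\<in>S. l (fst c) (snd c) * K) * norm A)"
    for M and A :: "(complex^'n^'n)^'k"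
  proof -
    have "norm (truncated S l M A) \<le> (\<Prod>c\<in>S. (?N * \<tau> * C / l (fst c) (snd c)) * exp (l (fst c) (snd c) * K * norm A))"
      unfolding truncated_def prod_norm [symmetric] by (intro prod_mono conjI single) auto
    also have "\<dots> = (\<Prod>c\<in>S. ?N * \<tau> * C / l (fst c) (snd c)) * exp ((\<Sum>c\<in>S. l (fst c) (snd c) * K) * norm A)"
      unfolding prod.distrib sum_distrib_right by (cases "finite S") (simp_all add: exp_sum)
    finally show ?thesis .
  qed
  then show ?thesis by blast
qed

lemma truncated_measurable [measurable]:
  "(truncated S l M :: (complex^'n^'n)^'k \<Rightarrow> complex) \<in> borel_measurable borel"
proof -
  have "continuous_on UNIV (\<lambda>A :: (complex^'n^'n)^'k. trace (matrix_power (A $ i) n))" for i n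
  proof -
    have "continuous_on UNIV (\<lambda>A :: (complex^'n^'n)^'k. matrix_power (A $ i) n)"
      by (rule continuous_on_compose2[OF continuous_on_matrix_power]) (auto intro!: continuous_intros)
    then show ?thesis by (rule bounded_linear.continuous_on[OF bounded_linear_trace])
  qed
  then have "continuous_on UNIV (truncated S l M :: (complex^'n^'n)^'k \<Rightarrow> complex)"
    unfolding truncated_def trace_term_def by (intro continuous_intros)
  then show ?thesis by (rule borel_measurable_continuous_onI)
qed

lemma trace_product_measurable:
  fixes m :: "'k::finite \<Rightarrow> nat"
  assumes l: "\<And>i j. (i, j) \<in> circles m \<Longrightarrow> l i j > 0"
  shows "(trace_product m l :: (complex^'n^'n)^('k::finite) \<Rightarrow> complex) \<in> borel_measurable borel"
  by (rule borel_measurable_LIMSEQ_metric[OF truncated_measurable truncated_tendsto[of m l, OF l]])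

text \<open>The contribution of one pairing to the quotient of the two integrals: series
  coefficients, 1 / N per pair of darts, N per free index.\<close>

definition pairing_weight :: "nat \<Rightarrow> 'k circle set \<Rightarrow> ('k \<Rightarrow> nat \<Rightarrow> real) \<Rightarrow> ('k circle \<Rightarrow> nat) \<Rightarrow>
    ('k circle \<times> nat \<Rightarrow> 'k circle \<times> nat) \<Rightarrow> real" where
  "pairing_weight N S l n \<sigma> = (\<Prod>c\<in>S. real N * (l (fst c) (snd c) ^ (n c - 1) / fact (n c))) *
     ((1 / real N) ^ (card (darts S n) div 2) * real N ^ faces S n \<sigma>)"

context matrix_gaussian
begin

lemma integrable_trace_product:
  assumes l: "\<And>i j. (i, j) \<in> circles m \<Longrightarrow> l i j > 0"
  shows "integrable \<mu> (\<lambda>t. trace_product m l (T t) * w (T t))"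
    "(\<lambda>M. LINT t|\<mu>. truncated (circles m) l M (T t) * w (T t)) \<longlonglongrightarrow> (LINT t|\<mu>. trace_product m l (T t) * w (T t))"
proof -
  have l': "\<And>c. c \<in> circles m \<Longrightarrow> l (fst c) (snd c) > 0" using l by simp
  obtain C \<kappa> where C: "\<And>M (A :: (complex^'n^'n)^'k). norm (truncated (circles m) l M A) \<le> C * exp (\<kappa> * norm A)"
    using truncated_bound[of "circles m" l, OF l'] by blast
  let ?g = "\<lambda>t. complex_of_real (C * exp (\<kappa> * norm (T t)))"
  have "integrable \<mu> (\<lambda>t. ?g t * w (T t))"
    by (rule integrable_exponential_growth[where f = "\<lambda>A. complex_of_real (C * exp (\<kappa> * norm A))" and K = "\<bar>C\<bar>" and c = \<kappa>])
       (measurable, simp add: abs_mult norm_mult)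
  then have g: "integrable \<mu> (\<lambda>t. norm (?g t * w (T t)))"
    by (rule integrable_norm)
  have lim: "(\<lambda>M. truncated (circles m) l M A) \<longlonglongrightarrow> trace_product m l A" for A :: "(complex^'n^'n)^'k"
    by (rule truncated_tendsto[of m l, OF l])
  have tp [measurable]: "(trace_product m l :: (complex^'n^'n)^'k \<Rightarrow> complex) \<in> borel_measurable borel"
    by (rule trace_product_measurable[of m l, OF l])
  have bnd: "AE t in \<mu>. norm (truncated (circles m) l M (T t) * w (T t)) \<le> norm (?g t * w (T t))" for M
  proof (rule AE_I2)
    fix t
    have "norm (truncated (circles m) l M (T t)) \<le> norm (?g t)"
      using C[of M "T t"] unfolding norm_of_real by linarith
    then show "norm (truncated (circles m) l M (T t) * w (T t)) \<le> norm (?g t * w (T t))"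
      unfolding norm_mult by (rule mult_right_mono) simp
  qed
  have limAE: "AE t in \<mu>. (\<lambda>M. truncated (circles m) l M (T t) * w (T t)) \<longlonglongrightarrow> trace_product m l (T t) * w (T t)"
    by (intro AE_I2 tendsto_mult_right lim)
  have m1: "(\<lambda>t. trace_product m l (T t) * w (T t)) \<in> borel_measurable \<mu>" by measurable
  have m2: "(\<lambda>t. truncated (circles m) l M (T t) * w (T t)) \<in> borel_measurable \<mu>" for M by measurable
  show "integrable \<mu> (\<lambda>t. trace_product m l (T t) * w (T t))"
    by (rule integrable_dominated_convergence[OF m1 m2 g limAE bnd])
  show "(\<lambda>M. LINT t|\<mu>. truncated (circles m) l M (T t) * w (T t)) \<longlonglongrightarrow> (LINT t|\<mu>. trace_product m l (T t) * w (T t))"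
    by (rule integral_dominated_convergence[OF m1 m2 g limAE bnd])
qed

lemma expectation_truncated:
  fixes S :: "'k circle set"
  assumes S: "finite S"
  shows "(LINT t|\<mu>. truncated S l M (T t) * w (T t)) =
    of_real (\<Sum>n\<in>S \<rightarrow>\<^sub>E {1..M}. \<Sum>\<sigma>\<in>colored_pairings S n. pairing_weight CARD('n) S l n \<sigma>) * (LINT t|\<mu>. w (T t))"
proof -
  let ?c = "\<lambda>n. (\<Prod>c\<in>S. of_nat CARD('n) * complex_of_real (l (fst c) (snd c) ^ (n c - 1) / fact (n c)))"
  let ?t = "\<lambda>n A. \<Prod>c\<in>S. trace (matrix_power ((A :: (complex^'n^'n)^'k) $ fst c) (n c))"
  have n0: "n c > 0" if "n \<in> S \<rightarrow>\<^sub>E {1..M}" "c \<in> S" for n c using PiE_mem[OF that] by simp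
  have expand: "truncated S l M A = (\<Sum>n\<in>S \<rightarrow>\<^sub>E {1..M}. ?c n * ?t n A)" for A :: "(complex^'n^'n)^'k"
    unfolding truncated_def trace_term_def
    by (subst prod_sum_PiE[OF S]) (simp_all only: finite_atLeastAtMost prod.distrib)
  have int: "integrable \<mu> (\<lambda>t. ?t n (T t) * w (T t))" if n: "n \<in> S \<rightarrow>\<^sub>E {1..M}" for n
  proof -
    have "integrable \<mu> (\<lambda>t. \<Sum>a\<in>darts S n \<rightarrow>\<^sub>E UNIV. (\<Prod>r\<in>darts S n. T t $ fst (fst r) $ a (prev_dart n r) $ a r) * w (T t))"
      by (intro Bochner_Integration.integrable_sum integrable_prod_linear[OF finite_darts[OF S]] linear_entry)
    moreover have "?t n (T t) = (\<Sum>a\<in>darts S n \<rightarrow>\<^sub>E UNIV. \<Prod>r\<in>darts S n. T t $ fst (fst r) $ a (prev_dart n r) $ a r)" for t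
      by (rule prod_trace_matrix_power[OF S n0[OF n]])
    ultimately show ?thesis by (simp only: sum_distrib_right)
  qed
  have "(LINT t|\<mu>. truncated S l M (T t) * w (T t)) = (LINT t|\<mu>. (\<Sum>n\<in>S \<rightarrow>\<^sub>E {1..M}. ?c n * (?t n (T t) * w (T t))))"
    unfolding expand sum_distrib_right by (simp only: mult.assoc)
  also have "\<dots> = (\<Sum>n\<in>S \<rightarrow>\<^sub>E {1..M}. ?c n * (LINT t|\<mu>. ?t n (T t) * w (T t)))"
    by (subst Bochner_Integration.integral_sum) (auto intro!: integrable_mult_right int simp del: of_real_divide of_real_power)
  also have "\<dots> = (\<Sum>n\<in>S \<rightarrow>\<^sub>E {1..M}. of_real (\<Sum>\<sigma>\<in>colored_pairings S n. pairing_weight CARD('n) S l n \<sigma>) * (LINT t|\<mu>. w (T t)))"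
  proof (intro sum.cong refl)
    fix n assume n: "n \<in> S \<rightarrow>\<^sub>E {1..M}"
    show "?c n * (LINT t|\<mu>. ?t n (T t) * w (T t)) =
      of_real (\<Sum>\<sigma>\<in>colored_pairings S n. pairing_weight CARD('n) S l n \<sigma>) * (LINT t|\<mu>. w (T t))"
    proof -
      have "(LINT t|\<mu>. ?t n (T t) * w (T t)) =
        (\<Sum>\<sigma>\<in>colored_pairings S n. (1 / of_nat CARD('n)) ^ (card (darts S n) div 2) * of_nat CARD('n) ^ faces S n \<sigma>)
          * (LINT t|\<mu>. w (T t))"
        by (rule expectation_traces[OF S n0[OF n]])
      moreover have "complex_of_real (pairing_weight CARD('n) S l n \<sigma>) = ?c n *
          ((1 / of_nat CARD('n)) ^ (card (darts S n) div 2) * of_nat CARD('n) ^ faces S n \<sigma>)" for \<sigma>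
        unfolding pairing_weight_def by simp
      ultimately show ?thesis
        by (simp only: of_real_sum sum_distrib_left [symmetric] mult.assoc)
    qed
  qed
  also have "\<dots> = of_real (\<Sum>n\<in>S \<rightarrow>\<^sub>E {1..M}. \<Sum>\<sigma>\<in>colored_pairings S n. pairing_weight CARD('n) S l n \<sigma>) * (LINT t|\<mu>. w (T t))"
    unfolding of_real_sum sum_distrib_right ..
  finally show ?thesis .
qed

text \<open>Divided by the Gaussian integral, the truncated integrals are the sums over the boxes.
  Dominated convergence gives their limit, and nonnegativity upgrades convergence along the boxes to
  summability.\<close>

lemma pairing_weight_has_sum:
  assumes l: "\<And>i j. (i, j) \<in> circles m \<Longrightarrow> l i j > 0"
  shows "\<exists>s. ((\<lambda>(n, \<sigma>). pairing_weight CARD('n) (circles m) l n \<sigma>) has_sum s)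
       (SIGMA n:circles m \<rightarrow>\<^sub>E {1..}. colored_pairings (circles m) n) \<and>
     (LINT t|\<mu>. trace_product m l (T t) * w (T t)) = of_real s * (LINT t|\<mu>. w (T t))"
proof -
  let ?S = "circles m" and ?Z = "LINT t|\<mu>. w (T t)" and ?I = "LINT t|\<mu>. trace_product m l (T t) * w (T t)"
  let ?W = "\<lambda>n \<sigma>. pairing_weight CARD('n) (circles m) l n \<sigma>"
  let ?K = "\<lambda>M. SIGMA n:?S \<rightarrow>\<^sub>E {1..M}. colored_pairings ?S n"
  have S: "finite ?S" by (rule finite_circles)
  have fin: "finite (?S \<rightarrow>\<^sub>E {1..M})" for M :: nat
    by (rule finite_PiE[OF S]) simp
  have sumK: "(\<Sum>n\<in>?S \<rightarrow>\<^sub>E {1..M}. \<Sum>\<sigma>\<in>colored_pairings ?S n. ?W n \<sigma>) = (\<Sum>(n, \<sigma>)\<in>?K M. ?W n \<sigma>)" for M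
    by (rule sum.Sigma) (use fin finite_colored_pairings[OF S] in blast)+
  have "(\<lambda>M. (of_real (\<Sum>(n, \<sigma>)\<in>?K M. ?W n \<sigma>) * ?Z) / ?Z) \<longlonglongrightarrow> ?I / ?Z"
    using integrable_trace_product(2)[of m l, OF l] unfolding expectation_truncated[OF S] sumK
    by (intro tendsto_divide tendsto_const integral_w_nonzero)
  then have lim: "(\<lambda>M. complex_of_real (\<Sum>(n, \<sigma>)\<in>?K M. ?W n \<sigma>)) \<longlonglongrightarrow> ?I / ?Z"
    using integral_w_nonzero by simp
  have lim_re: "(\<lambda>M. \<Sum>(n, \<sigma>)\<in>?K M. ?W n \<sigma>) \<longlonglongrightarrow> Re (?I / ?Z)"
    using tendsto_Re[OF lim] by simp
  \<comment> \<open>The sums are real, so their limit, the quotient of the integrals, is real as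
    well.\<close>
  have "(\<lambda>M. complex_of_real (\<Sum>(n, \<sigma>)\<in>?K M. ?W n \<sigma>)) \<longlonglongrightarrow> of_real (Re (?I / ?Z))"
    by (intro tendsto_of_real lim_re)
  then have eq: "?I / ?Z = of_real (Re (?I / ?Z))" by (rule LIMSEQ_unique[OF lim])
  have "?I = of_real (Re (?I / ?Z)) * ?Z"
    unfolding eq [symmetric] using integral_w_nonzero by simp
  moreover have "((\<lambda>(n, \<sigma>). ?W n \<sigma>) has_sum Re (?I / ?Z)) (SIGMA n:?S \<rightarrow>\<^sub>E {1..}. colored_pairings ?S n)"
  proof -
    have len: "0 \<le> l (fst c) (snd c)" if "c \<in> ?S" for c using l[of "fst c" "snd c"] that by simp
    have "0 \<le> ?W n \<sigma>" for n \<sigma>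
      unfolding pairing_weight_def
      by (intro mult_nonneg_nonneg prod_nonneg ballI divide_nonneg_nonneg zero_le_power len) simp_all
    then have nn: "0 \<le> (case x of (n, \<sigma>) \<Rightarrow> ?W n \<sigma>)" for x by (simp add: case_prod_unfold)
    have finK: "finite (?K M)" for M by (rule finite_SigmaI[OF fin finite_colored_pairings[OF S]])
    have inc: "incseq ?K"
    proof (rule incseq_SucI)
      fix M
      have "?S \<rightarrow>\<^sub>E {1..M} \<subseteq> ?S \<rightarrow>\<^sub>E {1..Suc M}" by (intro PiE_mono) auto
      then show "?K M \<subseteq> ?K (Suc M)" by (rule Sigma_mono) simp
    qed
    have "(\<Union>M::nat. ?S \<rightarrow>\<^sub>E {1..M}) = ?S \<rightarrow>\<^sub>E {1..}"
    proof
      show "(\<Union>M::nat. ?S \<rightarrow>\<^sub>E {1..M}) \<subseteq> ?S \<rightarrow>\<^sub>E {1..}"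
      proof (rule UN_least)
        fix M :: nat show "?S \<rightarrow>\<^sub>E {1..M} \<subseteq> ?S \<rightarrow>\<^sub>E {1..}" by (intro PiE_mono) auto
      qed
      show "?S \<rightarrow>\<^sub>E {1..} \<subseteq> (\<Union>M::nat. ?S \<rightarrow>\<^sub>E {1..M})"
      proof
        fix n :: "'k circle \<Rightarrow> nat" assume n: "n \<in> ?S \<rightarrow>\<^sub>E {1..}"
        \<comment> \<open>The sum of all values of n bounds each of them, so this box contains
          n.\<close>
        have "n \<in> ?S \<rightarrow>\<^sub>E {1..sum n ?S}"
        proof (rule PiE_I)
          fix c assume c: "c \<in> ?S"
          show "n c \<in> {1..sum n ?S}" using PiE_mem[OF n c] member_le_sum[OF c, of n] S by simp
        qed (use PiE_arb[OF n] in blast)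
        then show "n \<in> (\<Union>M::nat. ?S \<rightarrow>\<^sub>E {1..M})" by blast
      qed
    qed
    then have un: "(\<Union>M. ?K M) = (SIGMA n:?S \<rightarrow>\<^sub>E {1..}. colored_pairings ?S n)" by blast
    show ?thesis by (rule has_sum_nonneg_exhaustion[OF nn finK inc un lim_re])
  qed
  ultimately show ?thesis by blast
qed

end

section \<open>Isomorphism classes of gluings\<close>

definition iso_rel :: "'k circle set \<Rightarrow> ('k gluing \<times> 'k gluing) set" where
  "iso_rel S = {(D, D'). D \<in> admissible S \<and> D' \<in> admissible S \<and> (\<exists>f. gluing_iso f D D')}"

lemma gluing_iso_inv:
  assumes "D \<in> admissible S" "gluing_iso f D D'"
  shows "gluing_iso (inv_into (points D) f) D' D"
proof -
  let ?g = "inv_into (points D) f"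
  have b: "bij_betw f (points D) (points D')" using assms(2) by (simp add: gluing_iso_def)
  have gf: "?g (f p) = p" if "p \<in> points D" for p using b that by (simp add: bij_betw_def)
  show ?thesis
    unfolding gluing_iso_def
  proof (intro conjI ballI)
    show "bij_betw ?g (points D') (points D)" by (rule bij_betw_inv_into[OF b])
    fix q assume "q \<in> points D'"
    then obtain p where p: "p \<in> points D" "q = f p" using b by (auto simp: bij_betw_def)
    have f: "circles_at D' q = circles_at D p" using assms(2) p by (auto simp: gluing_iso_def)
    show "circles_at D (?g q) = circles_at D' q" using f gf p by simp
    fix c assume c: "c \<in> circles_at D' q"
    then have "succ_on D' c q = f (succ_on D c p)" using assms(2) p f by (auto simp: gluing_iso_def)
    then show "succ_on D c (?g q) = ?g (succ_on D' c q)"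
      using gf[OF succ_on_in_points[OF assms(1) p(1)]] gf[OF p(1)] p(2) c f by simp
  qed
qed

lemma gluing_iso_trans:
  assumes "gluing_iso f D D'" "gluing_iso g D' D''"
  shows "gluing_iso (g \<circ> f) D D''"
  unfolding gluing_iso_def
proof (intro conjI ballI)
  have f: "bij_betw f (points D) (points D')" "bij_betw g (points D') (points D'')"
    using assms by (auto simp: gluing_iso_def)
  show "bij_betw (g \<circ> f) (points D) (points D'')" by (rule bij_betw_trans[OF f])
  fix p assume p: "p \<in> points D"
  have q: "f p \<in> points D'" by (rule bij_betw_apply[OF f(1) p])
  show "circles_at D'' ((g \<circ> f) p) = circles_at D p" using assms p q by (simp add: gluing_iso_def)
  fix c assume "c \<in> circles_at D p"
  then show "succ_on D'' c ((g \<circ> f) p) = (g \<circ> f) (succ_on D c p)" using assms p q by (simp add: gluing_iso_def)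
qed

lemma equiv_iso_rel: "equiv (admissible S) (iso_rel S)"
proof (rule equivI)
  show "iso_rel S \<subseteq> admissible S \<times> admissible S" by (auto simp: iso_rel_def)
  have "gluing_iso id D D" for D :: "'a gluing" by (simp add: gluing_iso_def)
  then show "refl_on (admissible S) (iso_rel S)" by (auto simp: refl_on_def iso_rel_def)
  show "sym (iso_rel S)" by (rule symI) (auto simp: iso_rel_def dest: gluing_iso_inv)
  show "trans (iso_rel S)" by (rule transI) (auto simp: iso_rel_def dest: gluing_iso_trans)
qed

lemma topological_types_eq: "topological_types S = admissible S // iso_rel S"
  by (simp add: topological_types_def iso_rel_def)

lemma type_representative:
  assumes "C \<in> topological_types S"
  shows "(SOME D. D \<in> C) \<in> C" "(SOME D. D \<in> C) \<in> admissible S"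
proof -
  obtain D where D: "D \<in> admissible S" "C = iso_rel S `` {D}"
    using assms unfolding topological_types_eq by (rule quotientE)
  have "D \<in> C" using equiv_class_self[OF equiv_iso_rel D(1)] D(2) by simp
  then show 1: "(SOME D. D \<in> C) \<in> C" by (rule someI)
  show "(SOME D. D \<in> C) \<in> admissible S" using 1 D(2) by (auto simp: iso_rel_def)
qed

lemma pairings_of_subset:
  assumes "D \<in> admissible S"
  shows "pairings_of S D \<subseteq> colored_pairings S (num_points S D)"
proof
  fix \<sigma> assume "\<sigma> \<in> pairings_of S D"
  then obtain \<pi> where p: "labelling S (num_points S D) D \<pi>" "compatible S (num_points S D) \<pi> \<sigma>"
    by (auto simp: pairings_of_def)
  show "\<sigma> \<in> colored_pairings S (num_points S D)"
    using p(2) compatible_colors(1)[OF assms p] by (simp add: colored_pairings_def compatible_def)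
qed

lemma euler_char_pairings_of:
  assumes "finite S" "D \<in> admissible S" "\<sigma> \<in> pairings_of S D"
  shows "euler_char S D = int (card S) - int (card (darts S (num_points S D)) div 2) + int (faces S (num_points S D) \<sigma>)"
  using assms euler_char_labelling[OF assms(1,2)] unfolding faces_def pairings_of_def by blast

text \<open>Injectivity: n and \<sigma> determine the gluing up to isomorphism, by
  \<open>iso_of_labellings\<close>. Surjectivity: \<open>gluing_of_pairing\<close> realizes every
  colored pairing, and transporting its labelling along an isomorphism reaches the chosen
  representative of the type.\<close>

lemma bij_betw_types_pairings:
  fixes S :: "'k circle set"
  assumes S: "finite S"
  shows "bij_betw (\<lambda>(C, \<sigma>). (num_points S (SOME D. D \<in> C), \<sigma>))
     (SIGMA C:topological_types S. pairings_of S (SOME D. D \<in> C))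
     (SIGMA n:S \<rightarrow>\<^sub>E {1..}. colored_pairings S n)"
proof (rule bij_betw_imageI)
  let ?rep = "\<lambda>C :: 'k gluing set. SOME D. D \<in> C"
  let ?X = "SIGMA C:topological_types S. pairings_of S (?rep C)"
  let ?Y = "SIGMA n:S \<rightarrow>\<^sub>E {1..}. colored_pairings S n"
  let ?f = "\<lambda>(C, \<sigma>). (num_points S (?rep C), \<sigma>)"
  show "inj_on ?f ?X"
  proof (rule inj_onI)
    fix x y assume x: "x \<in> ?X" and y: "y \<in> ?X" and eq: "?f x = ?f y"
    obtain C \<sigma> where xC: "x = (C, \<sigma>)" by (cases x)
    obtain C' \<sigma>' where yC: "y = (C', \<sigma>')" by (cases y)
    have s: "\<sigma>' = \<sigma>" "num_points S (?rep C) = num_points S (?rep C')" using eq xC yC by auto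
    have C: "C \<in> topological_types S" "\<sigma> \<in> pairings_of S (?rep C)"
      "C' \<in> topological_types S" "\<sigma> \<in> pairings_of S (?rep C')" using x y xC yC s by auto
    obtain \<pi> where p: "labelling S (num_points S (?rep C)) (?rep C) \<pi>" "compatible S (num_points S (?rep C)) \<pi> \<sigma>"
      using C(2) by (auto simp: pairings_of_def)
    obtain \<pi>' where p': "labelling S (num_points S (?rep C)) (?rep C') \<pi>'" "compatible S (num_points S (?rep C)) \<pi>' \<sigma>"
      using C(4) s(2) by (auto simp: pairings_of_def)
    note r = type_representative[OF C(1)] and r' = type_representative[OF C(3)]
    have "(?rep C, ?rep C') \<in> iso_rel S"
      using iso_of_labellings[OF r(2) p r'(2) p'] r(2) r'(2) by (auto simp: iso_rel_def)
    then have "C = C'"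
      using quotient_eq_iff[OF equiv_iso_rel, of C S C' "?rep C" "?rep C'"] C(1,3) r(1) r'(1)
      unfolding topological_types_eq by blast
    then show "x = y" using xC yC s by simp
  qed
  show "?f ` ?X = ?Y"
  proof
    show "?f ` ?X \<subseteq> ?Y"
    proof (rule image_subsetI)
      fix x assume x: "x \<in> ?X"
      obtain C \<sigma> where xC: "x = (C, \<sigma>)" by (cases x)
      have C: "C \<in> topological_types S" "\<sigma> \<in> pairings_of S (?rep C)" using x xC by auto
      note r = type_representative(2)[OF C(1)]
      show "?f x \<in> ?Y" using num_points_in[OF r] subsetD[OF pairings_of_subset[OF r] C(2)] xC by simp
    qed
    show "?Y \<subseteq> ?f ` ?X"
    proof
      fix y assume y: "y \<in> ?Y"
      obtain n \<sigma> where yn: "y = (n, \<sigma>)" by (cases y)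
      have n: "n \<in> S \<rightarrow>\<^sub>E {1..}" and s: "\<sigma> \<in> pairings (darts S n)"
        and col: "\<And>r. r \<in> darts S n \<Longrightarrow> fst (fst r) \<noteq> fst (fst (\<sigma> r))"
        using y unfolding yn colored_pairings_def by blast+
      obtain D \<pi> where D: "D \<in> admissible S" "labelling S n D \<pi>" "compatible S n \<pi> \<sigma>"
        using gluing_of_pairing[OF S n s col] by blast
      define C where "C = iso_rel S `` {D}"
      have C: "C \<in> topological_types S" unfolding C_def topological_types_eq by (rule quotientI[OF D(1)])
      note r = type_representative[OF C]
      have "(D, ?rep C) \<in> iso_rel S" using r(1) unfolding C_def by blast
      then obtain f where f: "gluing_iso f D (?rep C)" by (auto simp: iso_rel_def)
      note lab = labelling_iso[OF D(2) f]
      have nn: "n = num_points S (?rep C)" by (rule labelling_num_points_eq[OF lab n])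
      have "\<sigma> \<in> pairings_of S (?rep C)"
        unfolding pairings_of_def using lab compatible_iso[OF D(3), of f] unfolding nn by blast
      then show "y \<in> ?f ` ?X"
        using C nn yn by (intro image_eqI[of _ _ "(C, \<sigma>)"]) auto
    qed
  qed
qed

text \<open>All pairings of a gluing have the same weight, since the Euler characteristic fixes
  their number of faces. Their number supplies one factor n per circle, which turns 1 / n! from the
  exponential series into 1 / (n - 1)! from the simplex.\<close>

lemma F_term_eq_sum_pairings:
  fixes m :: "'k::{finite,linorder} \<Rightarrow> nat"
  assumes N: "N > 0" and l: "\<And>i j. (i, j) \<in> circles m \<Longrightarrow> l i j > 0" and C: "C \<in> topological_types (circles m)"
  shows "F_term N m l C = (\<Sum>\<sigma>\<in>pairings_of (circles m) (SOME D. D \<in> C).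
     pairing_weight N (circles m) l (num_points (circles m) (SOME D. D \<in> C)) \<sigma>)"
proof -
  let ?S = "circles m"
  define D where "D = (SOME D. D \<in> C)"
  define n where "n = num_points ?S D"
  have D: "D \<in> admissible ?S" unfolding D_def by (rule type_representative(2)[OF C])
  have S: "finite ?S" by (rule finite_circles)
  interpret glued_circles ?S l D by standard (use S l D in auto)
  have n1: "n c > 0" if "c \<in> ?S" for c using PiE_mem[OF num_points_in[OF D] that] by (simp add: n_def)
  have card: "card (pairings_of ?S D) * card (automorphisms D) = (\<Prod>c\<in>?S. n c)"
    unfolding n_def by (rule card_pairings_of[OF S D])
  \<comment> \<open>The product on the right of \<open>card\<close> is positive, so neither factor
    on the left vanishes.\<close>
  have aut: "card (automorphisms D) > 0"
    using card n1 S by (metis (no_types, lifting) bot_nat_0.not_eq_extremum mult_0_right prod_zero_iff)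
  let ?L = "\<Prod>c\<in>?S. len c ^ (n c - 1) / fact (n c)"
  have w: "pairing_weight N ?S l n \<sigma> = ?L * real N powi euler_char ?S D" if s: "\<sigma> \<in> pairings_of ?S D" for \<sigma>
  proof -
    \<comment> \<open>The power N^(card S) of the inner discs is formed by the factors N of the
      traces.\<close>
    have e: "real N powi euler_char ?S D = real N ^ card ?S * ((1 / real N) ^ (card (darts ?S n) div 2) * real N ^ faces ?S n \<sigma>)"
      unfolding euler_char_pairings_of[OF S D s] n_def [symmetric] using N
      by (simp add: power_int_add power_int_diff power_one_over power_inverse divide_inverse)
    show ?thesis unfolding e pairing_weight_def prod.distrib prod_constant by (simp only: mult_ac)
  qed
  have "(\<Prod>c\<in>?S. len c ^ (n c - 1) / fact (n c - 1)) = real (\<Prod>c\<in>?S. n c) * ?L"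
    unfolding of_nat_prod prod.distrib [symmetric]
  proof (intro prod.cong refl)
    fix c assume c: "c \<in> ?S"
    have "fact (n c) = real (n c) * fact (n c - 1)" using n1[OF c] by (simp add: fact_reduce)
    then show "len c ^ (n c - 1) / fact (n c - 1) = real (n c) * (len c ^ (n c - 1) / fact (n c))"
      using n1[OF c] by simp
  qed
  then have vol: "gluing_volume ?S l D = real (card (pairings_of ?S D)) * ?L"
    unfolding gluing_volume_eq n_def [symmetric] card [symmetric] using aut by simp
  have "F_term N m l C = gluing_volume ?S l D * real N powi euler_char ?S D"
    by (simp add: F_term_def type_volume_def type_euler_def D_def)
  also have "\<dots> = (\<Sum>\<sigma>\<in>pairings_of ?S D. pairing_weight N ?S l n \<sigma>)"
    unfolding vol using w by simp
  finally show ?thesis by (simp add: D_def n_def)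
qed

theorem theorem7:
  fixes m :: "'k::{finite,linorder} \<Rightarrow> nat"
    and l :: "'k \<Rightarrow> nat \<Rightarrow> real"
    and lam :: "((complex^'n^'n)^('k::{finite,linorder})) measure"
  assumes "CARD('k) \<ge> 2"
    and "\<And>i j. (i, j) \<in> circles m \<Longrightarrow> l i j > 0"
    and "lebesgue_measure_on E_space lam"
  shows "F_term CARD('n) m l summable_on topological_types (circles m)
       \<and> integrable lam (\<lambda>A. trace_product m l A * gauss_weight A)
       \<and> integrable lam gauss_weight
       \<and> (LINT A|lam. gauss_weight A) \<noteq> 0
       \<and> complex_of_real (F CARD('n) m l) =
           (LINT A|lam. trace_product m l A * gauss_weight A) / (LINT A|lam. gauss_weight A)"
proof -
  let ?S = "circles m"
  note l = assms(2)
  obtain B :: "((complex^'n^'n)^('k::{finite,linorder})) set" where B: "independent B" "span B = E_space"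
    "lam = distr (\<Pi>\<^sub>M b\<in>B. lborel) (restrict_space borel E_space) (\<lambda>t. \<Sum>b\<in>B. t b *\<^sub>R b)"
    using assms(3) unfolding lebesgue_measure_on_def by blast
  interpret matrix_gaussian B by standard (use assms(1) B in auto)
  \<comment> \<open>The given Lebesgue measure is an image of the product measure, so all integrals
    over \<open>E_space\<close> are pulled back to the coefficients.\<close>
  have lam: "lam = distr \<mu> (restrict_space borel E_space) T"
    unfolding B(3) T_def [abs_def] ..
  have T: "T \<in> measurable \<mu> (restrict_space borel E_space)"
    by (rule measurable_restrict_space2) (use T_in_span B(2) in auto)
  have wm: "gauss_weight \<in> borel_measurable (restrict_space borel (E_space :: ((complex^'n^'n)^('k::{finite,linorder})) set))"
    using w_measurable unfolding w_eq by (rule measurable_restrict_space1)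
  have tm: "(\<lambda>A. trace_product m l A * gauss_weight A) \<in> borel_measurable (restrict_space borel (E_space :: ((complex^'n^'n)^('k::{finite,linorder})) set))"
    by (intro borel_measurable_times wm measurable_restrict_space1 trace_product_measurable l)
  have i1: "integrable lam (\<lambda>A. trace_product m l A * gauss_weight A)"
    unfolding lam integrable_distr_eq[OF T tm] using integrable_trace_product(1)[of m l, OF l] by (simp add: w_eq)
  have i2: "integrable lam gauss_weight"
    unfolding lam integrable_distr_eq[OF T wm]
    using integrable_exponential_growth[of "\<lambda>_. 1" 1 0] by (simp add: w_eq)
  have e1: "(LINT A|lam. trace_product m l A * gauss_weight A) = (LINT t|\<mu>. trace_product m l (T t) * w (T t))"
    unfolding lam integral_distr[OF T tm] by (simp add: w_eq)
  have e2: "(LINT A|lam. gauss_weight A) = (LINT t|\<mu>. w (T t))"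
    unfolding lam integral_distr[OF T wm] by (simp add: w_eq)
  obtain s where s: "((\<lambda>(n, \<sigma>). pairing_weight CARD('n) ?S l n \<sigma>) has_sum s) (SIGMA n:?S \<rightarrow>\<^sub>E {1..}. colored_pairings ?S n)"
    "(LINT t|\<mu>. trace_product m l (T t) * w (T t)) = of_real s * (LINT t|\<mu>. w (T t))"
    using pairing_weight_has_sum[of m l, OF l] by blast
  have "((\<lambda>(C, \<sigma>). pairing_weight CARD('n) ?S l (num_points ?S (SOME D. D \<in> C)) \<sigma>) has_sum s)
      (SIGMA C:topological_types ?S. pairings_of ?S (SOME D. D \<in> C))"
    using has_sum_reindex_bij_betw[OF bij_betw_types_pairings[OF finite_circles[of m]],
        of "\<lambda>(n, \<sigma>). pairing_weight CARD('n) ?S l n \<sigma>" s] s(1)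
    by (simp add: case_prod_unfold)
  \<comment> \<open>The sum over pairings is grouped by types; each inner sum is finite and equals
    the term of its type.\<close>
  then have Fs: "(F_term CARD('n) m l has_sum s) (topological_types ?S)"
  proof (rule has_sum_SigmaD)
    fix C assume C: "C \<in> topological_types ?S"
    have "finite (pairings_of ?S (SOME D. D \<in> C))"
      by (rule finite_subset[OF pairings_of_subset[OF type_representative(2)[OF C]]
            finite_colored_pairings[OF finite_circles[of m]]])
    then show "((\<lambda>\<sigma>. case (C, \<sigma>) of (C, \<sigma>) \<Rightarrow> pairing_weight CARD('n) ?S l (num_points ?S (SOME D. D \<in> C)) \<sigma>) has_sum
        F_term CARD('n) m l C) (pairings_of ?S (SOME D. D \<in> C))"
      using F_term_eq_sum_pairings[of "CARD('n)" m l C, OF _ l C] by (simp add: has_sum_finite)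
  qed
  have "F CARD('n) m l = s" unfolding F_def using Fs by (rule infsumI)
  then show ?thesis
    using i1 i2 has_sum_imp_summable[OF Fs] integral_w_nonzero unfolding e1 e2 s(2) by simp
qed

end
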